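(* Let $\Phi$ be a Young function with $\Phi\in\Delta_2$. For a proper convex function $f$ on $L_{\Phi^*}$, the following are equivalent: (1) $f$ is $\sigma(L_{\Phi^*},L_\Phi)$-lower semicontinuous, or equivalently $f(\xi)=\sup_{\eta\in L_\Phi}(\mathbb E[\eta\xi]-f^*(\eta))$ for all $\xi\in L_{\Phi^*}$; (2) $f$ is sequentially $\tau(L_{\Phi^*},L_\Phi)$-lower semicontinuous; (3) $f$ is lower semicontinuous for the topology $\tau_{L_0}$ on every order interval $[-\zeta,\zeta]$, $\zeta\in L_{\Phi^*}$, or equivalently $f$ is order lower semicontinuous: $f(\xi)\le\liminf_n f(\xi_n)$ whenever $\xi_n\to\xi$ a.s. and $(\xi_n)_n$ is order bounded in $L_{\Phi^*}$.
   Context: $(\Omega,\mathcal F,\mathbb P)$ is a probability space, $L_0$ is the space of $\mathbb P$-a.s. equivalence classes of finite real measurable functions, with the topology $\tau_{L_0}$ of convergence in probability; $\mathbb E$ is expectation. A (finite coercive) Young function is an even convex function $\Phi:\mathbb R\to\mathbb R$ with $\Phi(0)=0$ and $\lim_{x\to+\infty}\Phi(x)/x=+\infty$; its conjugate $\Phi^*(y)=\sup_x(xy-\Phi(x))$ is again such a function. $\Phi\in\Delta_2$ means $\limsup_{x\to\infty}\Phi(2x)/\Phi(x)<\infty$. For a Young function $\Psi$, $\mathbb B_\Psi=\{\xi\in L_0:\mathbb E[\Psi(\xi)]\le 1\}$, and the Orlicz space is $L_\Psi=\bigcup_{\lambda>0}\lambda\mathbb B_\Psi$ with norm $\|\xi\|_\Psi=\inf\{\lambda>0:\xi\in\lambda\mathbb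 B_\Psi\}$ and the a.s. pointwise order. $\sigma(L_{\Phi^*},L_\Phi)$ and $\tau(L_{\Phi^*},L_\Phi)$ are the weak and Mackey topologies on $L_{\Phi^*}$ for the duality $\langle\eta,\xi\rangle=\mathbb E[\eta\xi]$, $\eta\in L_\Phi$, $\xi\in L_{\Phi^*}$. Order interval: $[-\zeta,\zeta]=\{\xi:-\zeta\le\xi\le\zeta \text{ a.s.}\}$. A sequence $(\xi_n)_n$ is order bounded in $L_{\Phi^*}$ if $\sup_n|\xi_n|\in L_{\Phi^*}$. A proper convex function is a convex $f:L_{\Phi^*}\to\mathbb R\cup\{+\infty\}$, not identically $+\infty$; $f^*(\eta)=\sup_{\xi\in L_{\Phi^*}}(\mathbb E[\eta\xi]-f(\xi))$ for $\eta\in L_\Phi$. Sequentially $\tau$-lower semicontinuous means $f(\xi)\le\liminf_nf(\xi_n)$ for every sequence $\xi_n\to\xi$ in $\tau$. *)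

theory Defs
  imports "HOL-Probability.Probability"
begin

section \<open>Young functions\<close>

definition young_function :: "(real \<Rightarrow> real) \<Rightarrow> bool" where
  "young_function \<Phi> \<longleftrightarrow>
     (\<forall>x. \<Phi> (- x) = \<Phi> x) \<and> convex_on UNIV \<Phi> \<and> \<Phi> 0 = 0 \<and>
     filterlim (\<lambda>x. \<Phi> x / x) at_top at_top"

text \<open>For a Young function the supremum is over a set that is bounded above, by coercivity,
  so that the real-valued \<open>SUP\<close> is the true supremum.\<close>

definition young_conjugate :: "(real \<Rightarrow> real) \<Rightarrow> real \<Rightarrow> real" where
  "young_conjugate \<Phi> y = (SUP x. x * y - \<Phi> x)"

text \<open>A Young function is eventually positive, so the quotient is meaningful near infinity.\<close>

definition Delta2 :: "(real \<Rightarrow> real) \<Rightarrow> bool" where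
  "Delta2 \<Phi> \<longleftrightarrow> Limsup at_top (\<lambda>x. ereal (\<Phi> (2 * x) / \<Phi> x)) < \<infinity>"

section \<open>Orlicz spaces\<close>

text \<open>Elements of \<open>L\<^sub>0\<close> and of the Orlicz spaces are represented, as for the Lebesgue integral, by
  measurable functions. All notions below are invariant under a.s. equality; a function \<open>f\<close> on a
  space of a.s. equivalence classes is a function on representatives that satisfies
  \<open>ae_invariant_on\<close>. The topologies on representatives are the pullbacks of the topologies on
  classes, so that their open sets are saturated for a.s. equality.\<close>

definition ae_invariant_on :: "'a measure \<Rightarrow> ('a \<Rightarrow> real) set \<Rightarrow> (('a \<Rightarrow> real) \<Rightarrow> 'b) \<Rightarrow> bool" where
  "ae_invariant_on M E f \<longleftrightarrow>
     (\<forall>\<xi>\<in>E. \<forall>\<xi>'\<in>E. (AE \<omega> in M. \<xi> \<omega> = \<xi>' \<omega>) \<longrightarrow> f \<xi> = f \<xi>')"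

definition orlicz_ball :: "'a measure \<Rightarrow> (real \<Rightarrow> real) \<Rightarrow> ('a \<Rightarrow> real) set" where
  "orlicz_ball M \<Psi> = {\<xi> \<in> borel_measurable M. (\<integral>\<^sup>+ \<omega>. ennreal (\<Psi> (\<xi> \<omega>)) \<partial>M) \<le> 1}"

definition orlicz_space :: "'a measure \<Rightarrow> (real \<Rightarrow> real) \<Rightarrow> ('a \<Rightarrow> real) set" where
  "orlicz_space M \<Psi> = (\<Union>l\<in>{0<..}. (\<lambda>\<xi> \<omega>. l * \<xi> \<omega>) ` orlicz_ball M \<Psi>)"

definition order_interval :: "'a measure \<Rightarrow> ('a \<Rightarrow> real) \<Rightarrow> ('a \<Rightarrow> real) set" where
  "order_interval M \<zeta> = {\<xi> \<in> borel_measurable M. AE \<omega> in M. - \<zeta> \<omega> \<le> \<xi> \<omega> \<and> \<xi> \<omega> \<le> \<zeta> \<omega>}"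

text \<open>The supremum of a sequence in \<open>L\<^sub>0\<close> is a priori only extended real valued, hence \<open>ereal\<close>.\<close>

definition order_bounded_in :: "'a measure \<Rightarrow> ('a \<Rightarrow> real) set \<Rightarrow> (nat \<Rightarrow> 'a \<Rightarrow> real) \<Rightarrow> bool" where
  "order_bounded_in M E \<xi> \<longleftrightarrow>
     (\<exists>\<zeta>\<in>E. AE \<omega> in M. (SUP n. ereal \<bar>\<xi> n \<omega>\<bar>) = ereal (\<zeta> \<omega>))"

section \<open>Topologies\<close>

text \<open>Convergence in probability, metrised on classes by \<open>E[min \<bar>\<xi> - \<xi>\<^sub>0\<bar> 1]\<close>.\<close>

definition L0_topology :: "'a measure \<Rightarrow> ('a \<Rightarrow> real) topology" where
  "L0_topology M = topology_generated_by
     {{\<xi> \<in> borel_measurable M. (\<integral>\<omega>. min \<bar>\<xi> \<omega> - \<xi>\<^sub>0 \<omega>\<bar> 1 \<partial>M) < \<epsilon>} | \<xi>\<^sub>0 \<epsilon>.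
        \<xi>\<^sub>0 \<in> borel_measurable M \<and> 0 < \<epsilon>}"

definition pairing :: "'a measure \<Rightarrow> ('a \<Rightarrow> real) \<Rightarrow> ('a \<Rightarrow> real) \<Rightarrow> real" where
  "pairing M \<eta> \<xi> = (\<integral>\<omega>. \<eta> \<omega> * \<xi> \<omega> \<partial>M)"

text \<open>\<open>weak_topology M E F\<close> is \<open>\<sigma>(E, F)\<close>, a topology on \<open>E\<close>.\<close>

definition weak_topology ::
  "'a measure \<Rightarrow> ('a \<Rightarrow> real) set \<Rightarrow> ('a \<Rightarrow> real) set \<Rightarrow> ('a \<Rightarrow> real) topology" where
  "weak_topology M E F = topology_generated_by
     {{\<xi> \<in> E. pairing M \<eta> \<xi> \<in> U} | \<eta> U. \<eta> \<in> F \<and> open U}"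

definition absolutely_convex :: "('a \<Rightarrow> real) set \<Rightarrow> bool" where
  "absolutely_convex K \<longleftrightarrow>
     (\<forall>\<eta>\<in>K. \<forall>\<eta>'\<in>K. \<forall>a b. \<bar>a\<bar> + \<bar>b\<bar> \<le> 1 \<longrightarrow> (\<lambda>\<omega>. a * \<eta> \<omega> + b * \<eta>' \<omega>) \<in> K)"

text \<open>\<open>mackey_topology M E F\<close> is \<open>\<tau>(E, F)\<close>, a topology on \<open>E\<close>: uniform convergence on the
  absolutely convex \<open>\<sigma>(F, E)\<close>-compact subsets \<open>K\<close> of \<open>F\<close>. It is generated by the open balls of the
  seminorms \<open>sup\<^sub>\<eta>\<^sub>\<in>\<^sub>K \<bar>E[\<eta>\<xi>]\<bar>\<close>; as \<open>K\<close> is compact this supremum is attained for nonempty \<open>K\<close>,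
  so that the strict inequality may be required pointwise.\<close>

definition mackey_topology ::
  "'a measure \<Rightarrow> ('a \<Rightarrow> real) set \<Rightarrow> ('a \<Rightarrow> real) set \<Rightarrow> ('a \<Rightarrow> real) topology" where
  "mackey_topology M E F = topology_generated_by
     {{\<xi> \<in> E. \<forall>\<eta>\<in>K. \<bar>pairing M \<eta> (\<lambda>\<omega>. \<xi> \<omega> - \<xi>\<^sub>0 \<omega>)\<bar> < \<epsilon>} | K \<xi>\<^sub>0 \<epsilon>.
        compactin (weak_topology M F E) K \<and> absolutely_convex K \<and> \<xi>\<^sub>0 \<in> E \<and> 0 < \<epsilon>}"

section \<open>Convex functions and lower semicontinuity\<close>

definition proper_convex_on :: "('a \<Rightarrow> real) set \<Rightarrow> (('a \<Rightarrow> real) \<Rightarrow> ereal) \<Rightarrow> bool" where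
  "proper_convex_on E f \<longleftrightarrow>
     (\<forall>\<xi>\<in>E. f \<xi> \<noteq> - \<infinity>) \<and> (\<exists>\<xi>\<in>E. f \<xi> \<noteq> \<infinity>) \<and>
     (\<forall>\<xi>\<in>E. \<forall>\<xi>'\<in>E. \<forall>t. 0 < t \<and> t < 1 \<longrightarrow>
        f (\<lambda>\<omega>. t * \<xi> \<omega> + (1 - t) * \<xi>' \<omega>) \<le> ereal t * f \<xi> + ereal (1 - t) * f \<xi>')"

definition convex_conjugate ::
  "'a measure \<Rightarrow> ('a \<Rightarrow> real) set \<Rightarrow> (('a \<Rightarrow> real) \<Rightarrow> ereal) \<Rightarrow> ('a \<Rightarrow> real) \<Rightarrow> ereal" where
  "convex_conjugate M E f \<eta> = (SUP \<xi>\<in>E. ereal (pairing M \<eta> \<xi>) - f \<xi>)"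

definition lower_semicontinuous :: "'b topology \<Rightarrow> ('b \<Rightarrow> ereal) \<Rightarrow> bool" where
  "lower_semicontinuous X f \<longleftrightarrow> (\<forall>c::real. openin X {x \<in> topspace X. ereal c < f x})"

definition seq_lower_semicontinuous :: "'b topology \<Rightarrow> ('b \<Rightarrow> ereal) \<Rightarrow> bool" where
  "seq_lower_semicontinuous X f \<longleftrightarrow>
     (\<forall>x x'. range x \<subseteq> topspace X \<and> limitin X x x' sequentially \<longrightarrow>
        f x' \<le> liminf (\<lambda>n. f (x n)))"

definition order_lower_semicontinuous ::
  "'a measure \<Rightarrow> ('a \<Rightarrow> real) set \<Rightarrow> (('a \<Rightarrow> real) \<Rightarrow> ereal) \<Rightarrow> bool" where
  "order_lower_semicontinuous M E f \<longleftrightarrow>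
     (\<forall>\<xi> \<xi>'. range \<xi> \<subseteq> E \<and> \<xi>' \<in> E \<and> order_bounded_in M E \<xi> \<and>
        (AE \<omega> in M. (\<lambda>n. \<xi> n \<omega>) \<longlonglongrightarrow> \<xi>' \<omega>) \<longrightarrow>
        f \<xi>' \<le> liminf (\<lambda>n. f (\<xi> n)))"

end

theory Submission
  imports Defs
begin

text \<open>
  The crucial implication is that order lower semicontinuity implies weak lower semicontinuity.
  Let \<open>C\<close> be an order closed convex subset of \<open>L\<^bsub>\<Phi>*\<^esub>\<close>, a translate of a sublevel set, with \<open>0 \<notin> C\<close>; one
  functional from \<open>L\<^bsub>\<Phi>\<^esub>\<close> has to separate \<open>C\<close> from \<open>0\<close>.

  The condition \<open>\<Phi> \<in> \<Delta>\<^sub>2\<close> says that \<open>\<Phi>*(y) \<le> \<Phi>*(l y) / (2 l)\<close> for large \<open>y\<close>, so that averages of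
  \<open>l\<^sup>m\<close> essentially disjoint functions from a ball are small. Hence a norm bounded, a.s. convergent
  sequence has order bounded forward convex combinations, and \<open>C\<close> is closed in each ball under a.s.
  convergence. Minimising the strictly convex functional \<open>E[sqrt (1 + \<xi>\<^sup>2)]\<close> over differences then
  separates bounded pieces of \<open>C\<close> from balls by bounded functions. Iterating over balls of radius
  \<open>r 2\<^sup>k\<close> as in the Krein--Smulian theorem gives functionals \<open>g\<^sub>k\<close> of norm \<open>O(2\<^sup>-\<^sup>k)\<close> such that for each
  \<open>\<xi> \<in> C\<close> some \<open>\<bar>\<langle>g\<^sub>k, \<xi>\<rangle>\<bar>\<close> exceeds 1. The image of \<open>C\<close> in \<open>\<ell>\<^sup>2\<close> under \<open>\<xi> \<mapsto> (\<langle>g\<^sub>k, \<xi>\<rangle>)\<^sub>k\<close> therefore stays away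
  from \<open>0\<close>, and the point of minimal norm of its closure gives the coefficients of the separating functional.

  That Mackey sequential lower semicontinuity implies order lower semicontinuity is a gliding hump
  argument: order bounded a.s. null sequences are null uniformly on weakly compact sets.
\<close>

section \<open>Young functions\<close>

text \<open>No Hahn-Banach theorem and no representation of dual spaces is invoked: every separating
  functional is the gradient, at a limit of near-minimisers, of an explicit strictly convex
  functional, first \<open>E[theta]\<close> and then the squared norm of l2. This dictates the
  choices. Balls of \<open>L'\<close> lie in L1 but in general not in L2, so the functional must
  have linear growth; its gradient \<open>theta'(u)\<close> is then a bounded function and so
  belongs to \<open>L\<close> at once. Superlinearity makes balls uniformly integrable, so that a.s.
  convergence inside a ball is L1 convergence and bounded functions act continuously on it. The
  obstacle is that such a functional depends on the ball in which the separation takes place; hence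
  the growing balls, and the final recombination of all functionals into one a.e. convergent series,
  whose sum is shown to lie in \<open>L\<close> by testing it against the dual ball. The dual
  representation is obtained in the same style: a weak neighbourhood involves finitely many
  functionals, so the separation of a point from the epigraph again takes place in l2.\<close>

lemma convex_on_combine2:
  fixes f :: "real \<Rightarrow> real"
  assumes "convex_on UNIV f" "0 \<le> a" "0 \<le> b" "a + b = 1"
  shows "f (a * x + b * y) \<le> a * f x + b * f y"
  using convex_onD[OF assms(1), of b x y] assms(2-) by (simp add: eq_diff_eq[symmetric])

locale young =
  fixes \<Psi> :: "real \<Rightarrow> real"
  assumes young: "young_function \<Psi>"
begin

lemma even [simp]: "\<Psi> (- x) = \<Psi> x"
  and convex: "convex_on UNIV \<Psi>"
  and zero [simp]: "\<Psi> 0 = 0"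
  and coercive: "filterlim (\<lambda>x. \<Psi> x / x) at_top at_top"
  using young unfolding young_function_def by auto

lemma abs_arg: "\<Psi> \<bar>x\<bar> = \<Psi> x"
  by (simp add: abs_if)

lemma combine: "0 \<le> a \<Longrightarrow> 0 \<le> b \<Longrightarrow> a + b = 1 \<Longrightarrow> \<Psi> (a * x + b * y) \<le> a * \<Psi> x + b * \<Psi> y"
  by (rule convex_on_combine2[OF convex])

lemma nonneg [simp]: "0 \<le> \<Psi> x"
  using combine[of "1/2" "1/2" x "- x"] by simp

lemma scale_le: "0 \<le> t \<Longrightarrow> t \<le> 1 \<Longrightarrow> \<Psi> (t * x) \<le> t * \<Psi> x"
  using combine[of t "1 - t" x 0] by simp

lemma mono_abs: "\<bar>x\<bar> \<le> \<bar>y\<bar> \<Longrightarrow> \<Psi> x \<le> \<Psi> y"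
proof (cases "y = 0")
  case False
  assume *: "\<bar>x\<bar> \<le> \<bar>y\<bar>"
  have "\<Psi> \<bar>x\<bar> = \<Psi> ((\<bar>x\<bar> / \<bar>y\<bar>) * \<bar>y\<bar>)" using False by simp
  also have "\<dots> \<le> (\<bar>x\<bar> / \<bar>y\<bar>) * \<Psi> \<bar>y\<bar>" using False * by (intro scale_le) auto
  also have "\<dots> \<le> 1 * \<Psi> \<bar>y\<bar>" using False * by (intro mult_right_mono) auto
  finally show ?thesis by (simp add: abs_arg)
qed simp

lemma cont: "continuous_on UNIV \<Psi>"
  using convex_on_continuous[OF open_UNIV convex] .

lemma isCont: "isCont \<Psi> x"
  using cont continuous_on_eq_continuous_at by blast

lemma meas [measurable]: "\<Psi> \<in> borel_measurable borel"
  using cont by (rule borel_measurable_continuous_onI)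

lemma superlinear: "\<exists>m>0. \<forall>x. m \<le> \<bar>x\<bar> \<longrightarrow> K * \<bar>x\<bar> \<le> \<Psi> x"
proof -
  obtain m where m: "\<And>x. x \<ge> m \<Longrightarrow> \<Psi> x / x \<ge> K"
    using coercive unfolding filterlim_at_top eventually_at_top_linorder by blast
  have "K * \<bar>x\<bar> \<le> \<Psi> x" if "max m 1 \<le> \<bar>x\<bar>" for x
    using m[of "\<bar>x\<bar>"] that by (simp add: abs_arg pos_le_divide_eq)
  then show ?thesis by (intro exI[of _ "max m 1"]) auto
qed

text \<open>Superlinearity with slope \<open>1/e\<close> handles
  \<open>\<bar>x\<bar> \<ge> m\<close>, and below \<open>m\<close> the minimum is
  \<open>\<bar>x\<bar>\<close> itself. This is the form in which coercivity gives uniform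
  integrability of balls.\<close>

lemma abs_le: "0 < e \<Longrightarrow> \<exists>m>0. \<forall>x. \<bar>x\<bar> \<le> e * \<Psi> x + min \<bar>x\<bar> m"
proof -
  assume e: "0 < e"
  obtain m where m: "m > 0" "\<And>x. m \<le> \<bar>x\<bar> \<Longrightarrow> (1/e) * \<bar>x\<bar> \<le> \<Psi> x" using superlinear[of "1/e"] by auto
  have "\<bar>x\<bar> \<le> e * \<Psi> x + min \<bar>x\<bar> m" for x
  proof (cases "m \<le> \<bar>x\<bar>")
    case True
    have "e * ((1/e) * \<bar>x\<bar>) \<le> e * \<Psi> x" using m(2)[OF True] e by (intro mult_left_mono) auto
    then show ?thesis using e m(1) by simp
  qed (use e in simp)
  then show ?thesis using m(1) by blast
qed

lemma bdd_conj: "bdd_above (range (\<lambda>x. x * y - \<Psi> x))"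
proof -
  obtain m where m: "m > 0" "\<And>x. m \<le> \<bar>x\<bar> \<Longrightarrow> \<bar>y\<bar> * \<bar>x\<bar> \<le> \<Psi> x" using superlinear by blast
  have "x * y - \<Psi> x \<le> m * \<bar>y\<bar>" for x
  proof (cases "m \<le> \<bar>x\<bar>")
    case True
    have "x * y \<le> \<bar>y\<bar> * \<bar>x\<bar>" by (metis abs_ge_self abs_mult mult.commute)
    moreover have "0 \<le> m * \<bar>y\<bar>" using m(1) by simp
    ultimately show ?thesis using m(2)[OF True] by linarith
  next
    case False
    have "x * y \<le> \<bar>x\<bar> * \<bar>y\<bar>" by (metis abs_ge_self abs_mult)
    also have "\<dots> \<le> m * \<bar>y\<bar>" using False by (intro mult_right_mono) auto
    finally show ?thesis using nonneg[of x] by linarith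
  qed
  then show ?thesis by (intro bdd_aboveI) auto
qed

lemma fenchel_young: "x * y \<le> \<Psi> x + young_conjugate \<Psi> y"
  unfolding young_conjugate_def using cSUP_upper[OF UNIV_I bdd_conj, of x y] by linarith

lemma conj_least: "(\<And>x. x * y - \<Psi> x \<le> b) \<Longrightarrow> young_conjugate \<Psi> y \<le> b"
  unfolding young_conjugate_def by (rule cSUP_least) auto

lemma young_conjugate: "young_function (young_conjugate \<Psi>)"
  unfolding young_function_def
proof (intro conjI allI)
  fix y
  have *: "young_conjugate \<Psi> (- y) \<le> young_conjugate \<Psi> y" for y
  proof (rule conj_least)
    show "x * - y - \<Psi> x \<le> young_conjugate \<Psi> y" for x
      using fenchel_young[of "- x" y] by simp
  qed
  show "young_conjugate \<Psi> (- y) = young_conjugate \<Psi> y" using *[of y] *[of "- y"] by simp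
next
  show "convex_on UNIV (young_conjugate \<Psi>)"
  proof (intro convex_onI conj_least)
    fix t y z x :: real assume t: "0 < t" "t < 1"
    have "(1 - t) * (x * y) \<le> (1 - t) * (\<Psi> x + young_conjugate \<Psi> y)" "t * (x * z) \<le> t * (\<Psi> x + young_conjugate \<Psi> z)"
      using t fenchel_young by (auto intro!: mult_left_mono)
    then show "x * ((1 - t) *\<^sub>R y + t *\<^sub>R z) - \<Psi> x \<le> (1 - t) * young_conjugate \<Psi> y + t * young_conjugate \<Psi> z"
      by (simp add: algebra_simps)
  qed auto
next
  show "young_conjugate \<Psi> 0 = 0"
  proof (rule antisym)
    show "young_conjugate \<Psi> 0 \<le> 0" by (rule conj_least) simp
    show "0 \<le> young_conjugate \<Psi> 0" using fenchel_young[of 0 0] by simp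
  qed
next
  show "filterlim (\<lambda>x. young_conjugate \<Psi> x / x) at_top at_top"
    unfolding filterlim_at_top eventually_at_top_linorder
  proof (intro allI exI impI)
    \<comment> \<open>The supremum is tested at the point \<open>K + 1\<close>:
      \<open>(K + 1) x - \<Psi> (K + 1) \<ge> K x\<close> as soon as
      \<open>x \<ge> \<Psi> (K + 1)\<close>.\<close>
    fix K x :: real assume x: "max 1 (\<Psi> (K + 1)) \<le> x"
    have "K * x \<le> young_conjugate \<Psi> x" using fenchel_young[of "K + 1" x] x by (simp add: algebra_simps)
    then show "K \<le> young_conjugate \<Psi> x / x" using x by (simp add: pos_le_divide_eq)
  qed
qed

lemma subgradient: "\<exists>p. \<forall>x y. \<Psi> x + p x * (y - x) \<le> \<Psi> y"
proof -
  have "\<exists>q. \<forall>y. \<Psi> x + q * (y - x) \<le> \<Psi> y" for x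
    using convex_le_Inf_differential[OF convex, of x] by (metis UNIV_I interior_UNIV)
  then show ?thesis by metis
qed

text \<open>Doubling dualises: \<open>\<Psi> (2 x) \<le> 2 l \<Psi> x\<close> holds for large
  \<open>x\<close>, and the Fenchel-Young inequality for the pair \<open>2 x\<close>,
  \<open>l y\<close> bounds \<open>2 l (x y - \<Psi> x)\<close> by the conjugate at
  \<open>l y\<close>; then the supremum over \<open>x\<close> is taken. The factor 2 is the gain
  over the factor \<open>l\<close> that convexity alone provides.\<close>

lemma nabla2:
  assumes "Delta2 \<Psi>"
  shows "\<exists>l::nat. \<exists>y0>0. 1 < l \<and> (\<forall>y\<ge>y0. 2 * real l * young_conjugate \<Psi> y \<le> young_conjugate \<Psi> (real l * y))"
proof -
  obtain c :: real where c: "Limsup at_top (\<lambda>x. ereal (\<Psi> (2 * x) / \<Psi> x)) < ereal c"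
    using assms unfolding Delta2_def using less_PInf_Ex_of_nat by (metis ereal_dense2)
  then have "\<forall>\<^sub>F x in at_top. \<Psi> (2 * x) / \<Psi> x < c"
    using Limsup_lessD[OF c] by simp
  then obtain x1 where x1: "\<And>x. x \<ge> x1 \<Longrightarrow> \<Psi> (2 * x) / \<Psi> x < c"
    unfolding eventually_at_top_linorder by blast
  obtain m where m: "m > 0" "\<And>x. m \<le> \<bar>x\<bar> \<Longrightarrow> 1 * \<bar>x\<bar> \<le> \<Psi> x" using superlinear[of 1] by blast
  define x0 where "x0 = max x1 m"
  obtain l :: nat where l: "real l > max c 1" using reals_Archimedean2 by blast
  have dbl: "\<Psi> (2 * x) \<le> 2 * real l * \<Psi> x" if "x \<ge> x0" for x
  proof -
    have pos: "\<Psi> x > 0" using m(1) m(2)[of x] that unfolding x0_def by auto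
    have "\<Psi> (2 * x) \<le> c * \<Psi> x" using x1[of x] that pos unfolding x0_def by (simp add: divide_less_eq)
    also have "\<dots> \<le> 2 * real l * \<Psi> x" using l pos by (intro mult_right_mono) auto
    finally show ?thesis .
  qed
  have x0: "x0 > 0" using m(1) unfolding x0_def by simp
  obtain p where p: "\<And>x y. \<Psi> x + p x * (y - x) \<le> \<Psi> y" using subgradient by blast
  \<comment> \<open>For \<open>y\<close> above the subgradient at \<open>x0\<close>, the value of
    \<open>x y - \<Psi> x\<close> at any \<open>x < x0\<close> does not exceed that at
    \<open>x0\<close>. So small \<open>x\<close>, where doubling is unknown, cannot affect the
    supremum.\<close>
  define y0 where "y0 = max (p x0) 1"
  have "2 * real l * young_conjugate \<Psi> y \<le> young_conjugate \<Psi> (real l * y)" if y: "y \<ge> y0" for y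
  proof -
    have "x * y - \<Psi> x \<le> young_conjugate \<Psi> (real l * y) / (2 * real l)" for x
    proof -
      have big: "x * y - \<Psi> x \<le> young_conjugate \<Psi> (real l * y) / (2 * real l)" if "x \<ge> x0" for x
      proof -
        have "(2 * x) * (real l * y) - \<Psi> (2 * x) \<le> young_conjugate \<Psi> (real l * y)"
          using fenchel_young[of "2 * x" "real l * y"] by simp
        then have "(2 * real l) * (x * y - \<Psi> x) \<le> young_conjugate \<Psi> (real l * y)"
          using dbl[OF that] by (simp add: algebra_simps)
        then show ?thesis using l by (simp add: field_simps)
      qed
      show ?thesis
      proof (cases "x \<ge> x0")
        case False
        have "p x0 * (x0 - x) \<le> y * (x0 - x)" using False y unfolding y0_def by (intro mult_right_mono) auto
        then have "x * y - \<Psi> x \<le> x0 * y - \<Psi> x0" using p[of x0 x] by (simp add: algebra_simps)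
        then show ?thesis using big[of x0] by simp
      qed (rule big)
    qed
    then have "young_conjugate \<Psi> y \<le> young_conjugate \<Psi> (real l * y) / (2 * real l)" by (rule conj_least)
    then show ?thesis using l by (simp add: field_simps)
  qed
  moreover have "y0 > 0" "1 < l" using l unfolding y0_def by auto
  ultimately show ?thesis by blast
qed

end

section \<open>Orlicz spaces\<close>

lemma AE_summable_of_integrals:
  fixes g :: "nat \<Rightarrow> 'a \<Rightarrow> real"
  assumes [measurable]: "\<And>n. g n \<in> borel_measurable M"
    and int: "\<And>n. integrable M (g n)" and le: "\<And>n. (\<integral>\<omega>. \<bar>g n \<omega>\<bar> \<partial>M) \<le> c n" and c: "summable c"
  shows "AE \<omega> in M. summable (\<lambda>n. \<bar>g n \<omega>\<bar>)"
proof -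
  have c0: "0 \<le> c n" for n
    by (rule order_trans[OF _ le]) simp
  have "(\<integral>\<^sup>+\<omega>. (\<Sum>n. ennreal \<bar>g n \<omega>\<bar>) \<partial>M) = (\<Sum>n. \<integral>\<^sup>+\<omega>. ennreal \<bar>g n \<omega>\<bar> \<partial>M)"
    by (intro nn_integral_suminf) auto
  also have "\<dots> \<le> (\<Sum>n. ennreal (c n))"
  proof (intro suminf_le summableI)
    fix n
    have "(\<integral>\<^sup>+\<omega>. ennreal \<bar>g n \<omega>\<bar> \<partial>M) = ennreal (\<integral>\<omega>. \<bar>g n \<omega>\<bar> \<partial>M)"
      using int by (intro nn_integral_eq_integral) auto
    then show "(\<integral>\<^sup>+\<omega>. ennreal \<bar>g n \<omega>\<bar> \<partial>M) \<le> ennreal (c n)" using le by (simp add: ennreal_leI)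
  qed
  also have "\<dots> = ennreal (\<Sum>n. c n)" using c c0 by (intro suminf_ennreal2) auto
  finally have "(\<integral>\<^sup>+\<omega>. (\<Sum>n. ennreal \<bar>g n \<omega>\<bar>) \<partial>M) \<noteq> \<infinity>"
    using ennreal_less_top leD by (metis infinity_ennreal_def)
  then have "AE \<omega> in M. (\<Sum>n. ennreal \<bar>g n \<omega>\<bar>) \<noteq> \<infinity>"
    by (intro nn_integral_PInf_AE) auto
  then show ?thesis
    by eventually_elim (auto intro!: summable_suminf_not_top)
qed

lemma integrable_bounded_mult:
  fixes g x :: "'a \<Rightarrow> real"
  assumes x: "integrable M x" and [measurable]: "g \<in> borel_measurable M" and b: "\<And>\<omega>. \<bar>g \<omega>\<bar> \<le> b"
  shows "integrable M (\<lambda>\<omega>. g \<omega> * x \<omega>)"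
proof (rule Bochner_Integration.integrable_bound[of _ "\<lambda>\<omega>. b * x \<omega>"])
  have [measurable]: "x \<in> borel_measurable M" using x by auto
  show "(\<lambda>\<omega>. g \<omega> * x \<omega>) \<in> borel_measurable M" by measurable
  show "AE \<omega> in M. norm (g \<omega> * x \<omega>) \<le> norm (b * x \<omega>)"
    using b by (intro AE_I2) (auto simp: abs_mult intro!: mult_right_mono order_trans[OF b])
qed (use x in auto)

lemma frequently_eventually_ex:
  assumes "\<exists>\<^sub>F n in F. P n" "\<forall>\<^sub>F n in F. Q n"
  shows "\<exists>n. P n \<and> Q n"
proof (rule ccontr)
  assume "\<not> ?thesis"
  with assms(2) have "\<forall>\<^sub>F n in F. \<not> P n" by (auto elim: eventually_mono)
  with assms(1) show False by (simp add: frequently_def)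
qed

section \<open>Luxemburg balls and their uniform integrability\<close>

locale orlicz = prob_space M + young \<Psi>
  for M :: "'a measure" and \<Psi> :: "real \<Rightarrow> real"
begin

text \<open>For \<open>r > 0\<close> the closed ball of radius \<open>r\<close> of the Luxemburg
  norm, which itself is never introduced. At \<open>r = 0\<close> division by zero would admit every
  measurable function, hence the recurring hypothesis \<open>0 < r\<close>.\<close>

definition ball :: "real \<Rightarrow> ('a \<Rightarrow> real) set" where
  "ball r = {\<xi> \<in> borel_measurable M. (\<integral>\<^sup>+ \<omega>. ennreal (\<Psi> (\<xi> \<omega> / r)) \<partial>M) \<le> 1}"

lemma ball_iff:
  "\<xi> \<in> ball r \<longleftrightarrow> \<xi> \<in> borel_measurable M \<and> integrable M (\<lambda>\<omega>. \<Psi> (\<xi> \<omega> / r)) \<and> (\<integral>\<omega>. \<Psi> (\<xi> \<omega> / r) \<partial>M) \<le> 1"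
proof (cases "\<xi> \<in> borel_measurable M")
  case [measurable]: True
  show ?thesis
  proof
    assume "\<xi> \<in> ball r"
    then have *: "(\<integral>\<^sup>+ \<omega>. ennreal (\<Psi> (\<xi> \<omega> / r)) \<partial>M) \<le> 1" unfolding ball_def by auto
    then have i: "integrable M (\<lambda>\<omega>. \<Psi> (\<xi> \<omega> / r))"
      by (intro integrableI_bounded) (auto intro: le_less_trans)
    have "ennreal (\<integral>\<omega>. \<Psi> (\<xi> \<omega> / r) \<partial>M) \<le> 1"
      using * nn_integral_eq_integral[OF i] by simp
    then show "\<xi> \<in> borel_measurable M \<and> integrable M (\<lambda>\<omega>. \<Psi> (\<xi> \<omega> / r)) \<and> (\<integral>\<omega>. \<Psi> (\<xi> \<omega> / r) \<partial>M) \<le> 1"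
      using i True by (simp add: ennreal_le_1)
  next
    assume *: "\<xi> \<in> borel_measurable M \<and> integrable M (\<lambda>\<omega>. \<Psi> (\<xi> \<omega> / r)) \<and> (\<integral>\<omega>. \<Psi> (\<xi> \<omega> / r) \<partial>M) \<le> 1"
    then have "(\<integral>\<^sup>+ \<omega>. ennreal (\<Psi> (\<xi> \<omega> / r)) \<partial>M) = ennreal (\<integral>\<omega>. \<Psi> (\<xi> \<omega> / r) \<partial>M)"
      by (intro nn_integral_eq_integral) auto
    then show "\<xi> \<in> ball r" unfolding ball_def using * True by (simp only: mem_Collect_eq ennreal_le_1)
  qed
qed (auto simp: ball_def)

lemma ball_meas: "\<xi> \<in> ball r \<Longrightarrow> \<xi> \<in> borel_measurable M"
  unfolding ball_def by auto

lemma space_iff: "\<xi> \<in> orlicz_space M \<Psi> \<longleftrightarrow> (\<exists>r>0. \<xi> \<in> ball r)"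
proof
  assume "\<xi> \<in> orlicz_space M \<Psi>"
  then obtain l \<xi>0 where l: "l > 0" "\<xi>0 \<in> orlicz_ball M \<Psi>" "\<xi> = (\<lambda>\<omega>. l * \<xi>0 \<omega>)"
    unfolding orlicz_space_def by auto
  then have "\<xi> \<in> ball l" unfolding ball_def orlicz_ball_def by auto
  then show "\<exists>r>0. \<xi> \<in> ball r" using l by auto
next
  assume "\<exists>r>0. \<xi> \<in> ball r"
  then obtain r where r: "r > 0" "\<xi> \<in> ball r" by auto
  then have "(\<lambda>\<omega>. \<xi> \<omega> / r) \<in> orlicz_ball M \<Psi>" unfolding ball_def orlicz_ball_def by auto
  moreover have "\<xi> = (\<lambda>\<omega>. r * (\<xi> \<omega> / r))" using r by auto
  ultimately show "\<xi> \<in> orlicz_space M \<Psi>" unfolding orlicz_space_def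
    by (intro UN_I[of r] image_eqI) (use r(1) in auto)
qed

lemma space_meas: "\<xi> \<in> orlicz_space M \<Psi> \<Longrightarrow> \<xi> \<in> borel_measurable M"
  using space_iff ball_meas by blast

lemma ball_dominated:
  assumes \<xi>: "\<xi> \<in> ball r" and [measurable]: "g \<in> borel_measurable M" and le: "AE \<omega> in M. \<bar>g \<omega>\<bar> \<le> \<bar>\<xi> \<omega>\<bar>"
  shows "g \<in> ball r"
proof -
  have [measurable]: "\<xi> \<in> borel_measurable M" using \<xi> ball_meas by auto
  have "(\<integral>\<^sup>+ \<omega>. ennreal (\<Psi> (g \<omega> / r)) \<partial>M) \<le> (\<integral>\<^sup>+ \<omega>. ennreal (\<Psi> (\<xi> \<omega> / r)) \<partial>M)"
  proof (rule nn_integral_mono_AE)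
    show "AE \<omega> in M. ennreal (\<Psi> (g \<omega> / r)) \<le> ennreal (\<Psi> (\<xi> \<omega> / r))"
      using le by eventually_elim (auto intro!: ennreal_leI mono_abs divide_right_mono simp: abs_divide)
  qed
  then show ?thesis using \<xi> unfolding ball_def by auto
qed

lemma space_dominated:
  assumes "\<xi> \<in> orlicz_space M \<Psi>" "g \<in> borel_measurable M" "AE \<omega> in M. \<bar>g \<omega>\<bar> \<le> \<bar>\<xi> \<omega>\<bar>"
  shows "g \<in> orlicz_space M \<Psi>"
  using ball_dominated assms space_iff by meson

text \<open>Convexity with weights proportional to the radii; this is the triangle inequality of the
  norm.\<close>

lemma ball_add:
  assumes "\<xi> \<in> ball r" "\<zeta> \<in> ball s" "0 < r" "0 < s"
  shows "(\<lambda>\<omega>. \<xi> \<omega> + \<zeta> \<omega>) \<in> ball (r + s)"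
proof -
  have [measurable]: "\<xi> \<in> borel_measurable M" "\<zeta> \<in> borel_measurable M" using assms ball_meas by auto
  have i: "integrable M (\<lambda>\<omega>. \<Psi> (\<xi> \<omega> / r))" "integrable M (\<lambda>\<omega>. \<Psi> (\<zeta> \<omega> / s))"
    and le: "(\<integral>\<omega>. \<Psi> (\<xi> \<omega> / r) \<partial>M) \<le> 1" "(\<integral>\<omega>. \<Psi> (\<zeta> \<omega> / s) \<partial>M) \<le> 1" using assms ball_iff by auto
  let ?a = "r / (r + s)" and ?b = "s / (r + s)"
  have ab: "0 \<le> ?a" "0 \<le> ?b" "?a + ?b = 1" using assms by (auto simp: add_divide_distrib[symmetric])
  have pw: "\<Psi> ((\<xi> \<omega> + \<zeta> \<omega>) / (r + s)) \<le> ?a * \<Psi> (\<xi> \<omega> / r) + ?b * \<Psi> (\<zeta> \<omega> / s)" for \<omega>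
  proof -
    have "(\<xi> \<omega> + \<zeta> \<omega>) / (r + s) = ?a * (\<xi> \<omega> / r) + ?b * (\<zeta> \<omega> / s)"
      using assms by (simp add: add_divide_distrib)
    then show ?thesis using combine[OF ab] by metis
  qed
  have i2: "integrable M (\<lambda>\<omega>. ?a * \<Psi> (\<xi> \<omega> / r) + ?b * \<Psi> (\<zeta> \<omega> / s))" using i by auto
  have i3: "integrable M (\<lambda>\<omega>. \<Psi> ((\<xi> \<omega> + \<zeta> \<omega>) / (r + s)))"
    by (rule Bochner_Integration.integrable_bound[OF i2]) (auto intro!: AE_I2 order_trans[OF pw abs_ge_self] simp del: times_divide_eq_left)
  have "(\<integral>\<omega>. \<Psi> ((\<xi> \<omega> + \<zeta> \<omega>) / (r + s)) \<partial>M) \<le> (\<integral>\<omega>. ?a * \<Psi> (\<xi> \<omega> / r) + ?b * \<Psi> (\<zeta> \<omega> / s) \<partial>M)"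
    using i2 i3 pw by (intro integral_mono) auto
  also have "\<dots> = ?a * (\<integral>\<omega>. \<Psi> (\<xi> \<omega> / r) \<partial>M) + ?b * (\<integral>\<omega>. \<Psi> (\<zeta> \<omega> / s) \<partial>M)"
    using i by simp
  also have "\<dots> \<le> ?a * 1 + ?b * 1" using le ab by (intro add_mono mult_left_mono) auto
  finally show ?thesis using ab(3) i3 unfolding ball_iff by simp
qed

lemma ball_scale: "\<xi> \<in> ball r \<Longrightarrow> c \<noteq> 0 \<Longrightarrow> (\<lambda>\<omega>. c * \<xi> \<omega>) \<in> ball (\<bar>c\<bar> * r)"
proof -
  assume *: "\<xi> \<in> ball r" "c \<noteq> 0"
  then have "\<Psi> (c * x / (\<bar>c\<bar> * r)) = \<Psi> (x / r)" for x
  proof -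
    have "\<bar>c * x / (\<bar>c\<bar> * r)\<bar> = \<bar>x / r\<bar>" using * by (simp add: abs_mult abs_divide)
    then show ?thesis by (metis abs_arg)
  qed
  then show ?thesis using * unfolding ball_def by auto
qed

lemma ball_uminus: "\<xi> \<in> ball r \<Longrightarrow> (\<lambda>\<omega>. - \<xi> \<omega>) \<in> ball r"
  using ball_scale[of \<xi> r "-1"] by simp

lemma ball_diff:
  "\<xi> \<in> ball r \<Longrightarrow> \<zeta> \<in> ball s \<Longrightarrow> 0 < r \<Longrightarrow> 0 < s \<Longrightarrow> (\<lambda>\<omega>. \<xi> \<omega> - \<zeta> \<omega>) \<in> ball (r + s)"
  using ball_add[of \<xi> r "\<lambda>\<omega>. - \<zeta> \<omega>" s] ball_uminus by simp

lemma zero_ball: "(\<lambda>_. 0) \<in> ball r"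
  unfolding ball_def by simp

lemma ball_convex:
  assumes "\<xi> \<in> ball r" "\<zeta> \<in> ball r" "0 < r" "0 \<le> a" "0 \<le> b" "a + b = 1"
  shows "(\<lambda>\<omega>. a * \<xi> \<omega> + b * \<zeta> \<omega>) \<in> ball r"
proof (cases "a = 0 \<or> b = 0")
  case True
  then show ?thesis using assms by auto
next
  case False
  then have "(\<lambda>\<omega>. a * \<xi> \<omega> + b * \<zeta> \<omega>) \<in> ball (\<bar>a\<bar> * r + \<bar>b\<bar> * r)"
    using assms by (intro ball_add ball_scale) auto
  moreover have "\<bar>a\<bar> * r + \<bar>b\<bar> * r = r" using assms by (simp add: distrib_right[symmetric])
  ultimately show ?thesis by simp
qed

lemma ball_mono: "0 < r \<Longrightarrow> r \<le> s \<Longrightarrow> ball r \<subseteq> ball s"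
proof
  fix \<xi> assume *: "0 < r" "r \<le> s" "\<xi> \<in> ball r"
  show "\<xi> \<in> ball s"
  proof (cases "r = s")
    case False
    then show ?thesis using ball_add[OF *(3) zero_ball[of "s - r"]] * by simp
  qed (use * in simp)
qed

lemma space_add: "\<xi> \<in> orlicz_space M \<Psi> \<Longrightarrow> \<zeta> \<in> orlicz_space M \<Psi> \<Longrightarrow> (\<lambda>\<omega>. \<xi> \<omega> + \<zeta> \<omega>) \<in> orlicz_space M \<Psi>"
  unfolding space_iff using ball_add by (meson add_pos_pos)

lemma space_scale: "\<xi> \<in> orlicz_space M \<Psi> \<Longrightarrow> (\<lambda>\<omega>. c * \<xi> \<omega>) \<in> orlicz_space M \<Psi>"
proof (cases "c = 0")
  case True
  then show ?thesis unfolding space_iff using zero_ball by (auto intro: exI[of _ 1])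
next
  case False
  assume "\<xi> \<in> orlicz_space M \<Psi>"
  then obtain r where r: "r > 0" "\<xi> \<in> ball r" unfolding space_iff by auto
  then show ?thesis unfolding space_iff using ball_scale[OF r(2) False] False by (intro exI[of _ "\<bar>c\<bar> * r"]) auto
qed

lemma space_diff: "\<xi> \<in> orlicz_space M \<Psi> \<Longrightarrow> \<zeta> \<in> orlicz_space M \<Psi> \<Longrightarrow> (\<lambda>\<omega>. \<xi> \<omega> - \<zeta> \<omega>) \<in> orlicz_space M \<Psi>"
  using space_add[of \<xi> "\<lambda>\<omega>. -1 * \<zeta> \<omega>"] space_scale[of \<zeta> "-1"] by simp

lemma const_space: "(\<lambda>_. c) \<in> orlicz_space M \<Psi>"
proof -
  \<comment> \<open>With this radius \<open>scale_le\<close> bounds the modular by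
    \<open>\<Psi> 1 / (1 + \<Psi> 1)\<close>, which is at most 1.\<close>
  have "(\<lambda>_. 1) \<in> ball (1 + \<Psi> 1)"
  proof -
    have pos: "1 + \<Psi> 1 > 0" using nonneg[of 1] by linarith
    then have "\<Psi> (1 / (1 + \<Psi> 1)) \<le> (1 / (1 + \<Psi> 1)) * \<Psi> 1"
      using scale_le[of "1 / (1 + \<Psi> 1)" 1] by (simp add: divide_le_eq)
    also have "\<dots> \<le> 1" using pos by (simp add: divide_le_eq)
    finally show ?thesis unfolding ball_iff by (simp add: prob_space)
  qed
  then have "(\<lambda>_. 1) \<in> orlicz_space M \<Psi>" unfolding space_iff using add_pos_nonneg[OF zero_less_one nonneg[of 1]] by blast
  from space_scale[OF this, of c] show ?thesis by simp
qed

lemma bounded_space: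
  assumes "g \<in> borel_measurable M" "\<And>\<omega>. \<bar>g \<omega>\<bar> \<le> c"
  shows "g \<in> orlicz_space M \<Psi>"
  using assms by (intro space_dominated[OF const_space[of c]]) (auto intro!: AE_I2 order_trans[OF assms(2)])

text \<open>Fatou's lemma for the modular. Closedness under mere a.s. convergence is what later
  keeps limits of selections inside their ball.\<close>

lemma ball_closed:
  assumes u: "\<And>n. u n \<in> ball r" and [measurable]: "v \<in> borel_measurable M"
    and lim: "AE \<omega> in M. (\<lambda>n. u n \<omega>) \<longlonglongrightarrow> v \<omega>" and r: "0 < r"
  shows "v \<in> ball r"
proof -
  have [measurable]: "u n \<in> borel_measurable M" for n using u ball_meas by auto
  have "AE \<omega> in M. ennreal (\<Psi> (v \<omega> / r)) = liminf (\<lambda>n. ennreal (\<Psi> (u n \<omega> / r)))"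
    using lim
  proof (rule AE_mp, intro AE_I2 impI)
    fix \<omega> assume "(\<lambda>n. u n \<omega>) \<longlonglongrightarrow> v \<omega>"
    then have "(\<lambda>n. ennreal (\<Psi> (u n \<omega> / r))) \<longlonglongrightarrow> ennreal (\<Psi> (v \<omega> / r))"
      using r by (intro tendsto_ennrealI isCont_tendsto_compose[OF isCont] tendsto_divide) auto
    then show "ennreal (\<Psi> (v \<omega> / r)) = liminf (\<lambda>n. ennreal (\<Psi> (u n \<omega> / r)))"
      by (metis lim_imp_Liminf trivial_limit_sequentially)
  qed
  then have "(\<integral>\<^sup>+ \<omega>. ennreal (\<Psi> (v \<omega> / r)) \<partial>M) = (\<integral>\<^sup>+ \<omega>. liminf (\<lambda>n. ennreal (\<Psi> (u n \<omega> / r))) \<partial>M)"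
    by (rule nn_integral_cong_AE)
  also have "\<dots> \<le> liminf (\<lambda>n. \<integral>\<^sup>+ \<omega>. ennreal (\<Psi> (u n \<omega> / r)) \<partial>M)"
    by (intro nn_integral_liminf) auto
  also have "\<dots> \<le> 1"
    using u unfolding ball_def by (intro Liminf_le) (auto)
  finally show ?thesis unfolding ball_def by auto
qed

lemma ball_L1: "0 < r \<Longrightarrow> \<exists>c. \<forall>\<xi>\<in>ball r. integrable M \<xi> \<and> (\<integral>\<omega>. \<bar>\<xi> \<omega>\<bar> \<partial>M) \<le> c"
proof -
  assume r: "0 < r"
  obtain m where m: "m > 0" "\<And>x. \<bar>x\<bar> \<le> 1 * \<Psi> x + min \<bar>x\<bar> m" using abs_le[of 1] by auto
  show ?thesis
  proof (intro exI ballI)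
    fix \<xi> assume \<xi>: "\<xi> \<in> ball r"
    then have [measurable]: "\<xi> \<in> borel_measurable M" and i: "integrable M (\<lambda>\<omega>. \<Psi> (\<xi> \<omega> / r))"
      and le: "(\<integral>\<omega>. \<Psi> (\<xi> \<omega> / r) \<partial>M) \<le> 1" using ball_iff by auto
    have pw: "\<bar>\<xi> \<omega>\<bar> \<le> r * (\<Psi> (\<xi> \<omega> / r) + m)" for \<omega>
    proof -
      have "\<bar>\<xi> \<omega>\<bar> = r * \<bar>\<xi> \<omega> / r\<bar>" using r by simp
      also have "\<dots> \<le> r * (\<Psi> (\<xi> \<omega> / r) + m)" using r m(2)[of "\<xi> \<omega> / r"] by (intro mult_left_mono) auto
      finally show ?thesis .
    qed
    have ib: "integrable M (\<lambda>\<omega>. r * (\<Psi> (\<xi> \<omega> / r) + m))" using i by auto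
    have int: "integrable M \<xi>"
      by (rule Bochner_Integration.integrable_bound[OF ib]) (auto intro!: AE_I2 order_trans[OF pw])
    moreover have "(\<integral>\<omega>. \<bar>\<xi> \<omega>\<bar> \<partial>M) \<le> (\<integral>\<omega>. r * (\<Psi> (\<xi> \<omega> / r) + m) \<partial>M)"
      using ib int pw by (intro integral_mono) auto
    moreover have "(\<integral>\<omega>. r * (\<Psi> (\<xi> \<omega> / r) + m) \<partial>M) = r * ((\<integral>\<omega>. \<Psi> (\<xi> \<omega> / r) \<partial>M) + m)"
      using i by (simp add: prob_space)
    moreover have "\<dots> \<le> r * (1 + m)" using le r by simp
    ultimately show "integrable M \<xi> \<and> (\<integral>\<omega>. \<bar>\<xi> \<omega>\<bar> \<partial>M) \<le> r * (1 + m)" by linarith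
  qed
qed

lemma ball_integrable: "0 < r \<Longrightarrow> \<xi> \<in> ball r \<Longrightarrow> integrable M \<xi>"
  using ball_L1 by blast

text \<open>Vitali's theorem for a ball: \<open>abs_le\<close> bounds
  \<open>\<bar>w n\<bar> / r\<close> by a small multiple of the modular, whose expectation is at
  most 1, plus a truncation to which dominated convergence applies. The choice
  \<open>d = e / (2 r)\<close> gives each part half of \<open>e\<close>.\<close>

lemma ball_L1_tendsto_0:
  assumes w: "\<And>n. w n \<in> ball r" and r: "0 < r" and lim: "AE \<omega> in M. (\<lambda>n. w n \<omega>) \<longlonglongrightarrow> 0"
  shows "(\<lambda>n. \<integral>\<omega>. \<bar>w n \<omega>\<bar> \<partial>M) \<longlonglongrightarrow> 0"
proof (rule LIMSEQ_I)
  fix e :: real assume e: "0 < e"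
  define d where "d = e / (2 * r)"
  have d: "0 < d" using e r unfolding d_def by simp
  obtain m where m: "m > 0" "\<And>x. \<bar>x\<bar> \<le> d * \<Psi> x + min \<bar>x\<bar> m" using abs_le[OF d] by auto
  have [measurable]: "w n \<in> borel_measurable M" for n using w ball_meas by auto
  have "(\<lambda>n. \<integral>\<omega>. min \<bar>w n \<omega> / r\<bar> m \<partial>M) \<longlonglongrightarrow> (\<integral>\<omega>. 0 \<partial>M)"
  proof (rule integral_dominated_convergence[where w = "\<lambda>_. m"])
    show "AE \<omega> in M. (\<lambda>n. min \<bar>w n \<omega> / r\<bar> m) \<longlonglongrightarrow> 0"
      using lim
    proof (rule AE_mp, intro AE_I2 impI)
      fix \<omega> assume "(\<lambda>n. w n \<omega>) \<longlonglongrightarrow> 0"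
      then have "(\<lambda>n. min \<bar>w n \<omega> / r\<bar> m) \<longlonglongrightarrow> min \<bar>0 / r\<bar> m" using r by (intro tendsto_intros) auto
      then show "(\<lambda>n. min \<bar>w n \<omega> / r\<bar> m) \<longlonglongrightarrow> 0" using m by simp
    qed
  qed (use m in auto)
  then have "\<forall>\<^sub>F n in sequentially. (\<integral>\<omega>. min \<bar>w n \<omega> / r\<bar> m \<partial>M) < e / (2 * r)"
    using e r by (intro order_tendstoD(2)) auto
  then obtain N where N: "\<And>n. n \<ge> N \<Longrightarrow> (\<integral>\<omega>. min \<bar>w n \<omega> / r\<bar> m \<partial>M) < e / (2 * r)"
    unfolding eventually_sequentially by auto
  have "norm ((\<integral>\<omega>. \<bar>w n \<omega>\<bar> \<partial>M) - 0) < e" if n: "n \<ge> N" for n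
  proof -
    have i: "integrable M (\<lambda>\<omega>. \<Psi> (w n \<omega> / r))" and le: "(\<integral>\<omega>. \<Psi> (w n \<omega> / r) \<partial>M) \<le> 1" using w[of n] ball_iff by auto
    have i2: "integrable M (\<lambda>\<omega>. min \<bar>w n \<omega> / r\<bar> m)"
      using m by (intro integrable_const_bound[where B = m]) auto
    have pw: "\<bar>w n \<omega>\<bar> \<le> r * (d * \<Psi> (w n \<omega> / r) + min \<bar>w n \<omega> / r\<bar> m)" for \<omega>
    proof -
      have "\<bar>w n \<omega>\<bar> = r * \<bar>w n \<omega> / r\<bar>" using r by simp
      also have "\<dots> \<le> r * (d * \<Psi> (w n \<omega> / r) + min \<bar>w n \<omega> / r\<bar> m)"
        using r m(2)[of "w n \<omega> / r"] by (intro mult_left_mono) auto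
      finally show ?thesis .
    qed
    have "(\<integral>\<omega>. \<bar>w n \<omega>\<bar> \<partial>M) \<le> (\<integral>\<omega>. r * (d * \<Psi> (w n \<omega> / r) + min \<bar>w n \<omega> / r\<bar> m) \<partial>M)"
      using i i2 pw ball_integrable[OF r w] by (intro integral_mono) auto
    also have "\<dots> = r * (d * (\<integral>\<omega>. \<Psi> (w n \<omega> / r) \<partial>M) + (\<integral>\<omega>. min \<bar>w n \<omega> / r\<bar> m \<partial>M))"
      using i i2 by simp
    also have "\<dots> < r * (d * 1 + e / (2 * r))"
      using N[OF n] le d r by (intro mult_strict_left_mono add_le_less_mono mult_left_mono) auto
    also have "\<dots> = e" unfolding d_def using r by (simp add: field_simps)
    finally show ?thesis by (simp add: integral_nonneg_AE)
  qed
  then show "\<exists>N. \<forall>n\<ge>N. norm ((\<integral>\<omega>. \<bar>w n \<omega>\<bar> \<partial>M) - 0) < e" by blast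
qed

lemma ball_L1_tendsto:
  assumes u: "\<And>n. u n \<in> ball r" and r: "0 < r" and v: "v \<in> borel_measurable M"
    and lim: "AE \<omega> in M. (\<lambda>n. u n \<omega>) \<longlonglongrightarrow> v \<omega>"
  shows "(\<lambda>n. \<integral>\<omega>. \<bar>u n \<omega> - v \<omega>\<bar> \<partial>M) \<longlonglongrightarrow> 0"
proof (rule ball_L1_tendsto_0[of _ "r + r"])
  show "(\<lambda>\<omega>. u n \<omega> - v \<omega>) \<in> ball (r + r)" for n
    using u r ball_closed[OF u v lim r] by (intro ball_diff) auto
  show "AE \<omega> in M. (\<lambda>n. u n \<omega> - v \<omega>) \<longlonglongrightarrow> 0"
    using lim by eventually_elim (rule LIM_zero)
qed (use r in auto)

lemma bounded_pairing_tendsto: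
  assumes u: "\<And>n. u n \<in> ball r" and r: "0 < r" and v: "v \<in> borel_measurable M"
    and lim: "AE \<omega> in M. (\<lambda>n. u n \<omega>) \<longlonglongrightarrow> v \<omega>"
    and g [measurable]: "g \<in> borel_measurable M" and b: "\<And>\<omega>. \<bar>g \<omega>\<bar> \<le> b"
  shows "(\<lambda>n. \<integral>\<omega>. g \<omega> * u n \<omega> \<partial>M) \<longlonglongrightarrow> (\<integral>\<omega>. g \<omega> * v \<omega> \<partial>M)"
proof -
  have vb: "v \<in> ball r" by (rule ball_closed[OF u v lim r])
  have iu: "integrable M (u n)" "integrable M v" for n using ball_integrable[OF r] u vb by auto
  have [measurable]: "u n \<in> borel_measurable M" "v \<in> borel_measurable M" for n using iu by auto
  have gi: "integrable M (\<lambda>\<omega>. g \<omega> * x \<omega>)" if "integrable M x" for x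
    by (rule integrable_bounded_mult[OF that g b])
  have lim0: "(\<lambda>n. b * (\<integral>\<omega>. \<bar>u n \<omega> - v \<omega>\<bar> \<partial>M)) \<longlonglongrightarrow> 0"
    using tendsto_mult_left[OF ball_L1_tendsto[OF u r v lim], of b] by simp
  have "norm ((\<integral>\<omega>. g \<omega> * u n \<omega> \<partial>M) - (\<integral>\<omega>. g \<omega> * v \<omega> \<partial>M)) \<le> b * (\<integral>\<omega>. \<bar>u n \<omega> - v \<omega>\<bar> \<partial>M)" for n
  proof -
    have "\<bar>(\<integral>\<omega>. g \<omega> * u n \<omega> \<partial>M) - (\<integral>\<omega>. g \<omega> * v \<omega> \<partial>M)\<bar> = \<bar>\<integral>\<omega>. g \<omega> * (u n \<omega> - v \<omega>) \<partial>M\<bar>"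
      using gi iu by (simp add: right_diff_distrib)
    also have "\<dots> \<le> (\<integral>\<omega>. \<bar>g \<omega> * (u n \<omega> - v \<omega>)\<bar> \<partial>M)" by (rule integral_abs_bound)
    also have "\<dots> \<le> (\<integral>\<omega>. b * \<bar>u n \<omega> - v \<omega>\<bar> \<partial>M)"
    proof (rule integral_mono)
      show "integrable M (\<lambda>\<omega>. \<bar>g \<omega> * (u n \<omega> - v \<omega>)\<bar>)" using gi[of "\<lambda>\<omega>. u n \<omega> - v \<omega>"] iu by (intro integrable_abs) auto
    qed (use iu b in \<open>auto simp: abs_mult intro!: mult_right_mono\<close>)
    finally show ?thesis by simp
  qed
  then show ?thesis by (intro LIM_zero_cancel[OF Lim_null_comparison[OF _ lim0]]) simp
qed

end

section \<open>Convergent selections from nested convex sets\<close>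

text \<open>A strictly convex function of linear growth: its expectation is finite on L1, and its
  derivative \<open>theta'\<close> has modulus below 1, so gradients of the expectation are bounded
  functions. Geometrically, \<open>theta x\<close> is the Euclidean length of the vector
  \<open>(1, x)\<close>, and \<open>theta' x\<close> is the second coordinate of the normalised
  vector.\<close>

definition theta :: "real \<Rightarrow> real" where "theta x = sqrt (1 + x\<^sup>2)"

definition theta' :: "real \<Rightarrow> real" where "theta' x = x / sqrt (1 + x\<^sup>2)"

lemma theta_ge_1: "1 \<le> theta x"
  unfolding theta_def by simp

lemma theta_le: "theta x \<le> 1 + \<bar>x\<bar>"
  unfolding theta_def by (rule real_le_lsqrt) (auto simp: power2_eq_square algebra_simps)

lemma theta_sq: "(theta x)\<^sup>2 = 1 + x\<^sup>2"
  unfolding theta_def by (simp add: add_nonneg_nonneg)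

lemma theta'_alt: "theta' x = x / theta x"
  unfolding theta_def theta'_def by simp

lemma theta_pos: "0 < theta x"
  using theta_ge_1[of x] by linarith

lemma theta'_sq: "(theta' x)\<^sup>2 = 1 - 1 / (1 + x\<^sup>2)"
  using add_pos_nonneg[of 1 "x\<^sup>2"] by (simp add: theta'_alt power_divide theta_sq field_simps)

lemma theta'_abs: "\<bar>theta' x\<bar> \<le> 1"
proof -
  have "\<bar>theta' x\<bar>\<^sup>2 \<le> 1\<^sup>2" using theta'_sq[of x] add_pos_nonneg[of 1 "x\<^sup>2"] by simp
  then show ?thesis by (rule power2_le_imp_le) simp
qed

lemma theta'_inverse: "x = theta' x / sqrt (1 - (theta' x)\<^sup>2)"
proof -
  have "1 - (theta' x)\<^sup>2 = (1 / theta x)\<^sup>2" by (simp add: theta'_sq power_divide theta_sq)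
  then have "sqrt (1 - (theta' x)\<^sup>2) = 1 / theta x" using theta_pos[of x] by simp
  then show ?thesis using theta_pos[of x] by (simp add: theta'_alt)
qed

lemma continuous_theta: "continuous_on UNIV theta"
  unfolding theta_def by (intro continuous_intros)

lemma continuous_theta': "continuous_on UNIV theta'"
proof -
  have "sqrt (1 + x\<^sup>2) \<noteq> 0" for x :: real using theta_pos[of x] unfolding theta_def by linarith
  then show ?thesis unfolding theta'_def by (intro continuous_intros) auto
qed

lemma theta_meas [measurable]: "theta \<in> borel_measurable borel"
  using continuous_theta by (rule borel_measurable_continuous_onI)

lemma theta'_meas [measurable]: "theta' \<in> borel_measurable borel"
  using continuous_theta' by (rule borel_measurable_continuous_onI)

lemma isCont_theta': "isCont theta' x"
  using continuous_theta' continuous_on_eq_continuous_at by blast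

text \<open>Cauchy-Schwarz for the vectors \<open>(1, x)\<close> and \<open>(1, y)\<close>; the
  defect of the squares is \<open>(x - y)\<^sup>2\<close>.\<close>

lemma one_plus_mult_le_theta: "\<bar>1 + x * y\<bar> \<le> theta x * theta y"
proof (rule power2_le_imp_le)
  have "(theta x * theta y)\<^sup>2 = \<bar>1 + x * y\<bar>\<^sup>2 + (x - y)\<^sup>2"
    by (simp add: power_mult_distrib theta_sq) (simp add: power2_eq_square algebra_simps)
  then show "\<bar>1 + x * y\<bar>\<^sup>2 \<le> (theta x * theta y)\<^sup>2" by simp
qed (use theta_pos[of x] theta_pos[of y] in simp)

text \<open>Cauchy-Schwarz again, divided by \<open>theta x\<close>.\<close>

lemma theta_subgradient: "theta x - theta y \<le> theta' x * (x - y)"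
proof -
  have "theta x * theta' x = x" using theta_pos[of x] by (simp add: theta'_alt)
  then have "theta x * (theta x - theta' x * (x - y)) = (theta x)\<^sup>2 - x * (x - y)"
    by (metis (no_types, opaque_lifting) mult.assoc power2_eq_square right_diff_distrib)
  also have "\<dots> = 1 + x * y" by (simp only: theta_sq) (simp add: power2_eq_square algebra_simps)
  also have "\<dots> \<le> theta x * theta y" using one_plus_mult_le_theta[of x y] by simp
  finally have "theta x - theta' x * (x - y) \<le> theta y" using theta_pos[of x] by simp
  then show ?thesis by linarith
qed

text \<open>Strict convexity has to be measured through \<open>theta'\<close>: no fixed multiple of
  \<open>(x - y)\<^sup>2\<close> can be a lower bound, since \<open>theta\<close> is nearly affine
  at infinity. The gap is half the defect in the triangle inequality for \<open>(1, x)\<close> and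
  \<open>(1, y)\<close>, which controls the distance of their directions.\<close>

lemma theta_gap: "(theta' x - theta' y)\<^sup>2 / 8 \<le> (theta x + theta y) / 2 - theta ((x + y) / 2)"
proof -
  \<comment> \<open>The lengths \<open>a\<close>, \<open>b\<close>, the inner product
    \<open>c\<close> and the length \<open>s\<close> of the sum of \<open>(1, x)\<close> and
    \<open>(1, y)\<close>, whence \<open>(a + b)\<^sup>2 - s\<^sup>2 = 2 (a b - c)\<close>.\<close>
  define a b c s where "a = theta x" and "b = theta y" and "c = 1 + x * y" and "s = 2 * theta ((x + y) / 2)"
  have ab: "1 \<le> a" "1 \<le> b" unfolding a_def b_def by (auto simp: theta_ge_1)
  have c: "c \<le> a * b" unfolding a_def b_def c_def using one_plus_mult_le_theta[of x y] by simp
  have s0: "0 \<le> s" unfolding s_def using theta_pos[of "(x + y) / 2"] by simp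
  have s2: "s\<^sup>2 = a\<^sup>2 + b\<^sup>2 + 2 * c"
    unfolding s_def a_def b_def c_def by (simp add: power_mult_distrib theta_sq) (simp add: power2_eq_square field_simps)
  have diff: "(a + b)\<^sup>2 - s\<^sup>2 = 2 * (a * b - c)" by (simp add: s2) (simp add: power2_eq_square algebra_simps)
  have sab: "s \<le> a + b"
  proof (rule power2_le_imp_le)
    have "0 \<le> 2 * (a * b - c)" using c by simp
    then show "s\<^sup>2 \<le> (a + b)\<^sup>2" unfolding diff[symmetric] by (simp only: diff_ge_0_iff_ge)
  qed (use ab in linarith)
  have "2 * (a * b - c) = (a + b - s) * (a + b + s)" using diff by (simp add: power2_eq_square algebra_simps)
  also have "\<dots> \<le> (a + b - s) * (2 * (a + b))" using sab by (intro mult_left_mono) auto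
  also have "\<dots> \<le> (a + b - s) * (4 * (a * b))"
  proof (intro mult_left_mono)
    define q where "q = a * b"
    have "a \<le> q" "b \<le> q" unfolding q_def using ab by auto
    then have "2 * (a + b) \<le> 2 * (q + q)" by (intro mult_left_mono add_mono) auto
    then show "2 * (a + b) \<le> 4 * (a * b)" unfolding q_def by simp
  qed (use sab in auto)
  finally have 1: "1 - c / (a * b) \<le> 2 * (a + b - s)" using ab by (simp add: field_simps)
  \<comment> \<open>The added square completes the squared distance of the unit vectors
    \<open>(1, x) / a\<close> and \<open>(1, y) / b\<close>, which equals
    \<open>2 (1 - c / (a b))\<close>.\<close>
  have "(theta' x - theta' y)\<^sup>2 \<le> (x / a - y / b)\<^sup>2 + (1 / a - 1 / b)\<^sup>2" by (simp add: a_def b_def theta'_alt)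
  also have "\<dots> = (1 + x\<^sup>2) / a\<^sup>2 + (1 + y\<^sup>2) / b\<^sup>2 - 2 * (c / (a * b))"
  proof -
    have "(x * p - y * q)\<^sup>2 + (p - q)\<^sup>2 = (1 + x\<^sup>2) * p\<^sup>2 + (1 + y\<^sup>2) * q\<^sup>2 - 2 * ((1 + x * y) * (p * q))" for p q
      by (simp add: power2_eq_square algebra_simps)
    from this[of "1 / a" "1 / b"] show ?thesis unfolding c_def by (simp add: power_divide)
  qed
  also have "\<dots> = 2 * (1 - c / (a * b))" using ab by (simp add: a_def b_def theta_sq[symmetric])
  also have "\<dots> \<le> 2 * (2 * (a + b - s))" using 1 by (rule mult_left_mono) simp
  finally have "(theta' x - theta' y)\<^sup>2 \<le> 4 * (a + b - s)" by simp
  then have "(theta' x - theta' y)\<^sup>2 / 8 \<le> 4 * (a + b - s) / 8" by (rule divide_right_mono) simp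
  also have "\<dots> = (a + b) / 2 - s / 2" by (simp add: field_simps)
  finally show ?thesis unfolding s_def a_def b_def by simp
qed

text \<open>\<open>theta'\<close> is a homeomorphism onto the open interval from -1 to 1, so only
  limits of modulus 1 have to be excluded. Being bounded by \<open>b\<close> infinitely often keeps
  the square of \<open>theta'\<close> infinitely often at or below
  \<open>1 - 1 / (1 + b\<^sup>2)\<close>.\<close>

lemma tendsto_of_theta':
  fixes x :: "nat \<Rightarrow> real"
  assumes lim: "(\<lambda>n. theta' (x n)) \<longlonglongrightarrow> s" and fr: "\<exists>\<^sub>F n in sequentially. \<bar>x n\<bar> \<le> b"
  shows "convergent x"
proof -
  have l2: "(\<lambda>n. (theta' (x n))\<^sup>2) \<longlonglongrightarrow> s\<^sup>2" using lim by (intro tendsto_intros)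
  have "s\<^sup>2 < 1"
  proof (rule ccontr)
    assume "\<not> s\<^sup>2 < 1"
    moreover have p: "0 < 1 + b\<^sup>2" by (rule add_pos_nonneg) auto
    ultimately have "1 - 1 / (1 + b\<^sup>2) < s\<^sup>2" by (smt (verit) divide_pos_pos)
    then have ev: "\<forall>\<^sub>F n in sequentially. 1 - 1 / (1 + b\<^sup>2) < (theta' (x n))\<^sup>2" using l2 by (rule order_tendstoD(1)[rotated])
    obtain n where n: "\<bar>x n\<bar> \<le> b" "1 - 1 / (1 + b\<^sup>2) < (theta' (x n))\<^sup>2"
      using frequently_eventually_ex[OF fr ev] by blast
    have "(x n)\<^sup>2 \<le> b\<^sup>2" using n(1) by (metis abs_ge_zero power2_abs power_mono)
    then have "1 / (1 + b\<^sup>2) \<le> 1 / (1 + (x n)\<^sup>2)"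
      using p add_pos_nonneg[of 1 "(x n)\<^sup>2"] by (intro divide_left_mono) auto
    then show False using n(2) by (simp add: theta'_sq)
  qed
  then have "sqrt (1 - s\<^sup>2) \<noteq> 0" by simp
  then have "(\<lambda>n. theta' (x n) / sqrt (1 - (theta' (x n))\<^sup>2)) \<longlonglongrightarrow> s / sqrt (1 - s\<^sup>2)"
    using lim by (intro tendsto_intros)
  moreover have "(\<lambda>n. theta' (x n) / sqrt (1 - (theta' (x n))\<^sup>2)) = x"
    by (rule ext, rule theta'_inverse[symmetric])
  ultimately show ?thesis unfolding convergent_def by auto
qed

section \<open>Near-minimisers of the expectation of \<open>theta\<close>\<close>

context orlicz
begin

lemma integrable_theta: "integrable M u \<Longrightarrow> integrable M (\<lambda>\<omega>. theta (u \<omega>))"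
proof (rule Bochner_Integration.integrable_bound[of _ "\<lambda>\<omega>. 1 + \<bar>u \<omega>\<bar>"])
  assume "integrable M u"
  then show "integrable M (\<lambda>\<omega>. 1 + \<bar>u \<omega>\<bar>)" by auto
  from \<open>integrable M u\<close> have [measurable]: "u \<in> borel_measurable M" by auto
  show "(\<lambda>\<omega>. theta (u \<omega>)) \<in> borel_measurable M" by measurable
  show "AE \<omega> in M. norm (theta (u \<omega>)) \<le> norm (1 + \<bar>u \<omega>\<bar>)"
    using theta_le theta_pos by (intro AE_I2) (simp add: less_imp_le)
qed

text \<open>Near-minimisers of a strictly convex functional over decreasing convex sets are asymptotically
  close to each other, which replaces weak compactness.\<close>

lemma nested_convergent:
  assumes r: "0 < r" and D: "\<And>n. D n \<subseteq> ball r" "\<And>n. D n \<noteq> {}" "\<And>n k. n \<le> k \<Longrightarrow> D k \<subseteq> D n"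
    and mid: "\<And>n u v. u \<in> D n \<Longrightarrow> v \<in> D n \<Longrightarrow> (\<lambda>\<omega>. (u \<omega> + v \<omega>) / 2) \<in> D n"
  shows "\<exists>u v. (\<forall>n. u n \<in> D n) \<and> v \<in> borel_measurable M \<and> (AE \<omega> in M. (\<lambda>n. u n \<omega>) \<longlonglongrightarrow> v \<omega>)"
proof -
  define J where "J u = (\<integral>\<omega>. theta (u \<omega>) \<partial>M)" for u
  \<comment> \<open>As the sets decrease, the infima increase, and the L1 bound on the ball keeps
    them below \<open>1 + c\<close>. Hence they converge, and for large \<open>n \<le> k\<close> a
    near-minimiser over \<open>D k\<close> is nearly minimal over \<open>D n\<close> as
    well.\<close>
  define a where "a n = (INF u\<in>D n. J u)" for n
  obtain c where c: "\<And>\<xi>. \<xi> \<in> ball r \<Longrightarrow> integrable M \<xi>" "\<And>\<xi>. \<xi> \<in> ball r \<Longrightarrow> (\<integral>\<omega>. \<bar>\<xi> \<omega>\<bar> \<partial>M) \<le> c"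
    using ball_L1[OF r] by blast
  have Dint: "integrable M u" if "u \<in> D n" for u n using that D(1) c(1) by blast
  have J_ge: "1 \<le> J u" if "u \<in> D n" for u n
  proof -
    have "(\<integral>\<omega>. 1 \<partial>M) \<le> J u" unfolding J_def using integrable_theta[OF Dint[OF that]] theta_ge_1
      by (intro integral_mono) auto
    then show ?thesis by (simp add: prob_space)
  qed
  have J_le: "J u \<le> 1 + c" if "u \<in> D n" for u n
  proof -
    have "J u \<le> (\<integral>\<omega>. 1 + \<bar>u \<omega>\<bar> \<partial>M)" unfolding J_def using integrable_theta[OF Dint[OF that]] Dint[OF that] theta_le
      by (intro integral_mono) auto
    also have "\<dots> = 1 + (\<integral>\<omega>. \<bar>u \<omega>\<bar> \<partial>M)" using Dint[OF that] by (simp add: prob_space)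
    finally show ?thesis using c(2)[of u] that D(1) by force
  qed
  have bdd: "bdd_below (J ` D n)" for n using J_ge by (intro bdd_belowI[of _ 1]) auto
  have a_le: "a n \<le> J u" if "u \<in> D n" for u n unfolding a_def by (rule cINF_lower[OF bdd that])
  have "incseq a"
    unfolding incseq_def a_def using D by (intro allI impI cINF_superset_mono bdd) auto
  moreover have a_bd: "a n \<le> 1 + c" for n
    using a_le J_le D(2)[of n] by (meson ex_in_conv order_trans)
  ultimately have "convergent a" using incseq_convergent[of a] a_bd unfolding convergent_def by blast
  then obtain A where A: "a \<longlonglongrightarrow> A" unfolding convergent_def by blast
  have aA: "a n \<le> A" for n using incseq_le[OF \<open>incseq a\<close> A] by blast
  have "\<exists>u\<in>D n. J u \<le> a n + 1 / real (Suc n)" for n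
    using cINF_less_iff[OF D(2) bdd, of n "a n + 1 / real (Suc n)"] unfolding a_def[symmetric]
    by (meson less_add_same_cancel1 less_imp_le of_nat_0_less_iff zero_less_Suc zero_less_divide_1_iff)
  then obtain v where v: "\<And>n. v n \<in> D n" "\<And>n. J (v n) \<le> a n + 1 / real (Suc n)" by metis
  have vi: "integrable M (v n)" for n using v(1) Dint by blast
  have vm [measurable]: "v n \<in> borel_measurable M" for n using vi by auto
  \<comment> \<open>With the midpoint in \<open>D n\<close>, \<open>theta_gap\<close> bounds one
    eighth of the integral by \<open>(J (v n) + J (v k)) / 2 - a n\<close>. Inserting the
    near-minimality of \<open>v n\<close> and of \<open>v k\<close>, with
    \<open>a k \<le> A\<close>, and multiplying by 8 gives \<open>e n\<close>.\<close>
  define e where "e n = 4 * (A - a n) + 8 * (1 / real (Suc n))" for n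
  have close: "integrable M (\<lambda>\<omega>. (theta' (v n \<omega>) - theta' (v k \<omega>))\<^sup>2)"
    "(\<integral>\<omega>. (theta' (v n \<omega>) - theta' (v k \<omega>))\<^sup>2 \<partial>M) \<le> e n" if nk: "n \<le> k" for n k
  proof -
    show i: "integrable M (\<lambda>\<omega>. (theta' (v n \<omega>) - theta' (v k \<omega>))\<^sup>2)"
    proof (rule integrable_const_bound[where B = "2\<^sup>2"])
      have "\<bar>theta' x - theta' y\<bar> \<le> 2" for x y using theta'_abs[of x] theta'_abs[of y] by linarith
      then have "\<bar>theta' x - theta' y\<bar>\<^sup>2 \<le> 2\<^sup>2" for x y by (rule power_mono) simp
      then show "AE \<omega> in M. norm ((theta' (v n \<omega>) - theta' (v k \<omega>))\<^sup>2) \<le> 2\<^sup>2"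
        by (intro AE_I2) (simp only: real_norm_def abs_power2 power2_abs)
    qed measurable
    have mD: "(\<lambda>\<omega>. (v n \<omega> + v k \<omega>) / 2) \<in> D n" using mid[OF v(1)] v(1)[of k] D(3)[OF nk] by blast
    have it: "integrable M (\<lambda>\<omega>. theta (v n \<omega>))" "integrable M (\<lambda>\<omega>. theta (v k \<omega>))"
      "integrable M (\<lambda>\<omega>. theta ((v n \<omega> + v k \<omega>) / 2))"
      using vi integrable_theta[OF Dint[OF mD]] by (auto intro: integrable_theta)
    have "(\<integral>\<omega>. (theta' (v n \<omega>) - theta' (v k \<omega>))\<^sup>2 / 8 \<partial>M)
        \<le> (\<integral>\<omega>. (theta (v n \<omega>) + theta (v k \<omega>)) / 2 - theta ((v n \<omega> + v k \<omega>) / 2) \<partial>M)"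
      using i it theta_gap by (intro integral_mono) auto
    also have "\<dots> = (J (v n) + J (v k)) / 2 - J (\<lambda>\<omega>. (v n \<omega> + v k \<omega>) / 2)"
      unfolding J_def using it by simp
    also have "\<dots> \<le> (a n + 1 / real (Suc n) + (A + 1 / real (Suc n))) / 2 - a n"
    proof -
      have "1 / real (Suc k) \<le> 1 / real (Suc n)" using nk by (simp add: divide_simps)
      then have "J (v k) \<le> A + 1 / real (Suc n)" using v(2)[of k] aA[of k] by linarith
      then have "J (v n) + J (v k) \<le> a n + 1 / real (Suc n) + (A + 1 / real (Suc n))" using v(2)[of n] by (rule add_mono[rotated])
      then show ?thesis using a_le[OF mD] by (intro diff_mono divide_right_mono) auto
    qed
    also have "\<dots> = e n / 8"
    proof -
      have "(s + p + (t + p)) / 2 - s = (4 * (t - s) + 8 * p) / 8" for p s t :: real by (simp add: field_simps)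
      then show ?thesis unfolding e_def .
    qed
    finally show "(\<integral>\<omega>. (theta' (v n \<omega>) - theta' (v k \<omega>))\<^sup>2 \<partial>M) \<le> e n" by simp
  qed
  have "e \<longlonglongrightarrow> 4 * (A - A) + 8 * 0" unfolding e_def using A
    by (intro tendsto_intros LIMSEQ_Suc[OF lim_inverse_n', unfolded inverse_eq_divide])
  then have e0: "e \<longlonglongrightarrow> 0" by simp
  \<comment> \<open>Squared L2 distances of at most \<open>4^-j\<close> give L1 distances of at most
    \<open>2^-j\<close>, whose summability yields pointwise convergence.\<close>
  have "\<exists>\<kappa>. \<forall>j. e (\<kappa> j) \<le> (1/4) ^ j \<and> \<kappa> j < \<kappa> (Suc j)"
  proof (rule dependent_nat_choice)
    have ev: "\<exists>n>m. e n \<le> (1/4) ^ j" for j m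
    proof -
      have "\<forall>\<^sub>F n in sequentially. e n < (1/4) ^ j \<and> m < n"
        by (intro eventually_conj order_tendstoD(2)[OF e0] eventually_gt_at_top) simp
      then obtain n where "e n < (1/4) ^ j" "m < n" using eventually_happens' sequentially_bot by blast
      then show ?thesis by (auto intro: less_imp_le)
    qed
    show "\<exists>n. e n \<le> (1/4) ^ 0" using ev[of 0 0] by blast
    show "\<exists>m. e m \<le> (1/4) ^ Suc j \<and> n < m" for n j using ev[of n "Suc j"] by blast
  qed
  then obtain \<kappa> where \<kappa>: "\<And>j. e (\<kappa> j) \<le> (1/4) ^ j" "\<And>j. \<kappa> j < \<kappa> (Suc j)" by blast
  have sm: "strict_mono \<kappa>" using \<kappa>(2) by (rule strict_monoI_Suc)
  define u where "u j = v (\<kappa> j)" for j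
  have uD: "u j \<in> D j" for j using v(1)[of "\<kappa> j"] D(3)[OF seq_suble[OF sm, of j]] unfolding u_def by blast
  have [measurable]: "u j \<in> borel_measurable M" for j unfolding u_def by simp
  define d where "d j \<omega> = theta' (u (Suc j) \<omega>) - theta' (u j \<omega>)" for j \<omega>
  have "AE \<omega> in M. summable (\<lambda>j. \<bar>d j \<omega>\<bar>)"
  proof (rule AE_summable_of_integrals)
    show [measurable]: "d j \<in> borel_measurable M" for j unfolding d_def by measurable
    show di: "integrable M (d j)" for j
    proof (rule integrable_const_bound[where B = 2])
      have "\<bar>theta' x - theta' y\<bar> \<le> 2" for x y using theta'_abs[of x] theta'_abs[of y] by linarith
      then show "AE \<omega> in M. norm (d j \<omega>) \<le> 2" unfolding d_def by simp
    qed simp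
    have eq: "(d j \<omega>)\<^sup>2 = (theta' (v (\<kappa> j) \<omega>) - theta' (v (\<kappa> (Suc j)) \<omega>))\<^sup>2" for j \<omega>
      unfolding d_def u_def by (rule power2_commute)
    show "(\<integral>\<omega>. \<bar>d j \<omega>\<bar> \<partial>M) \<le> (1/2) ^ j" for j
    proof -
      have le: "\<kappa> j \<le> \<kappa> (Suc j)" using \<kappa>(2) by (simp add: less_imp_le)
      have i: "integrable M (\<lambda>\<omega>. (d j \<omega>)\<^sup>2)" and b: "(\<integral>\<omega>. (d j \<omega>)\<^sup>2 \<partial>M) \<le> (1/4) ^ j"
        using close[OF le] \<kappa>(1)[of j] unfolding eq by auto
      \<comment> \<open>The arithmetic-geometric mean inequality with weight \<open>2^j\<close>, in
        place of Cauchy-Schwarz for integrals.\<close>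
      have "\<bar>d j \<omega>\<bar> \<le> (2 ^ j * (d j \<omega>)\<^sup>2 + (1/2) ^ j) / 2" for \<omega>
      proof -
        have "0 \<le> (2 ^ j * \<bar>d j \<omega>\<bar> - 1)\<^sup>2" by simp
        then have "2 * (2 ^ j * \<bar>d j \<omega>\<bar>) \<le> (2 ^ j * \<bar>d j \<omega>\<bar>)\<^sup>2 + 1" by (simp add: power2_diff)
        then show ?thesis by (simp add: power_mult_distrib power2_eq_square power_one_over field_simps)
      qed
      then have "(\<integral>\<omega>. \<bar>d j \<omega>\<bar> \<partial>M) \<le> (\<integral>\<omega>. (2 ^ j * (d j \<omega>)\<^sup>2 + (1/2) ^ j) / 2 \<partial>M)"
        using i di[of j] by (intro integral_mono) auto
      also have "\<dots> = (2 ^ j * (\<integral>\<omega>. (d j \<omega>)\<^sup>2 \<partial>M) + (1/2) ^ j) / 2" using i by (simp add: prob_space)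
      also have "\<dots> \<le> (2 ^ j * (1/4) ^ j + (1/2) ^ j) / 2"
        using b by (intro divide_right_mono add_right_mono mult_left_mono) auto
      also have "\<dots> = (1/2) ^ j" by (simp add: power_mult_distrib[symmetric])
      finally show ?thesis .
    qed
    show "summable (\<lambda>j. (1/2 :: real) ^ j)" by (intro summable_geometric) simp
  qed
  then have conv1: "AE \<omega> in M. convergent (\<lambda>j. theta' (u j \<omega>))"
  proof eventually_elim
    case (elim \<omega>)
    then have "summable (\<lambda>j. d j \<omega>)" by (rule summable_rabs_cancel)
    then have "convergent (\<lambda>n. \<Sum>j<n. d j \<omega>)" by (simp add: summable_iff_convergent)
    moreover have "(\<Sum>j<n. d j \<omega>) = theta' (u n \<omega>) - theta' (u 0 \<omega>)" for n
      unfolding d_def by (rule sum_lessThan_telescope)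
    ultimately have "convergent (\<lambda>n. theta' (u n \<omega>) - theta' (u 0 \<omega>))" by simp
    then show ?case using convergent_add[OF _ convergent_const[of "theta' (u 0 \<omega>)"]] by force
  qed
  have "(\<integral>\<^sup>+\<omega>. liminf (\<lambda>j. ennreal \<bar>u j \<omega>\<bar>) \<partial>M) \<le> liminf (\<lambda>j. \<integral>\<^sup>+\<omega>. ennreal \<bar>u j \<omega>\<bar> \<partial>M)"
    by (intro nn_integral_liminf) auto
  also have "\<dots> \<le> ennreal c"
  proof (rule Liminf_le)
    show "\<forall>\<^sub>F j in sequentially. (\<integral>\<^sup>+\<omega>. ennreal \<bar>u j \<omega>\<bar> \<partial>M) \<le> ennreal c"
    proof (intro always_eventually allI)
      fix j
      have "u j \<in> ball r" using uD D(1) by blast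
      then show "(\<integral>\<^sup>+\<omega>. ennreal \<bar>u j \<omega>\<bar> \<partial>M) \<le> ennreal c"
        using c[of "u j"] by (subst nn_integral_eq_integral) (auto intro: ennreal_leI)
    qed
  qed simp
  finally have "(\<integral>\<^sup>+\<omega>. liminf (\<lambda>j. ennreal \<bar>u j \<omega>\<bar>) \<partial>M) \<noteq> \<infinity>"
    using ennreal_less_top leD by (metis infinity_ennreal_def)
  then have "AE \<omega> in M. liminf (\<lambda>j. ennreal \<bar>u j \<omega>\<bar>) \<noteq> \<infinity>" by (intro nn_integral_PInf_AE) auto
  \<comment> \<open>Convergence of \<open>theta' (u j)\<close> still allows
    \<open>\<bar>u j\<bar>\<close> to tend to infinity. The bound on the L1 norms and Fatou's lemma
    exclude this almost everywhere.\<close>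
  then have bd: "AE \<omega> in M. \<exists>b. \<exists>\<^sub>F j in sequentially. \<bar>u j \<omega>\<bar> \<le> b"
  proof eventually_elim
    case (elim \<omega>)
    then obtain n :: nat where n: "liminf (\<lambda>j. ennreal \<bar>u j \<omega>\<bar>) < of_nat n"
      using less_top ennreal_Ex_less_of_nat by (metis infinity_ennreal_def)
    show ?case
    proof (rule ccontr)
      assume "\<nexists>b. \<exists>\<^sub>F j in sequentially. \<bar>u j \<omega>\<bar> \<le> b"
      then have "\<forall>\<^sub>F j in sequentially. real n < \<bar>u j \<omega>\<bar>" unfolding frequently_def not_le by auto
      then have "\<forall>\<^sub>F j in sequentially. of_nat n \<le> ennreal \<bar>u j \<omega>\<bar>"
        by eventually_elim (simp add: ennreal_of_nat_eq_real_of_nat ennreal_leI)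
      then have "of_nat n \<le> liminf (\<lambda>j. ennreal \<bar>u j \<omega>\<bar>)" by (rule Liminf_bounded)
      then show False using n by simp
    qed
  qed
  have conv: "AE \<omega> in M. (\<lambda>j. u j \<omega>) \<longlonglongrightarrow> lim (\<lambda>j. u j \<omega>)"
    using conv1 bd
  proof eventually_elim
    case (elim \<omega>)
    then obtain s b where "(\<lambda>j. theta' (u j \<omega>)) \<longlonglongrightarrow> s" "\<exists>\<^sub>F j in sequentially. \<bar>u j \<omega>\<bar> \<le> b"
      unfolding convergent_def[of "\<lambda>j. theta' (u j \<omega>)"] by blast
    then have "convergent (\<lambda>j. u j \<omega>)" by (rule tendsto_of_theta'[where x = "\<lambda>j. u j \<omega>"])
    then show ?case by (simp add: convergent_LIMSEQ_iff)
  qed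
  have "(\<lambda>\<omega>. lim (\<lambda>j. u j \<omega>)) \<in> borel_measurable M" by (intro borel_measurable_lim_metric) auto
  then show ?thesis using uD conv by blast
qed

end

section \<open>Separation\<close>

lemma summable_mult_l2:
  fixes x y :: "nat \<Rightarrow> real"
  assumes "summable (\<lambda>k. (x k)\<^sup>2)" "summable (\<lambda>k. (y k)\<^sup>2)"
  shows "summable (\<lambda>k. x k * y k)"
proof (rule summable_comparison_test)
  show "summable (\<lambda>k. (x k)\<^sup>2 + (y k)\<^sup>2)" using assms by (rule summable_add)
  have "\<bar>a * b\<bar> \<le> a\<^sup>2 + b\<^sup>2" for a b :: real
  proof -
    define p where "p = \<bar>a * b\<bar>"
    have "2 * p \<le> a\<^sup>2 + b\<^sup>2" using sum_squares_bound[of "\<bar>a\<bar>" "\<bar>b\<bar>"] by (simp add: p_def abs_mult)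
    moreover have "0 \<le> p" unfolding p_def by simp
    ultimately show ?thesis unfolding p_def[symmetric] by linarith
  qed
  then show "\<exists>N. \<forall>k\<ge>N. norm (x k * y k) \<le> (x k)\<^sup>2 + (y k)\<^sup>2" by auto
qed

lemma suminf_square_add:
  fixes x y :: "nat \<Rightarrow> real"
  assumes "summable (\<lambda>k. (x k)\<^sup>2)" "summable (\<lambda>k. (y k)\<^sup>2)"
  shows "summable (\<lambda>k. (a * x k + b * y k)\<^sup>2)"
    and "(\<Sum>k. (a * x k + b * y k)\<^sup>2) = a\<^sup>2 * (\<Sum>k. (x k)\<^sup>2) + 2 * a * b * (\<Sum>k. x k * y k) + b\<^sup>2 * (\<Sum>k. (y k)\<^sup>2)"
proof -
  have eq: "(a * x k + b * y k)\<^sup>2 = a\<^sup>2 * (x k)\<^sup>2 + 2 * a * b * (x k * y k) + b\<^sup>2 * (y k)\<^sup>2" for k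
    by (simp add: power2_eq_square algebra_simps)
  have "(\<lambda>k. (a * x k + b * y k)\<^sup>2) sums (a\<^sup>2 * (\<Sum>k. (x k)\<^sup>2) + 2 * a * b * (\<Sum>k. x k * y k) + b\<^sup>2 * (\<Sum>k. (y k)\<^sup>2))"
    unfolding eq using assms summable_mult_l2[OF assms] by (intro sums_add sums_mult summable_sums)
  then show "summable (\<lambda>k. (a * x k + b * y k)\<^sup>2)"
    "(\<Sum>k. (a * x k + b * y k)\<^sup>2) = a\<^sup>2 * (\<Sum>k. (x k)\<^sup>2) + 2 * a * b * (\<Sum>k. x k * y k) + b\<^sup>2 * (\<Sum>k. (y k)\<^sup>2)"
    by (auto simp: sums_iff)
qed

lemma cauchy_schwarz_l2:
  fixes x y :: "nat \<Rightarrow> real"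
  assumes "summable (\<lambda>k. (x k)\<^sup>2)" "summable (\<lambda>k. (y k)\<^sup>2)"
  shows "(\<Sum>k. x k * y k)\<^sup>2 \<le> (\<Sum>k. (x k)\<^sup>2) * (\<Sum>k. (y k)\<^sup>2)"
proof -
  define A B P where "A = (\<Sum>k. (x k)\<^sup>2)" and "B = (\<Sum>k. (y k)\<^sup>2)" and "P = (\<Sum>k. x k * y k)"
  have B0: "0 \<le> B" unfolding B_def using assms by (intro suminf_nonneg) auto
  have key: "0 \<le> a\<^sup>2 * A + 2 * a * b * P + b\<^sup>2 * B" for a b
    unfolding A_def B_def P_def suminf_square_add(2)[OF assms, symmetric]
    using suminf_square_add(1)[OF assms] by (intro suminf_nonneg) auto
  have "P\<^sup>2 \<le> A * B"
  proof (cases "B = 0")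
    case True
    have "P = 0"
    proof (rule ccontr)
      assume P: "P \<noteq> 0"
      \<comment> \<open>With \<open>B = 0\<close> the quadratic form is affine in \<open>b\<close>,
        and this value of \<open>b\<close> makes it equal to -1.\<close>
      have "0 \<le> A + 2 * (- (A + 1) / (2 * P)) * P" using key[of 1 "- (A + 1) / (2 * P)"] True by simp
      also have "\<dots> = - 1" using P by (simp add: field_simps)
      finally show False by simp
    qed
    then show ?thesis using True by simp
  next
    case False
    have "0 \<le> B * (A * B - P\<^sup>2)" using key[of B "- P"] by (simp add: power2_eq_square algebra_simps)
    then show ?thesis using False B0 by (simp add: zero_le_mult_iff)
  qed
  then show ?thesis unfolding A_def B_def P_def .
qed

text \<open>The separating vector is the point of minimal norm in the closure of \<open>S\<close>.\<close>

lemma l2_separation: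
  fixes S :: "(nat \<Rightarrow> real) set"
  assumes ne: "S \<noteq> {}" and sq: "\<And>x. x \<in> S \<Longrightarrow> summable (\<lambda>k. (x k)\<^sup>2)"
    and convex: "\<And>x y a b. x \<in> S \<Longrightarrow> y \<in> S \<Longrightarrow> 0 \<le> a \<Longrightarrow> 0 \<le> b \<Longrightarrow> a + b = 1 \<Longrightarrow> (\<lambda>k. a * x k + b * y k) \<in> S"
    and ge: "\<And>x. x \<in> S \<Longrightarrow> 1 \<le> (\<Sum>k. (x k)\<^sup>2)"
  shows "\<exists>y. summable (\<lambda>k. (y k)\<^sup>2) \<and> (\<forall>x\<in>S. 1 \<le> (\<Sum>k. y k * x k))"
proof -
  define N where "N x = (\<Sum>k. (x k)\<^sup>2)" for x :: "nat \<Rightarrow> real"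
  define d where "d = (INF x\<in>S. N x)"
  have bdd: "bdd_below (N ` S)" using ge unfolding N_def by (intro bdd_belowI[of _ 1]) auto
  have d_le: "d \<le> N x" if "x \<in> S" for x unfolding d_def by (rule cINF_lower[OF bdd that])
  have d1: "1 \<le> d" unfolding d_def N_def by (rule cINF_greatest[OF ne ge])
  have "\<exists>x\<in>S. N x < d + 1 / real (Suc n)" for n
    using cINF_less_iff[OF ne bdd, of "d + 1 / real (Suc n)"] unfolding d_def[symmetric] by simp
  then obtain x where xS: "\<And>n. x n \<in> S" and xN: "\<And>n. N (x n) < d + 1 / real (Suc n)" by metis
  have i0: "(\<lambda>n. 1 / real (Suc n)) \<longlonglongrightarrow> 0" by (rule LIMSEQ_Suc[OF lim_inverse_n', unfolded inverse_eq_divide])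
  have Nx: "(\<lambda>n. N (x n)) \<longlonglongrightarrow> d"
  proof (rule tendsto_sandwich[OF _ _ tendsto_const[of d]])
    show "(\<lambda>n. d + 1 / real (Suc n)) \<longlonglongrightarrow> d" using tendsto_add[OF tendsto_const[of d] i0] by simp
  qed (use d_le[OF xS] less_imp_le[OF xN] in \<open>auto intro!: always_eventually simp del: of_nat_Suc\<close>)
  \<comment> \<open>Parallelogram law: the midpoint belongs to \<open>S\<close>, so its squared norm
    is at least \<open>d\<close>. Partial sums are enough and avoid a completeness statement for the
    sequence space.\<close>
  have close: "(\<Sum>k<K. (x n k - x m k)\<^sup>2) \<le> 2 * (1 / real (Suc n)) + 2 * (1 / real (Suc m))" for n m K
  proof -
    note s = sq[OF xS[of n]] sq[OF xS[of m]]
    have "(\<Sum>k<K. (x n k - x m k)\<^sup>2) \<le> N (\<lambda>k. 1 * x n k + (- 1) * x m k)"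
      unfolding N_def using sum_le_suminf[OF suminf_square_add(1)[OF s, of 1 "- 1"], of "{..<K}"] by simp
    also have "\<dots> = 2 * N (x n) + 2 * N (x m) - 4 * N (\<lambda>k. 1/2 * x n k + 1/2 * x m k)"
      unfolding N_def suminf_square_add(2)[OF s] by (simp add: power2_eq_square algebra_simps)
    also have "\<dots> \<le> 2 * (d + 1 / real (Suc n)) + 2 * (d + 1 / real (Suc m)) - 4 * d"
      using d_le[OF convex[OF xS[of n] xS[of m], of "1/2" "1/2"]] xN[of n] xN[of m]
      by (intro diff_mono add_mono mult_left_mono) auto
    finally show ?thesis by (simp add: algebra_simps)
  qed
  have coord: "convergent (\<lambda>n. x n k)" for k
  proof (rule Cauchy_convergent, rule CauchyI)
    fix e :: real assume e: "0 < e"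
    have "\<forall>\<^sub>F n in sequentially. 1 / real (Suc n) < e\<^sup>2 / 4" using e by (intro order_tendstoD(2)[OF i0]) auto
    then obtain n0 where n0: "\<And>n. n \<ge> n0 \<Longrightarrow> 1 / real (Suc n) < e\<^sup>2 / 4" unfolding eventually_sequentially by blast
    have "norm (x m k - x n k) < e" if "m \<ge> n0" "n \<ge> n0" for m n
    proof -
      have "(x m k - x n k)\<^sup>2 \<le> (\<Sum>k<Suc k. (x m k - x n k)\<^sup>2)" by (rule member_le_sum) auto
      also have "\<dots> \<le> 2 * (1 / real (Suc m)) + 2 * (1 / real (Suc n))" by (rule close)
      also have "\<dots> < 2 * (e\<^sup>2 / 4) + 2 * (e\<^sup>2 / 4)"
        using n0[OF that(1)] n0[OF that(2)] by (intro add_strict_mono mult_strict_left_mono) auto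
      also have "\<dots> = e\<^sup>2" by simp
      finally have "(norm (x m k - x n k))\<^sup>2 < e\<^sup>2" by (simp only: real_norm_def power2_abs)
      then show ?thesis by (rule power2_less_imp_less) (use e in simp)
    qed
    then show "\<exists>M. \<forall>m\<ge>M. \<forall>n\<ge>M. norm (x m k - x n k) < e" by blast
  qed
  then obtain y where y: "\<And>k. (\<lambda>n. x n k) \<longlonglongrightarrow> y k" unfolding convergent_def by metis
  have part: "(\<Sum>k<K. (x n k - y k)\<^sup>2) \<le> 2 * (1 / real (Suc n))" for n K
  proof (rule LIMSEQ_le)
    show "(\<lambda>m. \<Sum>k<K. (x n k - x m k)\<^sup>2) \<longlonglongrightarrow> (\<Sum>k<K. (x n k - y k)\<^sup>2)" by (intro tendsto_intros y)
    show "(\<lambda>m. 2 * (1 / real (Suc n)) + 2 * (1 / real (Suc m))) \<longlonglongrightarrow> 2 * (1 / real (Suc n))"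
      using tendsto_add[OF tendsto_const[of "2 * (1 / real (Suc n))"] tendsto_mult_left[OF i0, of 2]] by simp
  qed (use close in auto)
  have ds: "summable (\<lambda>k. (x n k - y k)\<^sup>2)" for n
    by (rule summableI_nonneg_bounded[OF _ part]) simp
  have dN: "N (\<lambda>k. x n k - y k) \<le> 2 * (1 / real (Suc n))" for n
    unfolding N_def using ds[of n] part by (intro suminf_le_const) auto
  have ys: "summable (\<lambda>k. (y k)\<^sup>2)"
    using suminf_square_add(1)[OF sq[OF xS[of 0]] ds[of 0], of 1 "- 1"] by simp
  have "1 \<le> (\<Sum>k. y k * z k)" if z: "z \<in> S" for z
  proof -
    define p where "p = (\<Sum>k. y k * z k)"
    have lim: "(\<lambda>n. \<Sum>k. x n k * z k) \<longlonglongrightarrow> p"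
    proof (rule LIM_zero_cancel, rule Lim_null_comparison)
      show "\<forall>\<^sub>F n in sequentially. norm ((\<Sum>k. x n k * z k) - p) \<le> sqrt (2 * (1 / real (Suc n)) * N z)"
      proof (intro always_eventually allI)
        fix n
        have "(\<Sum>k. x n k * z k) - p = (\<Sum>k. (x n k - y k) * z k)"
          unfolding p_def using summable_mult_l2[OF sq[OF xS[of n]] sq[OF z]] summable_mult_l2[OF ys sq[OF z]]
          by (simp add: suminf_diff left_diff_distrib)
        then have "((\<Sum>k. x n k * z k) - p)\<^sup>2 \<le> N (\<lambda>k. x n k - y k) * N z"
          using cauchy_schwarz_l2[OF ds[of n] sq[OF z]] unfolding N_def by simp
        also have "\<dots> \<le> 2 * (1 / real (Suc n)) * N z"
          using dN suminf_nonneg[OF sq[OF z]] unfolding N_def[of z] by (intro mult_right_mono) auto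
        finally show "norm ((\<Sum>k. x n k * z k) - p) \<le> sqrt (2 * (1 / real (Suc n)) * N z)"
          by (intro real_le_rsqrt) simp
      qed
      show "(\<lambda>n. sqrt (2 * (1 / real (Suc n)) * N z)) \<longlonglongrightarrow> 0"
        using tendsto_real_sqrt[OF tendsto_mult_right[OF tendsto_mult_left[OF i0, of 2], of "N z"]] by simp
    qed
    \<comment> \<open>Minimality along the segment from \<open>x n\<close> to \<open>z\<close>, with
      \<open>n\<close> sent to infinity: the limit \<open>y\<close> itself need not belong to
      \<open>S\<close>.\<close>
    have t_ineq: "d \<le> (1 - t)\<^sup>2 * d + 2 * (1 - t) * t * p + t\<^sup>2 * N z" if t: "0 < t" "t < 1" for t
    proof (rule LIMSEQ_le_const)
      show "(\<lambda>n. (1 - t)\<^sup>2 * N (x n) + 2 * (1 - t) * t * (\<Sum>k. x n k * z k) + t\<^sup>2 * N z)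
          \<longlonglongrightarrow> (1 - t)\<^sup>2 * d + 2 * (1 - t) * t * p + t\<^sup>2 * N z"
        by (intro tendsto_intros Nx lim)
      have "d \<le> N (\<lambda>k. (1 - t) * x n k + t * z k)" for n
        using t by (intro d_le convex xS z) auto
      then show "\<exists>n0. \<forall>n\<ge>n0. d \<le> (1 - t)\<^sup>2 * N (x n) + 2 * (1 - t) * t * (\<Sum>k. x n k * z k) + t\<^sup>2 * N z"
        unfolding N_def using suminf_square_add(2)[OF sq[OF xS] sq[OF z]] by metis
    qed
    have "2 * d \<le> 2 * p"
    proof (rule LIMSEQ_le_const)
      \<comment> \<open>After division by \<open>t\<close>, \<open>t\<close> is sent to 0. The index
        shift by two keeps \<open>?t 0 = 1/2\<close> below 1.\<close>
      let ?t = "\<lambda>n. 1 / real (Suc (Suc n))"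
      have t0: "?t \<longlonglongrightarrow> 0" by (rule LIMSEQ_Suc[OF i0])
      show "(\<lambda>n. ?t n * d + 2 * (1 - ?t n) * p + ?t n * N z) \<longlonglongrightarrow> 2 * p"
      proof -
        have "(\<lambda>n. ?t n * d + 2 * (1 - ?t n) * p + ?t n * N z) \<longlonglongrightarrow> 0 * d + 2 * (1 - 0) * p + 0 * N z"
          by (intro tendsto_intros t0)
        then show ?thesis by simp
      qed
      have "2 * d \<le> t * d + 2 * (1 - t) * p + t * N z" if "0 < t" "t < 1" for t
      proof -
        have "t * (2 * d) \<le> t * (t * d + 2 * (1 - t) * p + t * N z)"
          using t_ineq[OF that] by (simp add: power2_eq_square algebra_simps)
        then show ?thesis using that by simp
      qed
      moreover have "0 < ?t n" "?t n < 1" for n by (auto simp: divide_less_eq)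
      ultimately show "\<exists>N0. \<forall>n\<ge>N0. 2 * d \<le> ?t n * d + 2 * (1 - ?t n) * p + ?t n * N z" by blast
    qed
    then show ?thesis using d1 unfolding p_def by simp
  qed
  then show ?thesis using ys by blast
qed

section \<open>Separation of bounded convex sets from balls by bounded functions\<close>

lemma theta_lipschitz: "\<bar>theta x - theta y\<bar> \<le> \<bar>x - y\<bar>"
proof -
  have "theta x - theta y \<le> \<bar>x - y\<bar>" for x y
  proof -
    have "theta x - theta y \<le> \<bar>theta' x\<bar> * \<bar>x - y\<bar>" using theta_subgradient[of x y] by (metis abs_ge_self abs_mult order_trans)
    also have "\<dots> \<le> 1 * \<bar>x - y\<bar>" using theta'_abs by (intro mult_right_mono) auto
    finally show ?thesis by simp
  qed
  from this[of x y] this[of y x] show ?thesis by (simp add: abs_le_iff abs_minus_commute)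
qed

context orlicz
begin

lemma integral_theta_tendsto:
  assumes u: "\<And>n. u n \<in> ball r" and r: "0 < r" and v: "v \<in> borel_measurable M"
    and lim: "AE \<omega> in M. (\<lambda>n. u n \<omega>) \<longlonglongrightarrow> v \<omega>"
  shows "(\<lambda>n. \<integral>\<omega>. theta (u n \<omega>) \<partial>M) \<longlonglongrightarrow> (\<integral>\<omega>. theta (v \<omega>) \<partial>M)"
proof (rule LIM_zero_cancel, rule Lim_null_comparison[OF _ ball_L1_tendsto[OF u r v lim]], intro always_eventually allI)
  fix n
  have i: "integrable M (u n)" "integrable M v" using ball_integrable[OF r] u ball_closed[OF u v lim r] by auto
  then have it: "integrable M (\<lambda>\<omega>. theta (u n \<omega>))" "integrable M (\<lambda>\<omega>. theta (v \<omega>))" by (auto intro: integrable_theta)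
  have "norm ((\<integral>\<omega>. theta (u n \<omega>) \<partial>M) - (\<integral>\<omega>. theta (v \<omega>) \<partial>M)) = \<bar>\<integral>\<omega>. theta (u n \<omega>) - theta (v \<omega>) \<partial>M\<bar>" using it by simp
  also have "\<dots> \<le> (\<integral>\<omega>. \<bar>theta (u n \<omega>) - theta (v \<omega>)\<bar> \<partial>M)" by (rule integral_abs_bound)
  also have "\<dots> \<le> (\<integral>\<omega>. \<bar>u n \<omega> - v \<omega>\<bar> \<partial>M)" using i it theta_lipschitz by (intro integral_mono) auto
  finally show "norm ((\<integral>\<omega>. theta (u n \<omega>) \<partial>M) - (\<integral>\<omega>. theta (v \<omega>) \<partial>M)) \<le> (\<integral>\<omega>. \<bar>u n \<omega> - v \<omega>\<bar> \<partial>M)" .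
qed

text \<open>The expectation of \<open>theta\<close> is minimised over the differences
  \<open>\<xi> - \<beta>\<close> of points of \<open>D\<close> and of the ball. If \<open>u\<close>
  is a limit of near-minimisers, then \<open>h = theta'(u)\<close> satisfies
  \<open>E[h (\<xi> - \<beta> - u)] \<ge> 0\<close>. So \<open>h\<close> is larger on
  \<open>D\<close> than on the ball by at least \<open>E[h u]\<close>, which is positive unless
  \<open>u\<close> vanishes a.e.\<close>

lemma separate_from_ball:
  assumes r: "0 < r" and \<rho>: "0 < \<rho>" and D: "D \<subseteq> ball r" and disj: "D \<inter> ball \<rho> = {}"
    and convex: "\<And>u v a b. u \<in> D \<Longrightarrow> v \<in> D \<Longrightarrow> 0 \<le> a \<Longrightarrow> 0 \<le> b \<Longrightarrow> a + b = 1 \<Longrightarrow> (\<lambda>\<omega>. a * u \<omega> + b * v \<omega>) \<in> D"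
    and closed: "\<And>u v. (\<And>n::nat. u n \<in> D) \<Longrightarrow> v \<in> borel_measurable M \<Longrightarrow> (AE \<omega> in M. (\<lambda>n. u n \<omega>) \<longlonglongrightarrow> v \<omega>) \<Longrightarrow> v \<in> D"
  shows "\<exists>g\<in>borel_measurable M. (\<exists>b. \<forall>\<omega>. \<bar>g \<omega>\<bar> \<le> b) \<and> (\<forall>\<xi>\<in>ball \<rho>. \<bar>\<integral>\<omega>. g \<omega> * \<xi> \<omega> \<partial>M\<bar> \<le> 1)
     \<and> (\<forall>\<xi>\<in>D. 1 < (\<integral>\<omega>. g \<omega> * \<xi> \<omega> \<partial>M))"
proof (cases "D = {}")
  case True
  then show ?thesis by (intro bexI[of _ "\<lambda>_. 0"]) auto
next
  case ne: False
  define V where "V = {\<lambda>\<omega>. \<xi> \<omega> - \<beta> \<omega> | \<xi> \<beta>. \<xi> \<in> D \<and> \<beta> \<in> ball \<rho>}"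
  have R: "0 < r + \<rho>" using r \<rho> by simp
  have VI: "(\<lambda>\<omega>. \<xi> \<omega> - \<beta> \<omega>) \<in> V" if "\<xi> \<in> D" "\<beta> \<in> ball \<rho>" for \<xi> \<beta> using that unfolding V_def by auto
  have VE: "\<exists>\<xi>\<in>D. \<exists>\<beta>\<in>ball \<rho>. v = (\<lambda>\<omega>. \<xi> \<omega> - \<beta> \<omega>)" if "v \<in> V" for v using that unfolding V_def by auto
  have VB: "V \<subseteq> ball (r + \<rho>)" unfolding V_def using D r \<rho> ball_diff by blast
  have Vconv: "(\<lambda>\<omega>. a * u \<omega> + b * v \<omega>) \<in> V" if uv: "u \<in> V" "v \<in> V" and ab: "0 \<le> a" "0 \<le> b" "a + b = 1" for u v a b
  proof -
    obtain \<xi> \<beta> \<xi>' \<beta>' where *: "\<xi> \<in> D" "\<beta> \<in> ball \<rho>" "u = (\<lambda>\<omega>. \<xi> \<omega> - \<beta> \<omega>)" "\<xi>' \<in> D" "\<beta>' \<in> ball \<rho>" "v = (\<lambda>\<omega>. \<xi>' \<omega> - \<beta>' \<omega>)"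
      using VE uv by metis
    have "(\<lambda>\<omega>. (a * \<xi> \<omega> + b * \<xi>' \<omega>) - (a * \<beta> \<omega> + b * \<beta>' \<omega>)) \<in> V"
      using * ab \<rho> by (intro VI convex ball_convex) auto
    then show ?thesis unfolding * by (simp add: algebra_simps)
  qed
  have Vmid: "(\<lambda>\<omega>. (u \<omega> + v \<omega>) / 2) \<in> V" if "u \<in> V" "v \<in> V" for u v
    using Vconv[OF that, of "1/2" "1/2"] by (simp add: add_divide_distrib)
  have Vint: "integrable M v" if "v \<in> V" for v using ball_integrable[OF R] VB that by blast
  have Vne: "V \<noteq> {}" using ne VI zero_ball by blast
  define J where "J u = (\<integral>\<omega>. theta (u \<omega>) \<partial>M)" for u
  define d where "d = (INF u\<in>V. J u)"
  have bdd: "bdd_below (J ` V)"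
    using theta_pos unfolding J_def by (intro bdd_belowI[of _ 0]) (auto intro!: integral_nonneg_AE simp: less_imp_le)
  have d_le: "d \<le> J u" if "u \<in> V" for u unfolding d_def by (rule cINF_lower[OF bdd that])
  define D' where "D' n = {v \<in> V. J v \<le> d + 1 / real (Suc n)}" for n
  have "\<exists>w u. (\<forall>n. w n \<in> D' n) \<and> u \<in> borel_measurable M \<and> (AE \<omega> in M. (\<lambda>n. w n \<omega>) \<longlonglongrightarrow> u \<omega>)"
  proof (rule nested_convergent[OF R])
    show "D' n \<subseteq> ball (r + \<rho>)" for n unfolding D'_def using VB by auto
    show "D' n \<noteq> {}" for n
    proof -
      have "\<exists>v\<in>V. J v < d + 1 / real (Suc n)"
        using cINF_less_iff[OF Vne bdd, of "d + 1 / real (Suc n)"] unfolding d_def[symmetric] by simp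
      then show ?thesis unfolding D'_def using less_imp_le by blast
    qed
    show "D' k \<subseteq> D' n" if "n \<le> k" for n k
    proof -
      have "1 / real (Suc k) \<le> 1 / real (Suc n)" using that by (simp add: divide_simps)
      then show ?thesis unfolding D'_def by auto
    qed
    show "(\<lambda>\<omega>. (u \<omega> + v \<omega>) / 2) \<in> D' n" if "u \<in> D' n" "v \<in> D' n" for n u v
    proof -
      have uv: "u \<in> V" "v \<in> V" "J u \<le> d + 1 / real (Suc n)" "J v \<le> d + 1 / real (Suc n)" using that unfolding D'_def by auto
      have "theta ((x + y) / 2) \<le> (theta x + theta y) / 2" for x y
        using theta_gap[of x y] zero_le_power2[of "theta' x - theta' y"] by linarith
      then have "J (\<lambda>\<omega>. (u \<omega> + v \<omega>) / 2) \<le> (\<integral>\<omega>. (theta (u \<omega>) + theta (v \<omega>)) / 2 \<partial>M)"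
        unfolding J_def using integrable_theta[OF Vint] uv Vmid by (intro integral_mono) auto
      also have "\<dots> = (J u + J v) / 2" unfolding J_def using integrable_theta[OF Vint] uv by simp
      also have "\<dots> \<le> d + 1 / real (Suc n)" using uv(3,4) by (simp del: of_nat_Suc)
      finally show ?thesis unfolding D'_def using Vmid uv by simp
    qed
  qed
  then obtain w u where w: "\<And>n. w n \<in> D' n" and u [measurable]: "u \<in> borel_measurable M"
    and lim: "AE \<omega> in M. (\<lambda>n. w n \<omega>) \<longlonglongrightarrow> u \<omega>" by blast
  have wV: "w n \<in> V" for n using w unfolding D'_def by auto
  then have wB: "w n \<in> ball (r + \<rho>)" for n using VB by auto
  have uB: "u \<in> ball (r + \<rho>)" by (rule ball_closed[OF wB u lim R])
  have ui: "integrable M u" by (rule ball_integrable[OF R uB])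
  have i0: "(\<lambda>n. 1 / real (Suc n)) \<longlonglongrightarrow> 0" by (rule LIMSEQ_Suc[OF lim_inverse_n', unfolded inverse_eq_divide])
  have Ju: "J u \<le> d"
  proof (rule LIMSEQ_le)
    show "(\<lambda>n. J (w n)) \<longlonglongrightarrow> J u" unfolding J_def by (rule integral_theta_tendsto[OF wB R u lim])
    show "(\<lambda>n. d + 1 / real (Suc n)) \<longlonglongrightarrow> d" using tendsto_add[OF tendsto_const[of d] i0] by simp
  qed (use w in \<open>auto simp: D'_def\<close>)
  have nz: "\<not> (AE \<omega> in M. u \<omega> = 0)"
  proof
    assume u0: "AE \<omega> in M. u \<omega> = 0"
    have "AE \<omega> in M. (\<lambda>n. w n \<omega>) \<longlonglongrightarrow> 0" using lim u0 by eventually_elim simp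
    then have w0: "(\<lambda>n. \<integral>\<omega>. \<bar>w n \<omega>\<bar> \<partial>M) \<longlonglongrightarrow> 0" by (rule ball_L1_tendsto_0[OF wB R])
    \<comment> \<open>The set of differences is not known to be closed, so \<open>u = 0\<close> does
      not directly give a common point. It gives points of \<open>D\<close> at L1 distance at most
      \<open>1 / (n + 1)\<close> from the ball; the sets of these decrease and contain their
      midpoints, and a second selection converges to a point \<open>v\<close> of both
      \<open>D\<close> and the ball.\<close>
    define E where "E n = {\<xi> \<in> D. \<exists>\<beta>\<in>ball \<rho>. (\<integral>\<omega>. \<bar>\<xi> \<omega> - \<beta> \<omega>\<bar> \<partial>M) \<le> 1 / real (Suc n)}" for n
    have "\<exists>x v. (\<forall>n. x n \<in> E n) \<and> v \<in> borel_measurable M \<and> (AE \<omega> in M. (\<lambda>n. x n \<omega>) \<longlonglongrightarrow> v \<omega>)"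
    proof (rule nested_convergent[OF r])
      show "E n \<subseteq> ball r" for n unfolding E_def using D by auto
      show "E n \<noteq> {}" for n
      proof -
        have "\<forall>\<^sub>F k in sequentially. (\<integral>\<omega>. \<bar>w k \<omega>\<bar> \<partial>M) < 1 / real (Suc n)" by (rule order_tendstoD(2)[OF w0]) simp
        then obtain k where "(\<integral>\<omega>. \<bar>w k \<omega>\<bar> \<partial>M) < 1 / real (Suc n)" using eventually_happens' sequentially_bot by blast
        moreover obtain \<xi> \<beta> where "\<xi> \<in> D" "\<beta> \<in> ball \<rho>" "w k = (\<lambda>\<omega>. \<xi> \<omega> - \<beta> \<omega>)" using VE[OF wV[of k]] by blast
        ultimately have "\<xi> \<in> E n" unfolding E_def by (auto intro!: bexI[of _ \<beta>] simp del: of_nat_Suc)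
        then show ?thesis by blast
      qed
      show "E k \<subseteq> E n" if "n \<le> k" for n k
      proof -
        have "1 / real (Suc k) \<le> 1 / real (Suc n)" using that by (simp add: divide_simps)
        then show ?thesis unfolding E_def using order_trans by blast
      qed
      show "(\<lambda>\<omega>. (x \<omega> + y \<omega>) / 2) \<in> E n" if xyE: "x \<in> E n" "y \<in> E n" for n x y
      proof -
        obtain \<beta> \<gamma> where b: "\<beta> \<in> ball \<rho>" "(\<integral>\<omega>. \<bar>x \<omega> - \<beta> \<omega>\<bar> \<partial>M) \<le> 1 / real (Suc n)"
            "\<gamma> \<in> ball \<rho>" "(\<integral>\<omega>. \<bar>y \<omega> - \<gamma> \<omega>\<bar> \<partial>M) \<le> 1 / real (Suc n)" and xy: "x \<in> D" "y \<in> D"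
          using xyE unfolding E_def by blast
        have i: "integrable M x" "integrable M y" "integrable M \<beta>" "integrable M \<gamma>"
          using b xy D ball_integrable r \<rho> by blast+
        have m: "(\<lambda>\<omega>. 1/2 * x \<omega> + 1/2 * y \<omega>) \<in> D" "(\<lambda>\<omega>. 1/2 * \<beta> \<omega> + 1/2 * \<gamma> \<omega>) \<in> ball \<rho>"
          by (rule convex ball_convex; use b xy \<rho> in simp)+
        have "(\<integral>\<omega>. \<bar>(1/2 * x \<omega> + 1/2 * y \<omega>) - (1/2 * \<beta> \<omega> + 1/2 * \<gamma> \<omega>)\<bar> \<partial>M)
            \<le> (\<integral>\<omega>. (\<bar>x \<omega> - \<beta> \<omega>\<bar> + \<bar>y \<omega> - \<gamma> \<omega>\<bar>) / 2 \<partial>M)"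
        proof (rule integral_mono)
          show "\<bar>(1/2 * x \<omega> + 1/2 * y \<omega>) - (1/2 * \<beta> \<omega> + 1/2 * \<gamma> \<omega>)\<bar> \<le> (\<bar>x \<omega> - \<beta> \<omega>\<bar> + \<bar>y \<omega> - \<gamma> \<omega>\<bar>) / 2" for \<omega>
          proof -
            have "(1/2 * x \<omega> + 1/2 * y \<omega>) - (1/2 * \<beta> \<omega> + 1/2 * \<gamma> \<omega>) = ((x \<omega> - \<beta> \<omega>) + (y \<omega> - \<gamma> \<omega>)) / 2"
              by (simp add: diff_divide_distrib add_divide_distrib)
            also have "\<bar>\<dots>\<bar> \<le> (\<bar>x \<omega> - \<beta> \<omega>\<bar> + \<bar>y \<omega> - \<gamma> \<omega>\<bar>) / 2"
              unfolding abs_divide by (simp add: divide_right_mono abs_triangle_ineq)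
            finally show ?thesis .
          qed
        qed (use i in auto)
        also have "\<dots> = ((\<integral>\<omega>. \<bar>x \<omega> - \<beta> \<omega>\<bar> \<partial>M) + (\<integral>\<omega>. \<bar>y \<omega> - \<gamma> \<omega>\<bar> \<partial>M)) / 2" using i by simp
        also have "\<dots> \<le> 1 / real (Suc n)" using b by (simp del: of_nat_Suc)
        finally have "(\<lambda>\<omega>. 1/2 * x \<omega> + 1/2 * y \<omega>) \<in> E n"
          unfolding E_def using m(1) by (intro CollectI conjI bexI[OF _ m(2)])
        then show ?thesis by (simp add: add_divide_distrib)
      qed
    qed
    then obtain x v where x: "\<And>n. x n \<in> E n" and v: "v \<in> borel_measurable M"
      and xv: "AE \<omega> in M. (\<lambda>n. x n \<omega>) \<longlonglongrightarrow> v \<omega>" by blast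
    have xD: "x n \<in> D" for n using x unfolding E_def by auto
    have vD: "v \<in> D" by (rule closed[OF xD v xv])
    have "\<forall>n. \<exists>\<beta>\<in>ball \<rho>. (\<integral>\<omega>. \<bar>x n \<omega> - \<beta> \<omega>\<bar> \<partial>M) \<le> 1 / real (Suc n)" using x unfolding E_def by auto
    then obtain \<beta> where \<beta>: "\<And>n. \<beta> n \<in> ball \<rho>" "\<And>n. (\<integral>\<omega>. \<bar>x n \<omega> - \<beta> n \<omega>\<bar> \<partial>M) \<le> 1 / real (Suc n)" by metis
    have i: "integrable M (\<lambda>\<omega>. x n \<omega> - \<beta> n \<omega>)" for n
      using \<beta>(1) xD D ball_integrable r \<rho> by (intro Bochner_Integration.integrable_diff) blast+
    have "(\<lambda>n. \<integral>\<omega>. norm (x n \<omega> - \<beta> n \<omega>) \<partial>M) \<longlonglongrightarrow> 0"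
      by (rule tendsto_sandwich[OF _ _ tendsto_const i0]) (use \<beta>(2) in \<open>auto intro!: always_eventually\<close>)
    from tendsto_L1_AE_subseq[OF i this] obtain s where s: "strict_mono s" "AE \<omega> in M. (\<lambda>n. x (s n) \<omega> - \<beta> (s n) \<omega>) \<longlonglongrightarrow> 0" by blast
    have "AE \<omega> in M. (\<lambda>n. \<beta> (s n) \<omega>) \<longlonglongrightarrow> v \<omega>" using s(2) xv
    proof eventually_elim
      case (elim \<omega>)
      have "(\<lambda>n. x (s n) \<omega>) \<longlonglongrightarrow> v \<omega>" using LIMSEQ_subseq_LIMSEQ[OF elim(2) s(1)] by (simp add: comp_def)
      from tendsto_diff[OF this elim(1)] show ?case by simp
    qed
    then have "v \<in> ball \<rho>" using ball_closed[of "\<lambda>n. \<beta> (s n)" \<rho> v] \<beta>(1) v \<rho> by auto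
    then show False using vD disj by blast
  qed
  define h where "h \<omega> = theta' (u \<omega>)" for \<omega>
  have h [measurable]: "h \<in> borel_measurable M" unfolding h_def by measurable
  have h1: "\<bar>h \<omega>\<bar> \<le> 1" for \<omega> unfolding h_def by (rule theta'_abs)
  have hi: "integrable M (\<lambda>\<omega>. h \<omega> * y \<omega>)" if "integrable M y" for y by (rule integrable_bounded_mult[OF that h h1])
  have first: "0 \<le> (\<integral>\<omega>. h \<omega> * (v \<omega> - u \<omega>) \<partial>M)" if v: "v \<in> V" for v
  proof -
    have vi: "integrable M v" by (rule Vint[OF v])
    have [measurable]: "v \<in> borel_measurable M" using vi by auto
    \<comment> \<open>The segment from \<open>u\<close> towards \<open>v\<close>. Since
      \<open>u\<close> need not belong to \<open>V\<close>, the inequality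
      \<open>d \<le> J (z n)\<close> comes from the segments that start at \<open>w k\<close>. The
      subgradient is taken at \<open>z n\<close>, which bounds the increment from above; at the end
      \<open>z n\<close> tends to \<open>u\<close>.\<close>
    define z where "z n \<omega> = (1 - 1 / real (Suc n)) * u \<omega> + 1 / real (Suc n) * v \<omega>" for n \<omega>
    have [measurable]: "z n \<in> borel_measurable M" for n unfolding z_def by measurable
    have zi: "integrable M (z n)" for n unfolding z_def using ui vi by auto
    have pos: "0 \<le> (\<integral>\<omega>. theta' (z n \<omega>) * (v \<omega> - u \<omega>) \<partial>M)" for n
    proof -
      let ?t = "1 / real (Suc n)"
      have t: "0 < ?t" "?t \<le> 1" by auto
      have zV: "(\<lambda>\<omega>. (1 - ?t) * w k \<omega> + ?t * v \<omega>) \<in> V" for k using t by (intro Vconv wV v) auto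
      have "d \<le> J (z n)"
      proof (rule LIMSEQ_le_const)
        show "(\<lambda>k. J (\<lambda>\<omega>. (1 - ?t) * w k \<omega> + ?t * v \<omega>)) \<longlonglongrightarrow> J (z n)" unfolding J_def
        proof (rule integral_theta_tendsto[OF _ R])
          show "(\<lambda>\<omega>. (1 - ?t) * w k \<omega> + ?t * v \<omega>) \<in> ball (r + \<rho>)" for k using zV VB by blast
          show "AE \<omega> in M. (\<lambda>k. (1 - ?t) * w k \<omega> + ?t * v \<omega>) \<longlonglongrightarrow> z n \<omega>"
            using lim by eventually_elim (auto simp: z_def intro!: tendsto_intros)
        qed measurable
        show "\<exists>N. \<forall>k\<ge>N. d \<le> J (\<lambda>\<omega>. (1 - ?t) * w k \<omega> + ?t * v \<omega>)" using d_le[OF zV] by blast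
      qed
      then have "0 \<le> J (z n) - J u" using Ju by simp
      also have "\<dots> = (\<integral>\<omega>. theta (z n \<omega>) - theta (u \<omega>) \<partial>M)" unfolding J_def using integrable_theta zi ui by simp
      also have "\<dots> \<le> (\<integral>\<omega>. ?t * (theta' (z n \<omega>) * (v \<omega> - u \<omega>)) \<partial>M)"
      proof (rule integral_mono)
        show "integrable M (\<lambda>\<omega>. ?t * (theta' (z n \<omega>) * (v \<omega> - u \<omega>)))"
          using ui vi by (intro integrable_mult_right integrable_bounded_mult[where b = 1] theta'_abs) auto
        show "theta (z n \<omega>) - theta (u \<omega>) \<le> ?t * (theta' (z n \<omega>) * (v \<omega> - u \<omega>))" for \<omega>
        proof -
          have "(1 - t) * x + t * y - x = t * (y - x)" for t x y :: real by (simp add: algebra_simps)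
          then have "z n \<omega> - u \<omega> = ?t * (v \<omega> - u \<omega>)" unfolding z_def .
          then show ?thesis using theta_subgradient[of "z n \<omega>" "u \<omega>"] by (simp add: mult.left_commute)
        qed
      qed (use integrable_theta zi ui in auto)
      also have "\<dots> = ?t * (\<integral>\<omega>. theta' (z n \<omega>) * (v \<omega> - u \<omega>) \<partial>M)" by simp
      finally show ?thesis using t(1) by (simp add: zero_le_divide_iff)
    qed
    have "(\<lambda>n. \<integral>\<omega>. theta' (z n \<omega>) * (v \<omega> - u \<omega>) \<partial>M) \<longlonglongrightarrow> (\<integral>\<omega>. h \<omega> * (v \<omega> - u \<omega>) \<partial>M)"
    proof (rule integral_dominated_convergence[where w = "\<lambda>\<omega>. \<bar>v \<omega> - u \<omega>\<bar>"])
      show "integrable M (\<lambda>\<omega>. \<bar>v \<omega> - u \<omega>\<bar>)" using ui vi by auto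
      show "AE \<omega> in M. norm (theta' (z n \<omega>) * (v \<omega> - u \<omega>)) \<le> \<bar>v \<omega> - u \<omega>\<bar>" for n
        using theta'_abs by (intro AE_I2) (auto simp: abs_mult intro!: mult_left_le_one_le)
      show "AE \<omega> in M. (\<lambda>n. theta' (z n \<omega>) * (v \<omega> - u \<omega>)) \<longlonglongrightarrow> h \<omega> * (v \<omega> - u \<omega>)"
      proof (intro AE_I2)
        fix \<omega>
        have "(\<lambda>n. z n \<omega>) \<longlonglongrightarrow> (1 - 0) * u \<omega> + 0 * v \<omega>" unfolding z_def by (intro tendsto_intros i0)
        then have "(\<lambda>n. z n \<omega>) \<longlonglongrightarrow> u \<omega>" by simp
        then show "(\<lambda>n. theta' (z n \<omega>) * (v \<omega> - u \<omega>)) \<longlonglongrightarrow> h \<omega> * (v \<omega> - u \<omega>)" unfolding h_def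
          by (intro tendsto_intros isCont_tendsto_compose[OF isCont_theta'])
      qed
    qed measurable
    then show ?thesis by (rule LIMSEQ_le_const) (use pos in blast)
  qed
  define \<delta> where "\<delta> = (\<integral>\<omega>. h \<omega> * u \<omega> \<partial>M)"
  have hu: "0 \<le> h \<omega> * u \<omega>" "h \<omega> * u \<omega> = 0 \<longleftrightarrow> u \<omega> = 0" for \<omega>
    using theta_pos[of "u \<omega>"] unfolding h_def by (auto simp: theta'_alt)
  have "\<delta> \<noteq> 0" unfolding \<delta>_def using nz integral_nonneg_eq_0_iff_AE[OF hi[OF ui]] hu by auto
  moreover have "0 \<le> \<delta>" unfolding \<delta>_def using hu by (intro integral_nonneg_AE) auto
  ultimately have \<delta>: "0 < \<delta>" by simp
  define s where "s = (SUP \<beta>\<in>ball \<rho>. \<integral>\<omega>. h \<omega> * \<beta> \<omega> \<partial>M)"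
  obtain c where c: "\<And>\<beta>. \<beta> \<in> ball \<rho> \<Longrightarrow> integrable M \<beta>" "\<And>\<beta>. \<beta> \<in> ball \<rho> \<Longrightarrow> (\<integral>\<omega>. \<bar>\<beta> \<omega>\<bar> \<partial>M) \<le> c"
    using ball_L1[OF \<rho>] by blast
  have bdds: "bdd_above ((\<lambda>\<beta>. \<integral>\<omega>. h \<omega> * \<beta> \<omega> \<partial>M) ` ball \<rho>)"
  proof (rule bdd_aboveI)
    fix x assume "x \<in> (\<lambda>\<beta>. \<integral>\<omega>. h \<omega> * \<beta> \<omega> \<partial>M) ` ball \<rho>"
    then obtain \<beta> where \<beta>: "\<beta> \<in> ball \<rho>" "x = (\<integral>\<omega>. h \<omega> * \<beta> \<omega> \<partial>M)" by auto
    have "x \<le> (\<integral>\<omega>. \<bar>\<beta> \<omega>\<bar> \<partial>M)" unfolding \<beta>(2)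
    proof (rule integral_mono)
      show "h \<omega> * \<beta> \<omega> \<le> \<bar>\<beta> \<omega>\<bar>" for \<omega>
        using h1[of \<omega>] by (metis abs_ge_self abs_ge_zero abs_mult mult_left_le_one_le order_trans)
    qed (use hi c(1)[OF \<beta>(1)] in auto)
    then show "x \<le> c" using c(2)[OF \<beta>(1)] by linarith
  qed
  have s_ge: "(\<integral>\<omega>. h \<omega> * \<beta> \<omega> \<partial>M) \<le> s" if "\<beta> \<in> ball \<rho>" for \<beta> unfolding s_def by (rule cSUP_upper[OF that bdds])
  have s0: "0 \<le> s" using s_ge[OF zero_ball] by simp
  have sD: "s + \<delta> \<le> (\<integral>\<omega>. h \<omega> * \<xi> \<omega> \<partial>M)" if \<xi>: "\<xi> \<in> D" for \<xi>
  proof -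
    have \<xi>i: "integrable M \<xi>" using ball_integrable[OF r] D \<xi> by blast
    have "(\<integral>\<omega>. h \<omega> * \<beta> \<omega> \<partial>M) \<le> (\<integral>\<omega>. h \<omega> * \<xi> \<omega> \<partial>M) - \<delta>" if \<beta>: "\<beta> \<in> ball \<rho>" for \<beta>
    proof -
      have "0 \<le> (\<integral>\<omega>. h \<omega> * (\<xi> \<omega> - \<beta> \<omega> - u \<omega>) \<partial>M)" by (rule first[OF VI[OF \<xi> \<beta>]])
      also have "\<dots> = (\<integral>\<omega>. h \<omega> * \<xi> \<omega> \<partial>M) - (\<integral>\<omega>. h \<omega> * \<beta> \<omega> \<partial>M) - \<delta>"
        unfolding \<delta>_def using hi[OF \<xi>i] hi[OF c(1)[OF \<beta>]] hi[OF ui] by (simp add: right_diff_distrib)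
      finally show ?thesis by simp
    qed
    then have "s \<le> (\<integral>\<omega>. h \<omega> * \<xi> \<omega> \<partial>M) - \<delta>" unfolding s_def using zero_ball by (intro cSUP_least) auto
    then show ?thesis by simp
  qed
  \<comment> \<open>Strictly between the bound \<open>s\<close> on the ball and the lower bound
    \<open>s + \<delta>\<close> on \<open>D\<close>; adding half of \<open>\<delta>\<close> also
    makes \<open>q\<close> positive when \<open>s = 0\<close>.\<close>
  define q where "q = s + \<delta> / 2"
  have q: "0 < q" "s < q" "q < s + \<delta>" unfolding q_def using s0 \<delta> by auto
  show ?thesis
  proof (intro bexI[of _ "\<lambda>\<omega>. h \<omega> / q"] conjI exI allI ballI)
    show "\<bar>h \<omega> / q\<bar> \<le> 1 / q" for \<omega> using h1[of \<omega>] q by (simp add: abs_divide divide_right_mono)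
    show "\<bar>\<integral>\<omega>. h \<omega> / q * \<beta> \<omega> \<partial>M\<bar> \<le> 1" if "\<beta> \<in> ball \<rho>" for \<beta>
    proof -
      have "\<bar>\<integral>\<omega>. h \<omega> * \<beta> \<omega> \<partial>M\<bar> \<le> q" using s_ge[OF that] s_ge[OF ball_uminus[OF that]] q by (simp add: abs_le_iff)
      then show ?thesis using q by (simp add: abs_divide)
    qed
    show "1 < (\<integral>\<omega>. h \<omega> / q * \<xi> \<omega> \<partial>M)" if "\<xi> \<in> D" for \<xi>
      using sD[OF that] q by simp
  qed measurable
qed

end

section \<open>Order bounded convex combinations\<close>

context young
begin

lemma nabla2_iterate:
  assumes l: "1 < (l::nat)" and y0: "0 < y0" and nab: "\<And>y. y0 \<le> y \<Longrightarrow> 2 * real l * \<Psi> y \<le> \<Psi> (real l * y)"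
  shows "y0 \<le> y \<Longrightarrow> (2 * real l) ^ m * \<Psi> y \<le> \<Psi> (real l ^ m * y)"
proof (induction m)
  case (Suc m)
  have "1 * y \<le> real l ^ m * y" using l y0 Suc.prems by (intro mult_right_mono one_le_power) auto
  then have big: "y0 \<le> real l ^ m * y" using Suc.prems by simp
  have "(2 * real l) ^ Suc m * \<Psi> y = 2 * real l * ((2 * real l) ^ m * \<Psi> y)" by simp
  also have "\<dots> \<le> 2 * real l * \<Psi> (real l ^ m * y)" using Suc by (intro mult_left_mono) auto
  also have "\<dots> \<le> \<Psi> (real l * (real l ^ m * y))" by (rule nab[OF big])
  finally show ?case by (simp add: mult.assoc)
qed simp

text \<open>The iterated growth condition gains \<open>(2 l)^m\<close> where the quotient stays
  above \<open>y0\<close>; elsewhere the cost is at most \<open>\<Psi> y0\<close>. Summed over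
  \<open>l^m\<close> functions of modular at most 1, the main term is \<open>2^-m\<close>: this is
  what averaging exploits.\<close>

lemma nabla2_divide:
  assumes l: "1 < (l::nat)" and y0: "0 < y0" and nab: "\<And>y. y0 \<le> y \<Longrightarrow> 2 * real l * \<Psi> y \<le> \<Psi> (real l * y)"
  shows "\<Psi> (x / real l ^ m) \<le> \<Psi> x / (2 * real l) ^ m + \<Psi> y0"
proof -
  define N where "N = real l ^ m"
  have N: "0 < N" unfolding N_def using l by simp
  have p: "0 < (2 * real l) ^ m" using l by simp
  show ?thesis
  proof (cases "y0 \<le> \<bar>x\<bar> / N")
    case True
    have "(2 * real l) ^ m * \<Psi> (\<bar>x\<bar> / N) \<le> \<Psi> (N * (\<bar>x\<bar> / N))"
      unfolding N_def by (rule nabla2_iterate[OF l y0 nab True[unfolded N_def]])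
    then have "(2 * real l) ^ m * \<Psi> (x / N) \<le> \<Psi> x" using N by (metis abs_arg abs_divide abs_of_pos less_numeral_extra(3) nonzero_mult_div_cancel_left times_divide_eq_right)
    then have "\<Psi> (x / N) \<le> \<Psi> x / (2 * real l) ^ m" using p by (simp add: pos_le_divide_eq mult.commute)
    then show ?thesis unfolding N_def using nonneg[of y0] by linarith
  next
    case False
    then have "\<Psi> (x / N) \<le> \<Psi> y0" using N by (intro mono_abs) (auto simp: abs_divide)
    moreover have "0 \<le> \<Psi> x / (2 * real l) ^ m" using p by simp
    ultimately show ?thesis unfolding N_def by linarith
  qed
qed

text \<open>In an average of \<open>n\<close> numbers the last large one (there is at most one such index) is treated
  separately; the other large ones are followed by a large one.\<close>

lemma average_split:
  fixes x :: "nat \<Rightarrow> real" and n :: nat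
  assumes n: "0 < n" and \<delta>: "0 \<le> \<delta>"
  defines "b \<equiv> \<lambda>j. if \<bar>x j\<bar> > \<delta> then 1 else 0 :: real"
  shows "3 * \<Psi> ((\<Sum>j<n. x j) / real n / 3) \<le>
    \<Psi> \<delta> + (\<Sum>j<n. b j * \<Psi> (x j / real n)) + (\<Sum>j<n. \<Sum>i\<in>{j<..<n}. b i * \<Psi> (x j)) / real n"
proof -
  let ?last = "\<lambda>j. \<forall>i\<in>{j<..<n}. b i = 0"
  \<comment> \<open>The small entries, the last large entry, and the large entries with a later
    large one. Only for \<open>g\<close> does the bound keep the division by \<open>n\<close> inside
    \<open>\<Psi>\<close>. For \<open>a\<close> the bound \<open>\<delta>\<close> survives
    averaging, and for \<open>s\<close> Jensen's inequality is enough, because a product with a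
    later \<open>b i\<close> will have small expectation. Convexity over the three parts produces
    the factor 3.\<close>
  define a g s where "a j = (if \<bar>x j\<bar> \<le> \<delta> then \<bar>x j\<bar> else 0)"
    and "g j = (if \<bar>x j\<bar> > \<delta> \<and> ?last j then \<bar>x j\<bar> else 0)"
    and "s j = (if \<bar>x j\<bar> > \<delta> \<and> \<not> ?last j then \<bar>x j\<bar> else 0)" for j
  define A G S where "A = (\<Sum>j<n. a j) / real n" and "G = (\<Sum>j<n. g j) / real n" and "S = (\<Sum>j<n. s j) / real n"
  have b01: "0 \<le> b j" "b j = 0 \<or> b j = 1" for j unfolding b_def by auto
  have agsn: "0 \<le> a j" "0 \<le> g j" "0 \<le> s j" for j unfolding a_def g_def s_def by auto
  have "\<bar>x j\<bar> = a j + g j + s j" for j unfolding a_def g_def s_def by auto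
  then have "\<bar>\<Sum>j<n. x j\<bar> \<le> (\<Sum>j<n. a j + g j + s j)" using sum_abs[of x "{..<n}"] by simp
  then have sum_le: "\<bar>\<Sum>j<n. x j\<bar> / real n \<le> A + G + S"
    unfolding A_def G_def S_def by (simp add: sum.distrib add_divide_distrib[symmetric] divide_right_mono)
  have AGS: "0 \<le> A" "0 \<le> G" "0 \<le> S" unfolding A_def G_def S_def using agsn by (auto intro!: divide_nonneg_nonneg sum_nonneg)
  have "3 * \<Psi> ((\<Sum>j<n. x j) / real n / 3) \<le> 3 * \<Psi> ((A + G + S) / 3)"
    using sum_le AGS by (intro mult_left_mono mono_abs) (auto simp: abs_divide)
  also have "\<dots> \<le> \<Psi> A + \<Psi> G + \<Psi> S"
  proof -
    have "(A + G + S) / 3 = 2/3 * (1/2 * A + 1/2 * G) + 1/3 * S" by simp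
    then have "\<Psi> ((A + G + S) / 3) \<le> 2/3 * \<Psi> (1/2 * A + 1/2 * G) + 1/3 * \<Psi> S"
      using combine[of "2/3" "1/3" "1/2 * A + 1/2 * G" S] by (simp only:)
    moreover have "\<Psi> (1/2 * A + 1/2 * G) \<le> 1/2 * \<Psi> A + 1/2 * \<Psi> G" by (rule combine) auto
    ultimately show ?thesis by simp
  qed
  also have "\<Psi> A \<le> \<Psi> \<delta>"
  proof (rule mono_abs)
    have "(\<Sum>j<n. a j) \<le> (\<Sum>j<n. \<delta>)" using \<delta> by (intro sum_mono) (auto simp: a_def)
    then have "A \<le> \<delta>" unfolding A_def using n by (simp add: divide_le_eq mult.commute)
    then show "\<bar>A\<bar> \<le> \<bar>\<delta>\<bar>" using AGS \<delta> by simp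
  qed
  also have "\<Psi> G \<le> (\<Sum>j<n. b j * \<Psi> (x j / real n))"
  proof (cases "\<exists>j<n. g j \<noteq> 0")
    case True
    then obtain j where j: "j < n" "g j \<noteq> 0" by blast
    have other: "g i = 0" if "i \<in> {..<n} - {j}" for i
    proof (rule ccontr)
      assume gi: "g i \<noteq> 0"
      have "b i = 1" "b j = 1" "?last i" "?last j" using gi j(2) unfolding g_def b_def by (auto split: if_splits)
      moreover have "i < j \<or> j < i" using that by auto
      ultimately show False using that j(1) by force
    qed
    have "(\<Sum>i<n. g i) = g j" using j(1) sum.remove[of "{..<n}" j g] sum.neutral[of "{..<n} - {j}" g] other by simp
    also have "\<dots> = \<bar>x j\<bar>" using j(2) unfolding g_def by (simp split: if_splits)
    finally have "\<Psi> G = b j * \<Psi> (x j / real n)"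
      unfolding G_def b_def using j(2) abs_arg[of "x j / real n"] by (auto simp: g_def abs_divide split: if_splits)
    also have "\<dots> \<le> (\<Sum>j<n. b j * \<Psi> (x j / real n))" using j(1) b01 by (intro member_le_sum) auto
    finally show ?thesis .
  next
    case False
    then have "G = 0" unfolding G_def by simp
    then show ?thesis using b01 by (auto intro!: sum_nonneg)
  qed
  also have "\<Psi> S \<le> (\<Sum>j<n. \<Sum>i\<in>{j<..<n}. b i * \<Psi> (x j)) / real n"
  proof -
    have "\<Psi> (\<Sum>j<n. (1 / real n) *\<^sub>R s j) \<le> (\<Sum>j<n. (1 / real n) * \<Psi> (s j))"
      using n by (intro convex_on_sum[OF _ _ convex]) auto
    then have "\<Psi> S \<le> (\<Sum>j<n. \<Psi> (s j)) / real n" unfolding S_def by (simp add: sum_divide_distrib)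
    also have "\<dots> \<le> (\<Sum>j<n. \<Sum>i\<in>{j<..<n}. b i * \<Psi> (x j)) / real n"
    proof (intro divide_right_mono sum_mono)
      fix j
      show "\<Psi> (s j) \<le> (\<Sum>i\<in>{j<..<n}. b i * \<Psi> (x j))"
      proof (cases "s j = 0")
        case True
        then show ?thesis using b01 by (auto intro!: sum_nonneg)
      next
        case False
        then obtain i where i: "i \<in> {j<..<n}" "b i \<noteq> 0" and sj: "s j = \<bar>x j\<bar>" unfolding s_def by (auto split: if_splits)
        then have "\<Psi> (s j) = b i * \<Psi> (x j)" using b01(2)[of i] by (simp add: abs_arg)
        also have "\<dots> \<le> (\<Sum>i\<in>{j<..<n}. b i * \<Psi> (x j))" using i b01 by (intro member_le_sum) auto
        finally show ?thesis .
      qed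
    qed simp
    finally show ?thesis .
  qed
  finally show ?thesis by simp
qed

text \<open>The generalised inverse of \<open>\<Psi>\<close> on the nonnegative half-line;
  \<open>max 0 s\<close> keeps the set nonempty for negative \<open>s\<close>. It converts a common
  bound on values of \<open>\<Psi>\<close> into a common bound on the arguments, at which
  \<open>\<Psi>\<close> is still controlled.\<close>

definition level :: "real \<Rightarrow> real" where "level s = Sup {x. \<Psi> x \<le> max 0 s}"

lemma level_set: "bdd_above {x. \<Psi> x \<le> max 0 s}" "0 \<in> {x. \<Psi> x \<le> max 0 s}"
proof -
  obtain m where m: "m > 0" "\<And>x. m \<le> \<bar>x\<bar> \<Longrightarrow> 1 * \<bar>x\<bar> \<le> \<Psi> x" using superlinear[of 1] by blast
  have "x \<le> max m (max 0 s)" if "\<Psi> x \<le> max 0 s" for x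
    using m(2)[of x] that by (cases "m \<le> \<bar>x\<bar>") auto
  then show "bdd_above {x. \<Psi> x \<le> max 0 s}" by (intro bdd_aboveI[of _ "max m (max 0 s)"]) auto
qed auto

lemma level_ge: "\<Psi> x \<le> s \<Longrightarrow> x \<le> level s"
  unfolding level_def by (rule cSup_upper[OF _ level_set(1)]) auto

lemma level_le: "\<Psi> (level s) \<le> max 0 s"
proof -
  have "closed {x. \<Psi> x \<le> max 0 s}" by (intro closed_Collect_le cont continuous_on_const)
  from closed_contains_Sup[OF _ level_set(1) this] level_set(2) show ?thesis unfolding level_def by blast
qed

lemma level_meas [measurable]: "level \<in> borel_measurable borel"
proof (rule borel_measurable_mono, rule monoI)
  fix s t :: real assume "s \<le> t"
  show "level s \<le> level t" unfolding level_def
  proof (rule cSup_subset_mono[OF _ level_set(1)])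
    show "{x. \<Psi> x \<le> max 0 s} \<noteq> {}" using level_set(2) by blast
    show "{x. \<Psi> x \<le> max 0 s} \<subseteq> {x. \<Psi> x \<le> max 0 t}" using \<open>s \<le> t\<close> by auto
  qed
qed

end

context orlicz
begin

text \<open>The indices are chosen so sparsely that the sets where \<open>z (k i)\<close> exceeds
  \<open>\<delta>\<close> have small probability and carry little of the modular of all earlier
  functions. \<open>average_split\<close> then leaves three contributions of size
  \<open>2^-m\<close>: that of \<open>\<delta>\<close>, that of \<open>l^m\<close> functions divided
  by \<open>l^m\<close>, and the total of the small errors.\<close>

lemma block_average:
  assumes l: "1 < (l::nat)" and y0: "0 < y0" and nab: "\<And>y. y0 \<le> y \<Longrightarrow> 2 * real l * \<Psi> y \<le> \<Psi> (real l * y)"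
    and z: "\<And>n. z n \<in> ball 1" and lim: "AE \<omega> in M. (\<lambda>n. z n \<omega>) \<longlonglongrightarrow> 0"
  shows "\<exists>k. (\<forall>j. m \<le> k j) \<and> integrable M (\<lambda>\<omega>. \<Psi> ((\<Sum>j<l ^ m. z (k j) \<omega>) / real (l ^ m) / 3)) \<and>
    (\<integral>\<omega>. \<Psi> ((\<Sum>j<l ^ m. z (k j) \<omega>) / real (l ^ m) / 3) \<partial>M) \<le> (1/2) ^ m"
proof -
  have [measurable]: "z n \<in> borel_measurable M" for n using z ball_meas by auto
  have zi: "integrable M (\<lambda>\<omega>. \<Psi> (z n \<omega>))" "(\<integral>\<omega>. \<Psi> (z n \<omega>) \<partial>M) \<le> 1" for n using z[of n] unfolding ball_iff by auto
  define N where "N = l ^ m"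
  have N: "0 < N" unfolding N_def using l by simp
  define h :: real where "h = (1/2) ^ m"
  have h: "0 < h" "h \<le> 1" unfolding h_def by (auto simp: power_le_one)
  have p1: "0 < 1 + \<Psi> 1" "0 < \<Psi> y0 + 1" using nonneg[of 1] nonneg[of y0] by linarith+
  \<comment> \<open>Small enough for
    \<open>\<Psi> \<delta> \<le> \<delta> * \<Psi> 1 \<le> h\<close>, the first inequality because
    \<open>\<delta> \<le> 1\<close>.\<close>
  define \<delta> where "\<delta> = h / (1 + \<Psi> 1)"
  have \<delta>: "0 < \<delta>" unfolding \<delta>_def using h p1 by simp
  have \<Psi>\<delta>: "\<Psi> \<delta> \<le> h"
  proof -
    have "h \<le> 1 * (1 + \<Psi> 1)" using h(2) by (simp add: add_increasing2)
    then have "\<delta> \<le> 1" unfolding \<delta>_def by (simp only: pos_divide_le_eq[OF p1(1)])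
    then have "\<Psi> (\<delta> * 1) \<le> \<delta> * \<Psi> 1" using \<delta> by (intro scale_le) auto
    also have "\<dots> \<le> h" unfolding \<delta>_def using h p1 by (simp add: pos_divide_le_eq[OF p1(1)])
    finally show ?thesis by simp
  qed
  \<comment> \<open>The total error consists of \<open>N\<close> terms
    \<open>eps * \<Psi> y0\<close> from the divided functions and, after division by
    \<open>N\<close>, of at most \<open>N * eps\<close> from the pairs; together they are to make up
    \<open>h\<close>.\<close>
  define eps where "eps = h / (real N * (\<Psi> y0 + 1))"
  have eps: "0 < eps" "real N * (\<Psi> y0 + 1) * eps = h" unfolding eps_def using h p1 N by auto
  define I where "I k \<omega> = (if \<bar>z k \<omega>\<bar> > \<delta> then 1 else 0 :: real)" for k \<omega>
  have I [measurable]: "I k \<in> borel_measurable M" for k unfolding I_def by measurable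
  have I01: "0 \<le> I k \<omega>" "\<bar>I k \<omega>\<bar> \<le> 1" for k \<omega> unfolding I_def by auto
  have Ilim: "(\<lambda>k. \<integral>\<omega>. I k \<omega> * x \<omega> \<partial>M) \<longlonglongrightarrow> 0" if x: "integrable M x" for x
  proof -
    have [measurable]: "x \<in> borel_measurable M" using x by auto
    have "(\<lambda>k. \<integral>\<omega>. I k \<omega> * x \<omega> \<partial>M) \<longlonglongrightarrow> (\<integral>\<omega>. 0 \<partial>M)"
    proof (rule integral_dominated_convergence[where w = "\<lambda>\<omega>. \<bar>x \<omega>\<bar>"])
      show "AE \<omega> in M. (\<lambda>k. I k \<omega> * x \<omega>) \<longlonglongrightarrow> 0" using lim
      proof eventually_elim
        case (elim \<omega>)
        have "\<forall>\<^sub>F k in sequentially. \<bar>z k \<omega>\<bar> < \<delta>"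
          using order_tendstoD(2)[OF tendsto_rabs_zero[OF elim] \<delta>] .
        then have "\<forall>\<^sub>F k in sequentially. I k \<omega> * x \<omega> = 0" by eventually_elim (simp add: I_def)
        then show ?case by (rule tendsto_eventually)
      qed
      show "AE \<omega> in M. norm (I k \<omega> * x \<omega>) \<le> \<bar>x \<omega>\<bar>" for k
        using I01 by (intro AE_I2) (auto simp: abs_mult intro!: mult_left_le_one_le)
    qed (use x in auto)
    then show ?thesis by simp
  qed
  have "\<exists>k. \<forall>j. (m \<le> k j \<and> (\<integral>\<omega>. I (k j) \<omega> * 1 \<partial>M) \<le> eps) \<and>
      (k j < k (Suc j) \<and> (\<forall>i\<le>k j. (\<integral>\<omega>. I (k (Suc j)) \<omega> * \<Psi> (z i \<omega>) \<partial>M) \<le> eps))"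
  proof (rule dependent_nat_choice)
    have small: "\<forall>\<^sub>F k in sequentially. (\<integral>\<omega>. I k \<omega> * x \<omega> \<partial>M) \<le> eps" if "integrable M x" for x
      using order_tendstoD(2)[OF Ilim[OF that] eps(1)] by eventually_elim simp
    have "\<forall>\<^sub>F k in sequentially. m \<le> k \<and> (\<integral>\<omega>. I k \<omega> * 1 \<partial>M) \<le> eps"
      by (intro eventually_conj small eventually_ge_at_top) auto
    then show "\<exists>k. m \<le> k \<and> (\<integral>\<omega>. I k \<omega> * 1 \<partial>M) \<le> eps" using eventually_happens' sequentially_bot by blast
    fix k0 j
    have "\<forall>\<^sub>F k in sequentially. \<forall>i\<in>{..k0}. (\<integral>\<omega>. I k \<omega> * \<Psi> (z i \<omega>) \<partial>M) \<le> eps"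
      using small zi by (intro eventually_ball_finite) auto
    then have ev: "\<forall>\<^sub>F k in sequentially. \<forall>i\<le>k0. (\<integral>\<omega>. I k \<omega> * \<Psi> (z i \<omega>) \<partial>M) \<le> eps"
      by (rule eventually_mono) auto
    have "\<forall>\<^sub>F k in sequentially. (m \<le> k \<and> (\<integral>\<omega>. I k \<omega> * 1 \<partial>M) \<le> eps) \<and> k0 < k \<and> (\<forall>i\<le>k0. (\<integral>\<omega>. I k \<omega> * \<Psi> (z i \<omega>) \<partial>M) \<le> eps)"
      by (intro eventually_conj small ev eventually_ge_at_top eventually_gt_at_top) auto
    then show "\<exists>k. (m \<le> k \<and> (\<integral>\<omega>. I k \<omega> * 1 \<partial>M) \<le> eps) \<and> k0 < k \<and> (\<forall>i\<le>k0. (\<integral>\<omega>. I k \<omega> * \<Psi> (z i \<omega>) \<partial>M) \<le> eps)"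
      using eventually_happens' sequentially_bot by blast
  qed
  then obtain k where k: "\<And>j. m \<le> k j" "\<And>j. (\<integral>\<omega>. I (k j) \<omega> \<partial>M) \<le> eps" "\<And>j. k j < k (Suc j)"
    "\<And>j i. i \<le> k j \<Longrightarrow> (\<integral>\<omega>. I (k (Suc j)) \<omega> * \<Psi> (z i \<omega>) \<partial>M) \<le> eps" by auto
  have sm: "strict_mono k" using k(3) by (rule strict_monoI_Suc)
  have cross: "(\<integral>\<omega>. I (k i) \<omega> * \<Psi> (z (k j) \<omega>) \<partial>M) \<le> eps" if ji: "j < i" for i j
  proof -
    obtain i' where i': "i = Suc i'" using ji by (cases i) auto
    then have "k j \<le> k i'" using ji sm by (simp add: strict_mono_less_eq)
    then show ?thesis using k(4) i' by simp
  qed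
  define L where "L = (2 * real l) ^ m"
  have L: "0 < L" unfolding L_def using l by simp
  define U where "U \<omega> = \<Psi> \<delta> + (\<Sum>j<N. \<Psi> (z (k j) \<omega>) / L + I (k j) \<omega> * \<Psi> y0) + (\<Sum>j<N. \<Sum>i\<in>{j<..<N}. I (k i) \<omega> * \<Psi> (z (k j) \<omega>)) / real N" for \<omega>
  have pw: "3 * \<Psi> ((\<Sum>j<N. z (k j) \<omega>) / real N / 3) \<le> U \<omega>" for \<omega>
  proof -
    have "I (k j) \<omega> * \<Psi> (z (k j) \<omega> / real N) \<le> \<Psi> (z (k j) \<omega>) / L + I (k j) \<omega> * \<Psi> y0" for j
    proof -
      have "\<Psi> (z (k j) \<omega> / real N) \<le> \<Psi> (z (k j) \<omega>) / L + \<Psi> y0"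
        unfolding N_def L_def of_nat_power by (rule nabla2_divide[OF l y0 nab])
      moreover have "0 \<le> \<Psi> (z (k j) \<omega>) / L" using L by simp
      ultimately show ?thesis unfolding I_def by simp
    qed
    then have "(\<Sum>j<N. I (k j) \<omega> * \<Psi> (z (k j) \<omega> / real N)) \<le> (\<Sum>j<N. \<Psi> (z (k j) \<omega>) / L + I (k j) \<omega> * \<Psi> y0)" by (rule sum_mono)
    then show ?thesis
      using average_split[OF N less_imp_le[OF \<delta>], of "\<lambda>j. z (k j) \<omega>"] unfolding U_def I_def by linarith
  qed
  have Ii: "integrable M (I k)" for k using I01 by (intro integrable_const_bound[where B = 1]) auto
  have IPi: "integrable M (\<lambda>\<omega>. I i \<omega> * \<Psi> (z j \<omega>))" for i j
    by (rule integrable_bounded_mult[OF zi(1) I I01(2)])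
  have Ui: "integrable M U" unfolding U_def using zi(1) Ii IPi
    by (intro Bochner_Integration.integrable_add Bochner_Integration.integrable_sum integrable_divide integrable_mult_left) auto
  have "(\<integral>\<omega>. U \<omega> \<partial>M) = \<Psi> \<delta> + (\<Sum>j<N. (\<integral>\<omega>. \<Psi> (z (k j) \<omega>) \<partial>M) / L + (\<integral>\<omega>. I (k j) \<omega> \<partial>M) * \<Psi> y0)
      + (\<Sum>j<N. \<Sum>i\<in>{j<..<N}. (\<integral>\<omega>. I (k i) \<omega> * \<Psi> (z (k j) \<omega>) \<partial>M)) / real N"
    unfolding U_def using zi(1) Ii IPi by (simp add: prob_space)
  also have "\<dots> \<le> h + (\<Sum>j<N. 1 / L + eps * \<Psi> y0) + (\<Sum>j<N. real N * eps) / real N"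
  proof (intro add_mono divide_right_mono sum_mono mult_right_mono \<Psi>\<delta> zi(2) k(2))
    fix j
    have "(\<Sum>i\<in>{j<..<N}. (\<integral>\<omega>. I (k i) \<omega> * \<Psi> (z (k j) \<omega>) \<partial>M)) \<le> (\<Sum>i\<in>{j<..<N}. eps)"
      by (intro sum_mono cross) auto
    also have "\<dots> = real (card {j<..<N}) * eps" by simp
    also have "\<dots> \<le> real N * eps" using eps by (intro mult_right_mono) auto
    finally show "(\<Sum>i\<in>{j<..<N}. (\<integral>\<omega>. I (k i) \<omega> * \<Psi> (z (k j) \<omega>) \<partial>M)) \<le> real N * eps" .
  qed (use L in auto)
  also have "\<dots> = h + real N / L + real N * (\<Psi> y0 + 1) * eps" using N by (simp add: algebra_simps)
  \<comment> \<open>\<open>N = l^m\<close> against \<open>L = (2 l)^m\<close>: here the factor 2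
    gained in \<open>nabla2\<close> yields summability over the blocks.\<close>
  also have "real N / L = h" unfolding N_def L_def h_def using l by (simp add: power_mult_distrib power_one_over field_simps)
  finally have UI: "(\<integral>\<omega>. U \<omega> \<partial>M) \<le> 3 * h" unfolding eps(2) by simp
  define F where "F \<omega> = \<Psi> ((\<Sum>j<N. z (k j) \<omega>) / real N / 3)" for \<omega>
  have [measurable]: "F \<in> borel_measurable M" unfolding F_def by measurable
  have F0: "0 \<le> F \<omega>" "3 * F \<omega> \<le> U \<omega>" for \<omega> unfolding F_def using pw by auto
  have Fi: "integrable M F"
  proof (rule Bochner_Integration.integrable_bound[OF Ui])
    show "AE \<omega> in M. norm (F \<omega>) \<le> norm (U \<omega>)" using F0 by (intro AE_I2) (smt (verit) real_norm_def)
  qed measurable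
  have "3 * (\<integral>\<omega>. F \<omega> \<partial>M) = (\<integral>\<omega>. 3 * F \<omega> \<partial>M)" by simp
  also have "\<dots> \<le> (\<integral>\<omega>. U \<omega> \<partial>M)" using Fi Ui F0 by (intro integral_mono) auto
  finally have "(\<integral>\<omega>. F \<omega> \<partial>M) \<le> h" using UI by linarith
  then show ?thesis using k(1) Fi unfolding F_def N_def h_def by blast
qed

lemma average_in_convex:
  fixes x :: "nat \<Rightarrow> 'b \<Rightarrow> real"
  assumes convex: "\<And>u v a b. u \<in> C \<Longrightarrow> v \<in> C \<Longrightarrow> 0 \<le> a \<Longrightarrow> 0 \<le> b \<Longrightarrow> a + b = 1 \<Longrightarrow> (\<lambda>\<omega>. a * u \<omega> + b * v \<omega>) \<in> C"
    and x: "\<And>j. x j \<in> C"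
  shows "(\<lambda>\<omega>. (\<Sum>j<Suc n. x j \<omega>) / real (Suc n)) \<in> C"
proof (induction n)
  case 0
  then show ?case using x by simp
next
  case (Suc n)
  let ?a = "real (Suc n) / real (Suc (Suc n))" and ?b = "1 / real (Suc (Suc n))"
  have "(\<lambda>\<omega>. ?a * ((\<Sum>j<Suc n. x j \<omega>) / real (Suc n)) + ?b * x (Suc n) \<omega>) \<in> C"
    by (intro convex Suc x) (auto simp: add_divide_distrib[symmetric])
  moreover have "?a * (s / real (Suc n)) + ?b * t = (s + t) / real (Suc (Suc n))" for s t
    by (simp add: add_divide_distrib del: of_nat_Suc)
  ultimately show ?case by (simp only: sum.lessThan_Suc[of _ "Suc n"])
qed

text \<open>A bounded a.s. convergent sequence has order bounded forward convex combinations.\<close>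

lemma order_closed_bounded_closed:
  assumes l: "1 < (l::nat)" and y0: "0 < y0" and nab: "\<And>y. y0 \<le> y \<Longrightarrow> 2 * real l * \<Psi> y \<le> \<Psi> (real l * y)"
    and convex: "\<And>u v a b. u \<in> C \<Longrightarrow> v \<in> C \<Longrightarrow> 0 \<le> a \<Longrightarrow> 0 \<le> b \<Longrightarrow> a + b = 1 \<Longrightarrow> (\<lambda>\<omega>. a * u \<omega> + b * v \<omega>) \<in> C"
    and closed: "\<And>u v h. (\<And>n::nat. u n \<in> C) \<Longrightarrow> v \<in> orlicz_space M \<Psi> \<Longrightarrow> h \<in> orlicz_space M \<Psi> \<Longrightarrow>
      (\<And>n. AE \<omega> in M. \<bar>u n \<omega>\<bar> \<le> h \<omega>) \<Longrightarrow> (AE \<omega> in M. (\<lambda>n. u n \<omega>) \<longlonglongrightarrow> v \<omega>) \<Longrightarrow> v \<in> C"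
    and r: "0 < r" and uC: "\<And>n. u n \<in> C" and uB: "\<And>n. u n \<in> ball r" and v: "v \<in> borel_measurable M"
    and lim: "AE \<omega> in M. (\<lambda>n. u n \<omega>) \<longlonglongrightarrow> v \<omega>"
  shows "v \<in> C"
proof -
  have vB: "v \<in> ball r" by (rule ball_closed[OF uB v lim r])
  have [measurable]: "u n \<in> borel_measurable M" "v \<in> borel_measurable M" for n using uB ball_meas v by auto
  \<comment> \<open>The differences lie in the ball of radius \<open>2 r\<close>, so the quotients
    lie in the unit ball.\<close>
  define z where "z n \<omega> = (u n \<omega> - v \<omega>) / (2 * r)" for n \<omega>
  have [measurable]: "z n \<in> borel_measurable M" for n unfolding z_def by measurable
  have zB: "z n \<in> ball 1" for n
    using ball_diff[OF uB[of n] vB r r] unfolding ball_def z_def by simp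
  have zlim: "AE \<omega> in M. (\<lambda>n. z n \<omega>) \<longlonglongrightarrow> 0" using lim
  proof eventually_elim
    case (elim \<omega>)
    then have "(\<lambda>n. z n \<omega>) \<longlonglongrightarrow> (v \<omega> - v \<omega>) / (2 * r)" unfolding z_def using r by (intro tendsto_intros) auto
    then show ?case by simp
  qed
  have "\<forall>m. \<exists>k. (\<forall>j. m \<le> k j) \<and> integrable M (\<lambda>\<omega>. \<Psi> ((\<Sum>j<l ^ m. z (k j) \<omega>) / real (l ^ m) / 3)) \<and>
    (\<integral>\<omega>. \<Psi> ((\<Sum>j<l ^ m. z (k j) \<omega>) / real (l ^ m) / 3) \<partial>M) \<le> (1/2) ^ m"
    using block_average[OF l y0 nab zB zlim] by blast
  then obtain k where k: "\<And>m j. m \<le> k m j" "\<And>m. integrable M (\<lambda>\<omega>. \<Psi> ((\<Sum>j<l ^ m. z (k m j) \<omega>) / real (l ^ m) / 3))"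
    "\<And>m. (\<integral>\<omega>. \<Psi> ((\<Sum>j<l ^ m. z (k m j) \<omega>) / real (l ^ m) / 3) \<partial>M) \<le> (1/2) ^ m" by metis
  define \<zeta> where "\<zeta> m \<omega> = (\<Sum>j<l ^ m. z (k m j) \<omega>) / real (l ^ m)" for m \<omega>
  have [measurable]: "\<zeta> m \<in> borel_measurable M" for m unfolding \<zeta>_def by measurable
  define F where "F m \<omega> = \<Psi> (\<zeta> m \<omega> / 3)" for m \<omega>
  have [measurable]: "F m \<in> borel_measurable M" for m unfolding F_def by measurable
  have F0: "0 \<le> F m \<omega>" for m \<omega> unfolding F_def by simp
  have Fi: "integrable M (F m)" "(\<integral>\<omega>. F m \<omega> \<partial>M) \<le> (1/2) ^ m" for m using k(2,3) unfolding F_def \<zeta>_def by auto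
  have geo: "summable (\<lambda>m. (1/2::real) ^ m)" by (intro summable_geometric) simp
  have sF: "AE \<omega> in M. summable (\<lambda>m. \<bar>F m \<omega>\<bar>)"
    by (rule AE_summable_of_integrals[OF _ Fi(1) _ geo]) (use Fi(2) F0 in auto)
  have sI: "summable (\<lambda>m. \<integral>\<omega>. F m \<omega> \<partial>M)"
    by (rule summable_comparison_test[OF _ geo]) (use Fi(2) F0 in \<open>auto simp: integral_nonneg_AE\<close>)
  define S where "S \<omega> = (\<Sum>m. F m \<omega>)" for \<omega>
  have [measurable]: "S \<in> borel_measurable M" unfolding S_def by measurable
  have Si: "integrable M S" unfolding S_def using Fi(1) sF sI F0 by (intro integrable_suminf) auto
  have "(\<integral>\<omega>. S \<omega> \<partial>M) = (\<Sum>m. \<integral>\<omega>. F m \<omega> \<partial>M)" unfolding S_def using Fi(1) sF sI F0 by (intro integral_suminf) auto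
  also have "\<dots> \<le> (\<Sum>m. (1/2) ^ m)" using Fi(2) sI geo by (intro suminf_le) auto
  also have "\<dots> = 2" by (subst suminf_geometric) auto
  finally have S2: "(\<integral>\<omega>. S \<omega> \<partial>M) \<le> 2" .
  \<comment> \<open>One function for all blocks: \<open>S\<close> dominates every
    \<open>\<Psi> (\<zeta> m / 3)\<close>, so \<open>h\<close> dominates every
    \<open>\<bar>\<zeta> m\<bar> / 3\<close>. As \<open>E[S] \<le> 2\<close>, halving the argument
    brings the modular down to 1, which puts \<open>h\<close> into the ball of radius 2.\<close>
  define h where "h \<omega> = level (S \<omega>)" for \<omega>
  have [measurable]: "h \<in> borel_measurable M" unfolding h_def by measurable
  have S0: "AE \<omega> in M. 0 \<le> S \<omega>" using sF unfolding S_def by eventually_elim (use F0 in \<open>auto intro!: suminf_nonneg\<close>)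
  have hle: "AE \<omega> in M. \<Psi> (h \<omega> / 2) \<le> S \<omega> / 2" using S0
  proof eventually_elim
    case (elim \<omega>)
    have "\<Psi> (1/2 * h \<omega>) \<le> 1/2 * \<Psi> (h \<omega>)" by (rule scale_le) auto
    also have "\<dots> \<le> 1/2 * S \<omega>" using level_le[of "S \<omega>"] elim unfolding h_def by simp
    finally show ?case by simp
  qed
  have hi: "integrable M (\<lambda>\<omega>. \<Psi> (h \<omega> / 2))"
  proof (rule Bochner_Integration.integrable_bound[OF integrable_divide[OF Si, of 2]])
    show "AE \<omega> in M. norm (\<Psi> (h \<omega> / 2)) \<le> norm (S \<omega> / 2)" using hle by eventually_elim simp
  qed measurable
  have "(\<integral>\<omega>. \<Psi> (h \<omega> / 2) \<partial>M) \<le> (\<integral>\<omega>. S \<omega> / 2 \<partial>M)" using hi Si hle by (intro integral_mono_AE) auto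
  also have "\<dots> \<le> 1" using S2 by simp
  finally have "h \<in> ball 2" using hi unfolding ball_iff by simp
  then have hL: "h \<in> orlicz_space M \<Psi>" unfolding space_iff by (intro exI[of _ 2]) simp
  have vL: "v \<in> orlicz_space M \<Psi>" using vB r unfolding space_iff by blast
  have \<zeta>h: "AE \<omega> in M. \<forall>m. \<bar>\<zeta> m \<omega>\<bar> \<le> 3 * h \<omega>" using sF
  proof eventually_elim
    case (elim \<omega>)
    show ?case
    proof
      fix m
      have "F m \<omega> = (\<Sum>i\<in>{m}. F i \<omega>)" by simp
      also have "\<dots> \<le> S \<omega>" unfolding S_def using elim F0 by (intro sum_le_suminf) auto
      finally have "\<Psi> (\<bar>\<zeta> m \<omega> / 3\<bar>) \<le> S \<omega>" unfolding F_def abs_arg .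
      then have "\<bar>\<zeta> m \<omega> / 3\<bar> \<le> h \<omega>" unfolding h_def by (rule level_ge)
      then show "\<bar>\<zeta> m \<omega>\<bar> \<le> 3 * h \<omega>" by simp
    qed
  qed
  \<comment> \<open>Only entries with index at least \<open>m\<close> are averaged, so pointwise
    convergence is inherited whatever their number \<open>l^m\<close>.\<close>
  have \<zeta>lim: "AE \<omega> in M. (\<lambda>m. \<zeta> m \<omega>) \<longlonglongrightarrow> 0" using zlim
  proof eventually_elim
    case (elim \<omega>)
    show ?case
    proof (rule LIMSEQ_I)
      fix e :: real assume e: "0 < e"
      then obtain n0 where n0: "\<And>n. n \<ge> n0 \<Longrightarrow> \<bar>z n \<omega>\<bar> < e / 2"
        using LIMSEQ_D[OF elim, of "e / 2"] by auto
      have "norm (\<zeta> m \<omega> - 0) < e" if m: "m \<ge> n0" for m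
      proof -
        have N: "0 < real (l ^ m)" using l by simp
        have "\<bar>\<Sum>j<l ^ m. z (k m j) \<omega>\<bar> \<le> (\<Sum>j<l ^ m. e / 2)"
          using n0[OF order_trans[OF m k(1)]] by (intro order_trans[OF sum_abs] sum_mono) (simp add: less_imp_le)
        also have "\<dots> = real (l ^ m) * (e / 2)" by simp
        finally have "\<bar>\<zeta> m \<omega>\<bar> \<le> e / 2" unfolding \<zeta>_def abs_divide using N by (simp add: divide_le_eq mult.commute)
        then show ?thesis using e by simp
      qed
      then show "\<exists>n0. \<forall>m\<ge>n0. norm (\<zeta> m \<omega> - 0) < e" by blast
    qed
  qed
  define w where "w m \<omega> = (\<Sum>j<l ^ m. u (k m j) \<omega>) / real (l ^ m)" for m \<omega>
  have wC: "w m \<in> C" for m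
  proof -
    obtain n where "l ^ m = Suc n" using l by (metis gr0_implies_Suc less_trans zero_less_one zero_less_power)
    then show ?thesis using average_in_convex[of C "\<lambda>j. u (k m j)" n] convex uC unfolding w_def by simp
  qed
  have w_eq: "w m \<omega> = v \<omega> + 2 * r * \<zeta> m \<omega>" for m \<omega>
  proof -
    have "u n \<omega> = v \<omega> + 2 * r * z n \<omega>" for n unfolding z_def using r by simp
    then have "(\<Sum>j<l ^ m. u (k m j) \<omega>) = real (l ^ m) * v \<omega> + 2 * r * (\<Sum>j<l ^ m. z (k m j) \<omega>)"
      by (simp add: sum.distrib sum_distrib_left)
    then show ?thesis unfolding w_def \<zeta>_def using l by (simp add: add_divide_distrib)
  qed
  show ?thesis
  proof (rule closed[OF wC vL])
    have "(\<lambda>\<omega>. \<bar>v \<omega>\<bar>) \<in> orlicz_space M \<Psi>" by (rule space_dominated[OF vL]) auto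
    then show "(\<lambda>\<omega>. \<bar>v \<omega>\<bar> + 6 * r * h \<omega>) \<in> orlicz_space M \<Psi>" by (rule space_add[OF _ space_scale[OF hL]])
    show "AE \<omega> in M. \<bar>w m \<omega>\<bar> \<le> \<bar>v \<omega>\<bar> + 6 * r * h \<omega>" for m using \<zeta>h
    proof eventually_elim
      case (elim \<omega>)
      have "\<bar>w m \<omega>\<bar> \<le> \<bar>v \<omega>\<bar> + \<bar>2 * r * \<zeta> m \<omega>\<bar>" unfolding w_eq by (rule abs_triangle_ineq)
      also have "\<bar>2 * r * \<zeta> m \<omega>\<bar> = 2 * r * \<bar>\<zeta> m \<omega>\<bar>" using r by (simp add: abs_mult)
      also have "\<dots> \<le> 2 * r * (3 * h \<omega>)" using r elim by (intro mult_left_mono) auto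
      finally show ?case by simp
    qed
    show "AE \<omega> in M. (\<lambda>m. w m \<omega>) \<longlonglongrightarrow> v \<omega>" using \<zeta>lim
    proof eventually_elim
      case (elim \<omega>)
      have "(\<lambda>m. w m \<omega>) \<longlonglongrightarrow> v \<omega> + 2 * r * 0" unfolding w_eq by (intro tendsto_intros elim)
      then show ?case by simp
    qed
  qed
qed

end

section \<open>The duality\<close>

locale orlicz_dual = orlicz M \<Phi> for M :: "'a measure" and \<Phi> +
  assumes Delta2: "Delta2 \<Phi>"
begin

sublocale dual: orlicz M "young_conjugate \<Phi>"
  by unfold_locales (rule young_conjugate)

abbreviation "L \<equiv> orlicz_space M \<Phi>"

abbreviation "L' \<equiv> orlicz_space M (young_conjugate \<Phi>)"

lemma integrable_pairing:
  assumes "\<eta> \<in> L" "\<xi> \<in> L'"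
  shows "integrable M (\<lambda>\<omega>. \<eta> \<omega> * \<xi> \<omega>)"
proof -
  obtain r s where r: "r > 0" "\<eta> \<in> ball r" and s: "s > 0" "\<xi> \<in> dual.ball s"
    using assms space_iff dual.space_iff by auto
  have i: "integrable M (\<lambda>\<omega>. r * s * (\<Phi> (\<eta> \<omega> / r) + young_conjugate \<Phi> (\<xi> \<omega> / s)))"
    using r(2) s(2) unfolding ball_iff dual.ball_iff by auto
  have [measurable]: "\<eta> \<in> borel_measurable M" "\<xi> \<in> borel_measurable M" using r s ball_meas dual.ball_meas by auto
  show ?thesis
  proof (rule Bochner_Integration.integrable_bound[OF i])
    have "\<bar>x * y\<bar> \<le> r * s * (\<Phi> (x / r) + young_conjugate \<Phi> (y / s))" for x y
    proof -
      have "\<bar>x * y\<bar> = r * s * (\<bar>x / r\<bar> * \<bar>y / s\<bar>)" using r s by (simp add: abs_mult)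
      also have "\<dots> \<le> r * s * (\<Phi> \<bar>x / r\<bar> + young_conjugate \<Phi> \<bar>y / s\<bar>)"
        using r s by (intro mult_left_mono fenchel_young) auto
      finally show ?thesis by (simp only: abs_arg dual.abs_arg)
    qed
    then show "AE \<omega> in M. norm (\<eta> \<omega> * \<xi> \<omega>) \<le> norm (r * s * (\<Phi> (\<eta> \<omega> / r) + young_conjugate \<Phi> (\<xi> \<omega> / s)))"
      by (intro AE_I2) (metis abs_ge_self order_trans real_norm_def)
  qed measurable
qed

text \<open>Test against subgradients of \<open>\<Phi>\<close> at truncations of \<open>g\<close>.\<close>

lemma bounded_functional_in_space:
  assumes c: "0 < c" and g [measurable]: "g \<in> borel_measurable M" and g0: "\<And>\<omega>. 0 \<le> g \<omega>"
    and bd: "\<And>\<xi>. \<xi> \<in> dual.ball 1 \<Longrightarrow> (\<And>\<omega>. 0 \<le> \<xi> \<omega>) \<Longrightarrow> integrable M (\<lambda>\<omega>. g \<omega> * \<xi> \<omega>) \<and> (\<integral>\<omega>. g \<omega> * \<xi> \<omega> \<partial>M) \<le> c"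
  shows "g \<in> L"
proof -
  obtain p where p: "\<And>x y. \<Phi> x + p x * (y - x) \<le> \<Phi> y" using subgradient by blast
  have p_mono: "p x \<le> p y" if "x \<le> y" for x y
  proof (cases "x = y")
    case False
    have "(p x - p y) * (y - x) \<le> 0" using p[of x y] p[of y x] by (simp add: algebra_simps)
    then show ?thesis using that False by (simp add: mult_le_0_iff)
  qed simp
  have [measurable]: "p \<in> borel_measurable borel" by (intro borel_measurable_mono monoI p_mono)
  \<comment> \<open>The test functions must be nonnegative. On the nonnegative half-line the modulus
    can change only the value at 0.\<close>
  define q where "q x = \<bar>p x\<bar>" for x
  have [measurable]: "q \<in> borel_measurable borel" unfolding q_def by measurable
  have conj_le: "young_conjugate \<Phi> (p x) \<le> x * p x - \<Phi> x" for x
  proof (rule conj_least)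
    show "z * p x - \<Phi> z \<le> x * p x - \<Phi> x" for z using p[of x z] by (simp add: algebra_simps)
  qed
  \<comment> \<open>This direction of the Fenchel-Young equality at a subgradient is the one that
    forces the modular of \<open>G n\<close> to be small.\<close>
  have q_eq: "young_conjugate \<Phi> (q x) + \<Phi> x \<le> x * q x" if "0 \<le> x" for x
  proof -
    have "x * p x \<le> x * q x" unfolding q_def using that by (intro mult_left_mono) auto
    then show ?thesis using conj_le[of x] dual.abs_arg[of "p x"] unfolding q_def by linarith
  qed
  \<comment> \<open>Truncation makes all integrals finite before anything is known about the modular
    of \<open>g\<close>.\<close>
  define G where "G n \<omega> = min (g \<omega> / c) (real n)" for n \<omega>
  have [measurable]: "G n \<in> borel_measurable M" for n unfolding G_def by measurable
  have Gb: "0 \<le> G n \<omega>" "G n \<omega> \<le> real n" "G n \<omega> \<le> g \<omega> / c" for n \<omega> unfolding G_def using c g0 by auto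
  have GB: "G n \<in> ball 1" for n
  proof -
    define \<xi> where "\<xi> \<omega> = q (G n \<omega>)" for \<omega>
    have [measurable]: "\<xi> \<in> borel_measurable M" unfolding \<xi>_def by measurable
    have \<xi>0: "0 \<le> \<xi> \<omega>" for \<omega> unfolding \<xi>_def q_def by simp
    define B where "B = max \<bar>p 0\<bar> \<bar>p (real n)\<bar>"
    have \<xi>B: "\<xi> \<omega> \<le> B" for \<omega>
      using p_mono[OF Gb(1)[of n \<omega>]] p_mono[OF Gb(2)[of n \<omega>]] unfolding \<xi>_def q_def B_def by linarith
    have i1: "integrable M (\<lambda>\<omega>. young_conjugate \<Phi> (\<xi> \<omega>))"
      using \<xi>0 \<xi>B by (intro integrable_const_bound[where B = "young_conjugate \<Phi> B"]) (auto intro!: dual.mono_abs AE_I2 order_trans[OF \<xi>B])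
    have i2: "integrable M (\<lambda>\<omega>. \<Phi> (G n \<omega>))"
      using Gb by (intro integrable_const_bound[where B = "\<Phi> (real n)"]) (auto intro!: mono_abs AE_I2)
    have i3: "integrable M (\<lambda>\<omega>. G n \<omega> * \<xi> \<omega>)"
    proof (rule integrable_const_bound[where B = "real n * B"])
      have "\<bar>G n \<omega> * \<xi> \<omega>\<bar> \<le> real n * B" for \<omega>
        unfolding abs_mult using Gb \<xi>0 \<xi>B by (intro mult_mono) auto
      then show "AE \<omega> in M. norm (G n \<omega> * \<xi> \<omega>) \<le> real n * B" by simp
    qed measurable
    define A where "A = (\<integral>\<omega>. young_conjugate \<Phi> (\<xi> \<omega>) \<partial>M)"
    have sum: "A + (\<integral>\<omega>. \<Phi> (G n \<omega>) \<partial>M) \<le> (\<integral>\<omega>. G n \<omega> * \<xi> \<omega> \<partial>M)"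
    proof -
      have "A + (\<integral>\<omega>. \<Phi> (G n \<omega>) \<partial>M) = (\<integral>\<omega>. young_conjugate \<Phi> (\<xi> \<omega>) + \<Phi> (G n \<omega>) \<partial>M)" unfolding A_def using i1 i2 by simp
      also have "\<dots> \<le> (\<integral>\<omega>. G n \<omega> * \<xi> \<omega> \<partial>M)"
        using i1 i2 i3 q_eq[OF Gb(1)] unfolding \<xi>_def by (intro integral_mono) auto
      finally show ?thesis .
    qed
    have test: "(\<integral>\<omega>. G n \<omega> * \<xi> \<omega> \<partial>M) \<le> t" if t: "0 < t" and tb: "(\<lambda>\<omega>. \<xi> \<omega> / t) \<in> dual.ball 1" for t
    proof -
      have b: "integrable M (\<lambda>\<omega>. g \<omega> * (\<xi> \<omega> / t))" "(\<integral>\<omega>. g \<omega> * (\<xi> \<omega> / t) \<partial>M) \<le> c" using bd[OF tb] \<xi>0 t by auto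
      have "(\<integral>\<omega>. G n \<omega> * \<xi> \<omega> \<partial>M) \<le> (\<integral>\<omega>. t / c * (g \<omega> * (\<xi> \<omega> / t)) \<partial>M)"
      proof (rule integral_mono[OF i3])
        show "G n \<omega> * \<xi> \<omega> \<le> t / c * (g \<omega> * (\<xi> \<omega> / t))" for \<omega>
          using mult_right_mono[OF Gb(3) \<xi>0, of n \<omega> \<omega>] t by simp
      qed (rule integrable_mult_right[OF b(1)])
      also have "\<dots> = t / c * (\<integral>\<omega>. g \<omega> * (\<xi> \<omega> / t) \<partial>M)" by simp
      also have "\<dots> \<le> t / c * c" using b t c by (intro mult_left_mono) auto
      finally show ?thesis using c by simp
    qed
    have A0: "0 \<le> A" unfolding A_def by (intro integral_nonneg_AE) auto
    \<comment> \<open>If the modular \<open>A\<close> of the test function is at most 1, the test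
      gives \<open>A + E[\<Phi> (G n)] \<le> 1\<close>. Otherwise \<open>\<xi> / A\<close> is an
      admissible test function, which gives \<open>E[G n * \<xi>] \<le> A\<close>; subtracting
      \<open>A\<close> leaves nothing for \<open>E[\<Phi> (G n)]\<close>.\<close>
    have "(\<integral>\<omega>. \<Phi> (G n \<omega>) \<partial>M) \<le> 1"
    proof (cases "A \<le> 1")
      case True
      then have "(\<lambda>\<omega>. \<xi> \<omega> / 1) \<in> dual.ball 1" unfolding dual.ball_iff using i1 unfolding A_def by simp
      from test[OF _ this] show ?thesis using sum A0 by simp
    next
      case False
      have le: "young_conjugate \<Phi> (\<xi> \<omega> / A) \<le> young_conjugate \<Phi> (\<xi> \<omega>) / A" for \<omega>
        using dual.scale_le[of "1 / A" "\<xi> \<omega>"] False by simp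
      have i4: "integrable M (\<lambda>\<omega>. young_conjugate \<Phi> (\<xi> \<omega> / A))"
        by (rule Bochner_Integration.integrable_bound[OF integrable_divide[OF i1, of A]]) (use le A0 in \<open>auto intro!: AE_I2\<close>)
      have "(\<integral>\<omega>. young_conjugate \<Phi> (\<xi> \<omega> / A) \<partial>M) \<le> (\<integral>\<omega>. young_conjugate \<Phi> (\<xi> \<omega>) / A \<partial>M)"
        using i4 i1 le by (intro integral_mono) auto
      also have "\<dots> = 1" using False A_def by simp
      finally have "(\<lambda>\<omega>. \<xi> \<omega> / A) \<in> dual.ball 1" unfolding dual.ball_iff using i4 by simp
      from test[OF _ this] False have "(\<integral>\<omega>. G n \<omega> * \<xi> \<omega> \<partial>M) \<le> A" by simp
      then show ?thesis using sum by simp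
    qed
    then show ?thesis unfolding ball_iff using i2 by simp
  qed
  have "(\<lambda>\<omega>. g \<omega> / c) \<in> ball 1"
  proof (rule ball_closed[OF GB])
    show "AE \<omega> in M. (\<lambda>n. G n \<omega>) \<longlonglongrightarrow> g \<omega> / c"
    proof (intro AE_I2)
      fix \<omega>
      obtain n0 :: nat where "g \<omega> / c \<le> real n0" using real_arch_simple by blast
      then have "\<forall>\<^sub>F n in sequentially. G n \<omega> = g \<omega> / c"
        unfolding eventually_sequentially G_def by (intro exI[of _ n0]) (auto simp: min_def)
      then show "(\<lambda>n. G n \<omega>) \<longlonglongrightarrow> g \<omega> / c" by (rule tendsto_eventually)
    qed
  qed auto
  then have "(\<lambda>\<omega>. g \<omega> / c) \<in> L" unfolding space_iff by (intro exI[of _ 1]) simp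
  from space_scale[OF this, of c] show ?thesis using c by simp
qed

section \<open>Krein-Smulian separation of an order closed convex set from zero\<close>

lemma ball_pairing_scale:
  assumes g: "\<And>\<xi>. \<xi> \<in> dual.ball \<rho> \<Longrightarrow> \<bar>\<integral>\<omega>. g \<omega> * \<xi> \<omega> \<partial>M\<bar> \<le> 1" and \<rho>: "0 < \<rho>" and s: "0 < s" and \<xi>: "\<xi> \<in> dual.ball s"
  shows "\<bar>\<integral>\<omega>. g \<omega> * \<xi> \<omega> \<partial>M\<bar> \<le> s / \<rho>"
proof -
  have "(\<lambda>\<omega>. \<rho> / s * \<xi> \<omega>) \<in> dual.ball (\<bar>\<rho> / s\<bar> * s)" using \<xi> \<rho> s by (intro dual.ball_scale) auto
  then have "(\<lambda>\<omega>. \<rho> / s * \<xi> \<omega>) \<in> dual.ball \<rho>" using \<rho> s by simp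
  from g[OF this] have "\<bar>\<rho> / s * (\<integral>\<omega>. g \<omega> * \<xi> \<omega> \<partial>M)\<bar> \<le> 1" by (simp add: mult.left_commute)
  then show ?thesis using \<rho> s by (simp add: abs_mult field_simps)
qed

text \<open>Balls are solid: \<open>\<xi>\<close> may be replaced by its modulus with the sign of
  \<open>g\<close>. The absolute bound is what makes the series of functionals converge absolutely
  a.e.\<close>

lemma ball_pairing_abs:
  assumes g: "\<And>\<xi>. \<xi> \<in> dual.ball \<rho> \<Longrightarrow> \<bar>\<integral>\<omega>. g \<omega> * \<xi> \<omega> \<partial>M\<bar> \<le> 1" and \<rho>: "0 < \<rho>" and s: "0 < s" and \<xi>: "\<xi> \<in> dual.ball s"
    and [measurable]: "g \<in> borel_measurable M"
  shows "(\<integral>\<omega>. \<bar>g \<omega> * \<xi> \<omega>\<bar> \<partial>M) \<le> s / \<rho>"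
proof -
  have [measurable]: "\<xi> \<in> borel_measurable M" using \<xi> dual.ball_meas by auto
  have "(\<lambda>\<omega>. sgn (g \<omega>) * \<bar>\<xi> \<omega>\<bar>) \<in> dual.ball s"
    by (rule dual.ball_dominated[OF \<xi>]) (auto simp: abs_mult sgn_if)
  from ball_pairing_scale[OF g \<rho> s this]
  have "\<bar>\<integral>\<omega>. g \<omega> * (sgn (g \<omega>) * \<bar>\<xi> \<omega>\<bar>) \<partial>M\<bar> \<le> s / \<rho>" by simp
  moreover have "g \<omega> * (sgn (g \<omega>) * \<bar>\<xi> \<omega>\<bar>) = \<bar>g \<omega> * \<xi> \<omega>\<bar>" for \<omega> by (auto simp: abs_mult sgn_if)
  ultimately show ?thesis by simp
qed

text \<open>Points of \<open>C\<close> of norm at most \<open>1 / (n + 1)\<close> would tend to 0 in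
  L1, hence a.s. along a subsequence, inside the unit ball. This provides the radius
  \<open>r0\<close> with which the induction starts.\<close>

lemma small_ball_disjoint:
  assumes closed: "\<And>u v. (\<And>n::nat. u n \<in> C) \<Longrightarrow> (\<And>n. u n \<in> dual.ball 1) \<Longrightarrow> v \<in> borel_measurable M \<Longrightarrow>
      (AE \<omega> in M. (\<lambda>n. u n \<omega>) \<longlonglongrightarrow> v \<omega>) \<Longrightarrow> v \<in> C"
    and zero: "(\<lambda>_. 0) \<notin> C"
  shows "\<exists>r>0. C \<inter> dual.ball r = {}"
proof (rule ccontr)
  assume "\<not> ?thesis"
  then have "\<forall>n. \<exists>u. u \<in> C \<inter> dual.ball (1 / real (Suc n))" by (metis of_nat_0_less_iff zero_less_Suc zero_less_divide_1_iff ex_in_conv)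
  then obtain u where u: "\<And>n. u n \<in> C" "\<And>n. u n \<in> dual.ball (1 / real (Suc n))" by (metis IntE)
  have uB: "u n \<in> dual.ball 1" for n using dual.ball_mono[of "1 / real (Suc n)" 1] u(2)[of n] by (auto simp: divide_le_eq)
  obtain c where c: "\<And>\<xi>. \<xi> \<in> dual.ball 1 \<Longrightarrow> integrable M \<xi>" "\<And>\<xi>. \<xi> \<in> dual.ball 1 \<Longrightarrow> (\<integral>\<omega>. \<bar>\<xi> \<omega>\<bar> \<partial>M) \<le> c"
    using dual.ball_L1[of 1] by auto
  have le: "(\<integral>\<omega>. \<bar>u n \<omega>\<bar> \<partial>M) \<le> c * (1 / real (Suc n))" for n
  proof -
    have "(\<lambda>\<omega>. real (Suc n) * u n \<omega>) \<in> dual.ball (\<bar>real (Suc n)\<bar> * (1 / real (Suc n)))"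
      using u(2) by (intro dual.ball_scale) auto
    then have "(\<lambda>\<omega>. real (Suc n) * u n \<omega>) \<in> dual.ball 1" by simp
    from c(2)[OF this] have "real (Suc n) * (\<integral>\<omega>. \<bar>u n \<omega>\<bar> \<partial>M) \<le> c" by (simp add: abs_mult del: of_nat_Suc)
    then show ?thesis by (simp add: field_simps del: of_nat_Suc)
  qed
  have lim0: "(\<lambda>n. c * (1 / real (Suc n))) \<longlonglongrightarrow> 0"
    using tendsto_mult_left[OF LIMSEQ_Suc[OF lim_inverse_n', unfolded inverse_eq_divide], of c] by simp
  have "(\<lambda>n. \<integral>\<omega>. norm (u n \<omega>) \<partial>M) \<longlonglongrightarrow> 0"
    by (rule tendsto_sandwich[OF _ _ tendsto_const lim0]) (use le in \<open>auto intro!: always_eventually simp del: of_nat_Suc\<close>)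
  from tendsto_L1_AE_subseq[OF c(1)[OF uB] this] obtain s where "AE \<omega> in M. (\<lambda>n. u (s n) \<omega>) \<longlonglongrightarrow> 0" by blast
  then have "(\<lambda>_. 0) \<in> C" using closed[of "\<lambda>n. u (s n)" "\<lambda>_. 0"] u(1) uB by simp
  then show False using zero by simp
qed

text \<open>The Krein--Smulian argument: functionals of summable norms such that \<open>C\<close> avoids the intersection of
  their slabs map \<open>C\<close> into the complement of the unit ball of \<open>\<ell>\<^sup>2\<close>.\<close>

lemma separate_from_zero:
  assumes sub: "C \<subseteq> L'"
    and convex: "\<And>u v a b. u \<in> C \<Longrightarrow> v \<in> C \<Longrightarrow> 0 \<le> a \<Longrightarrow> 0 \<le> b \<Longrightarrow> a + b = 1 \<Longrightarrow> (\<lambda>\<omega>. a * u \<omega> + b * v \<omega>) \<in> C"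
    and closed: "\<And>u v h. (\<And>n::nat. u n \<in> C) \<Longrightarrow> v \<in> L' \<Longrightarrow> h \<in> L' \<Longrightarrow>
      (\<And>n. AE \<omega> in M. \<bar>u n \<omega>\<bar> \<le> h \<omega>) \<Longrightarrow> (AE \<omega> in M. (\<lambda>n. u n \<omega>) \<longlonglongrightarrow> v \<omega>) \<Longrightarrow> v \<in> C"
    and zero: "(\<lambda>_. 0) \<notin> C"
  shows "\<exists>\<eta>\<in>L. \<forall>\<xi>\<in>C. 1 \<le> (\<integral>\<omega>. \<eta> \<omega> * \<xi> \<omega> \<partial>M)"
proof (cases "C = {}")
  case True
  then show ?thesis using const_space[of 0] by blast
next
  case ne: False
  obtain l :: nat and y0 where nab: "y0 > 0" "1 < l"
    "\<And>y. y0 \<le> y \<Longrightarrow> 2 * real l * young_conjugate \<Phi> y \<le> young_conjugate \<Phi> (real l * y)"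
    using nabla2[OF Delta2] by blast
  have bclosed: "v \<in> C" if "0 < r" "\<And>n. u n \<in> C" "\<And>n. u n \<in> dual.ball r" "v \<in> borel_measurable M"
      "AE \<omega> in M. (\<lambda>n. u n \<omega>) \<longlonglongrightarrow> v \<omega>" for r u v
    by (rule dual.order_closed_bounded_closed[OF nab(2,1,3) convex closed that])
  have "\<exists>r>0. C \<inter> dual.ball r = {}"
  proof (rule small_ball_disjoint[OF _ zero])
    show "v \<in> C" if "\<And>n::nat. u n \<in> C" "\<And>n. u n \<in> dual.ball 1" "v \<in> borel_measurable M"
      "AE \<omega> in M. (\<lambda>n. u n \<omega>) \<longlonglongrightarrow> v \<omega>" for u v
      by (rule bclosed[OF zero_less_one that])
  qed
  then obtain r0 where r0: "0 < r0" "C \<inter> dual.ball r0 = {}" by blast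
  define \<rho> where "\<rho> n = r0 * 2 ^ n" for n :: nat
  have \<rho>: "0 < \<rho> n" for n unfolding \<rho>_def using r0 by simp
  define slab where "slab g = {\<xi> \<in> L'. \<bar>\<integral>\<omega>. g \<omega> * \<xi> \<omega> \<partial>M\<bar> \<le> 1}" for g :: "'a \<Rightarrow> real"
  define good where "good n g \<longleftrightarrow> g \<in> borel_measurable M \<and> (\<exists>b. \<forall>\<omega>. \<bar>g \<omega>\<bar> \<le> b) \<and>
    (\<forall>\<xi>\<in>dual.ball (\<rho> n). \<bar>\<integral>\<omega>. g \<omega> * \<xi> \<omega> \<partial>M\<bar> \<le> 1)" for n and g :: "'a \<Rightarrow> real"
  \<comment> \<open>\<open>A\<close> is the intersection of the slabs chosen so far. The last clause
    is the aim of the induction; convexity and closedness within balls are carried along so that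
    \<open>C \<inter> A\<close> can be separated again.\<close>
  define inv where "inv n A \<longleftrightarrow> A \<subseteq> L' \<and> (\<forall>u\<in>A. \<forall>v\<in>A. \<forall>a b. 0 \<le> a \<and> 0 \<le> b \<and> a + b = 1 \<longrightarrow> (\<lambda>\<omega>. a * u \<omega> + b * v \<omega>) \<in> A)
    \<and> (\<forall>r u v. 0 < r \<and> (\<forall>n::nat. u n \<in> A \<and> u n \<in> dual.ball r) \<and> v \<in> borel_measurable M \<and>
        (AE \<omega> in M. (\<lambda>n. u n \<omega>) \<longlonglongrightarrow> v \<omega>) \<longrightarrow> v \<in> A)
    \<and> C \<inter> A \<inter> dual.ball (\<rho> n) = {}" for n :: nat and A
  have step: "\<exists>A'. inv (Suc n) A' \<and> (\<exists>g. good n g \<and> A' = A \<inter> slab g)" if A: "inv n A" for n A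
  proof -
    note A' = A[unfolded inv_def]
    have Asub: "A \<subseteq> L'" by (rule A'[THEN conjunct1])
    have Aconv: "(\<lambda>\<omega>. a * u \<omega> + b * v \<omega>) \<in> A" if "u \<in> A" "v \<in> A" "0 \<le> a" "0 \<le> b" "a + b = 1" for u v a b
      using A'[THEN conjunct2, THEN conjunct1, rule_format, OF that(1,2), of a b] that by blast
    have Acl: "v \<in> A" if "0 < r" "\<And>n::nat. u n \<in> A" "\<And>n. u n \<in> dual.ball r" "v \<in> borel_measurable M"
      "AE \<omega> in M. (\<lambda>n. u n \<omega>) \<longlonglongrightarrow> v \<omega>" for r u v
      using A'[THEN conjunct2, THEN conjunct2, THEN conjunct1, rule_format, of r u v] that by blast
    have Adisj: "C \<inter> A \<inter> dual.ball (\<rho> n) = {}" by (rule A'[THEN conjunct2, THEN conjunct2, THEN conjunct2])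
    \<comment> \<open>Inside the ball of radius \<open>\<rho> (n + 1)\<close> the remaining part of
      \<open>C\<close> avoids the ball of radius \<open>\<rho> n\<close>. A functional bounded by 1
      on the smaller ball and above 1 on this part has a slab that misses the part.\<close>
    have "\<exists>g\<in>borel_measurable M. (\<exists>b. \<forall>\<omega>. \<bar>g \<omega>\<bar> \<le> b) \<and> (\<forall>\<xi>\<in>dual.ball (\<rho> n). \<bar>\<integral>\<omega>. g \<omega> * \<xi> \<omega> \<partial>M\<bar> \<le> 1)
       \<and> (\<forall>\<xi>\<in>C \<inter> A \<inter> dual.ball (\<rho> (Suc n)). 1 < (\<integral>\<omega>. g \<omega> * \<xi> \<omega> \<partial>M))"
    proof (rule dual.separate_from_ball[OF \<rho>[of "Suc n"] \<rho>[of n]])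
      show "C \<inter> A \<inter> dual.ball (\<rho> (Suc n)) \<inter> dual.ball (\<rho> n) = {}" using Adisj by blast
      show "(\<lambda>\<omega>. a * u \<omega> + b * v \<omega>) \<in> C \<inter> A \<inter> dual.ball (\<rho> (Suc n))"
        if "u \<in> C \<inter> A \<inter> dual.ball (\<rho> (Suc n))" "v \<in> C \<inter> A \<inter> dual.ball (\<rho> (Suc n))" "0 \<le> a" "0 \<le> b" "a + b = 1" for u v a b
        using that \<rho> by (auto intro!: convex Aconv dual.ball_convex)
      show "v \<in> C \<inter> A \<inter> dual.ball (\<rho> (Suc n))"
        if u: "\<And>k::nat. u k \<in> C \<inter> A \<inter> dual.ball (\<rho> (Suc n))" and v: "v \<in> borel_measurable M"
          and lim: "AE \<omega> in M. (\<lambda>k. u k \<omega>) \<longlonglongrightarrow> v \<omega>" for u v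
      proof -
        have u': "\<And>k. u k \<in> C" "\<And>k. u k \<in> A" "\<And>k. u k \<in> dual.ball (\<rho> (Suc n))" using u by auto
        show ?thesis using bclosed[OF \<rho> u'(1,3) v lim] Acl[OF \<rho> u'(2,3) v lim] dual.ball_closed[OF u'(3) v lim \<rho>] by blast
      qed
    qed auto
    then obtain g where g: "good n g" "\<And>\<xi>. \<xi> \<in> C \<inter> A \<inter> dual.ball (\<rho> (Suc n)) \<Longrightarrow> 1 < (\<integral>\<omega>. g \<omega> * \<xi> \<omega> \<partial>M)"
      unfolding good_def by blast
    then obtain b where gm: "g \<in> borel_measurable M" and gb: "\<And>\<omega>. \<bar>g \<omega>\<bar> \<le> b" unfolding good_def by blast
    have gi: "integrable M (\<lambda>\<omega>. g \<omega> * \<xi> \<omega>)" if "\<xi> \<in> L'" for \<xi>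
      by (rule integrable_pairing[OF bounded_space[OF gm gb] that])
    have "inv (Suc n) (A \<inter> slab g)" unfolding inv_def
    proof (intro conjI ballI allI impI)
      show "A \<inter> slab g \<subseteq> L'" using Asub by auto
      show "C \<inter> (A \<inter> slab g) \<inter> dual.ball (\<rho> (Suc n)) = {}" using g(2) unfolding slab_def by force
    next
      fix u v a b assume uv: "u \<in> A \<inter> slab g" "v \<in> A \<inter> slab g" and "0 \<le> a \<and> 0 \<le> b \<and> a + b = (1::real)"
      then have ab: "0 \<le> a" "0 \<le> b" "a + b = 1" by auto
      have m: "(\<lambda>\<omega>. a * u \<omega> + b * v \<omega>) \<in> A" using uv ab by (intro Aconv) auto
      have "(\<integral>\<omega>. g \<omega> * (a * u \<omega> + b * v \<omega>) \<partial>M) = (\<integral>\<omega>. a * (g \<omega> * u \<omega>) + b * (g \<omega> * v \<omega>) \<partial>M)"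
        by (intro Bochner_Integration.integral_cong) (auto simp: algebra_simps)
      also have "\<dots> = a * (\<integral>\<omega>. g \<omega> * u \<omega> \<partial>M) + b * (\<integral>\<omega>. g \<omega> * v \<omega> \<partial>M)"
        using gi[OF subsetD[OF Asub IntD1[OF uv(1)]]] gi[OF subsetD[OF Asub IntD1[OF uv(2)]]] by simp
      finally have "\<bar>\<integral>\<omega>. g \<omega> * (a * u \<omega> + b * v \<omega>) \<partial>M\<bar> \<le> \<bar>a * (\<integral>\<omega>. g \<omega> * u \<omega> \<partial>M)\<bar> + \<bar>b * (\<integral>\<omega>. g \<omega> * v \<omega> \<partial>M)\<bar>"
        using abs_triangle_ineq by simp
      also have "\<dots> = a * \<bar>\<integral>\<omega>. g \<omega> * u \<omega> \<partial>M\<bar> + b * \<bar>\<integral>\<omega>. g \<omega> * v \<omega> \<partial>M\<bar>" using ab by (simp add: abs_mult)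
      also have "\<dots> \<le> a * 1 + b * 1" using uv ab unfolding slab_def by (intro add_mono mult_left_mono) auto
      finally show "(\<lambda>\<omega>. a * u \<omega> + b * v \<omega>) \<in> A \<inter> slab g" using m Asub ab unfolding slab_def by auto
    next
      fix r :: real and u :: "nat \<Rightarrow> 'a \<Rightarrow> real" and v
      assume "0 < r \<and> (\<forall>n. u n \<in> A \<inter> slab g \<and> u n \<in> dual.ball r) \<and> v \<in> borel_measurable M \<and> (AE \<omega> in M. (\<lambda>n. u n \<omega>) \<longlonglongrightarrow> v \<omega>)"
      then have r: "0 < r" and u: "\<And>n. u n \<in> A" "\<And>n. u n \<in> slab g" "\<And>n. u n \<in> dual.ball r" and v: "v \<in> borel_measurable M"
        and lim: "AE \<omega> in M. (\<lambda>n. u n \<omega>) \<longlonglongrightarrow> v \<omega>" by auto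
      have vA: "v \<in> A" by (rule Acl[OF r u(1,3) v lim])
      have "(\<lambda>n. \<bar>\<integral>\<omega>. g \<omega> * u n \<omega> \<partial>M\<bar>) \<longlonglongrightarrow> \<bar>\<integral>\<omega>. g \<omega> * v \<omega> \<partial>M\<bar>"
        by (intro tendsto_rabs dual.bounded_pairing_tendsto[OF u(3) r v lim gm gb])
      then have "\<bar>\<integral>\<omega>. g \<omega> * v \<omega> \<partial>M\<bar> \<le> 1" by (rule LIMSEQ_le_const2) (use u(2) in \<open>auto simp: slab_def\<close>)
      then show "v \<in> A \<inter> slab g" using vA Asub unfolding slab_def by auto
    qed
    then show ?thesis using g(1) by blast
  qed
  have start: "inv 0 L'"
    unfolding inv_def
  proof (intro conjI ballI allI impI)
    show "C \<inter> L' \<inter> dual.ball (\<rho> 0) = {}" using r0 unfolding \<rho>_def by auto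
    show "(\<lambda>\<omega>. a * u \<omega> + b * v \<omega>) \<in> L'" if "u \<in> L'" "v \<in> L'" for u v a b
      using that by (intro dual.space_add dual.space_scale)
    show "v \<in> L'" if "0 < r \<and> (\<forall>n::nat. u n \<in> L' \<and> u n \<in> dual.ball r) \<and> v \<in> borel_measurable M \<and> (AE \<omega> in M. (\<lambda>n. u n \<omega>) \<longlonglongrightarrow> v \<omega>)" for r u v
      using dual.ball_closed[of u r v] that dual.space_iff by blast
  qed simp
  have "\<exists>A. \<forall>n. (inv n (A n) \<and> (n = 0 \<longrightarrow> A n = L')) \<and> (\<exists>g. good n g \<and> A (Suc n) = A n \<inter> slab g)"
  proof (rule dependent_nat_choice)
    show "\<exists>A. inv 0 A \<and> (0 = (0::nat) \<longrightarrow> A = L')" using start by blast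
    show "\<exists>A'. (inv (Suc n) A' \<and> (Suc n = 0 \<longrightarrow> A' = L')) \<and> (\<exists>g. good n g \<and> A' = A \<inter> slab g)"
      if "inv n A \<and> (n = 0 \<longrightarrow> A = L')" for n A
      using step[of n A] that by auto
  qed
  then obtain A g where A: "\<And>n. inv n (A n)" "A 0 = L'" and g: "\<And>n. good n (g n)"
    and Ag: "\<And>n. A (Suc n) = A n \<inter> slab (g n)" by metis
  have gm [measurable]: "g n \<in> borel_measurable M" for n using g unfolding good_def by auto
  have gB: "\<xi> \<in> dual.ball (\<rho> n) \<Longrightarrow> \<bar>\<integral>\<omega>. g n \<omega> * \<xi> \<omega> \<partial>M\<bar> \<le> 1" for n \<xi> using g unfolding good_def by blast
  have gi: "integrable M (\<lambda>\<omega>. g n \<omega> * \<xi> \<omega>)" if "\<xi> \<in> L'" for n \<xi>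
    using integrable_pairing[OF bounded_space[OF gm] that] g[of n] unfolding good_def by blast
  \<comment> \<open>A point in all slabs lies in every \<open>A n\<close>, and also in the ball of
    radius \<open>\<rho> n\<close> for large \<open>n\<close>, where \<open>C \<inter> A n\<close>
    has no points.\<close>
  have escape: "\<exists>k. 1 < \<bar>\<integral>\<omega>. g k \<omega> * \<xi> \<omega> \<partial>M\<bar>" if \<xi>: "\<xi> \<in> C" for \<xi>
  proof (rule ccontr)
    assume no: "\<nexists>k. 1 < \<bar>\<integral>\<omega>. g k \<omega> * \<xi> \<omega> \<partial>M\<bar>"
    obtain s where s: "0 < s" "\<xi> \<in> dual.ball s" using \<xi> sub dual.space_iff by blast
    have slabs: "\<xi> \<in> slab (g k)" for k using no \<xi> sub unfolding slab_def by (auto simp: not_less)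
    have "\<xi> \<in> A n" for n
      by (induction n) (use A(2) Ag slabs \<xi> sub in auto)
    moreover obtain n :: nat where "s / r0 < 2 ^ n" using real_arch_pow[of 2 "s / r0"] by auto
    then have "s \<le> \<rho> n" unfolding \<rho>_def using r0 by (simp add: divide_less_eq mult.commute)
    then have "\<xi> \<in> dual.ball (\<rho> n)" using dual.ball_mono[OF s(1)] s(2) by blast
    ultimately show False using \<xi> A(1)[of n] unfolding inv_def by blast
  qed
  \<comment> \<open>Being bounded by 1 on the ball of radius \<open>r0 * 2^k\<close>, the
    \<open>k\<close>-th functional has norm at most \<open>2^-k / r0\<close>. So \<open>T\<close>
    maps into the square summable sequences, and \<open>escape\<close> keeps the image of
    \<open>C\<close> outside the open unit ball.\<close>
  define T where "T \<xi> k = (\<integral>\<omega>. g k \<omega> * \<xi> \<omega> \<partial>M)" for \<xi> k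
  have T_le: "\<bar>T \<xi> k\<bar> \<le> s / r0 * (1/2) ^ k" "(\<integral>\<omega>. \<bar>g k \<omega> * \<xi> \<omega>\<bar> \<partial>M) \<le> s / r0 * (1/2) ^ k"
    if "0 < s" "\<xi> \<in> dual.ball s" for s \<xi> k
  proof -
    have "s / \<rho> k = s / r0 * (1/2) ^ k" unfolding \<rho>_def by (simp add: power_one_over)
    then show "\<bar>T \<xi> k\<bar> \<le> s / r0 * (1/2) ^ k" "(\<integral>\<omega>. \<bar>g k \<omega> * \<xi> \<omega>\<bar> \<partial>M) \<le> s / r0 * (1/2) ^ k"
      using ball_pairing_scale[where g = "g k" and \<rho> = "\<rho> k", OF gB \<rho> that]
        ball_pairing_abs[where g = "g k" and \<rho> = "\<rho> k", OF gB \<rho> that gm] unfolding T_def by simp_all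
  qed
  have T_sq: "summable (\<lambda>k. (T \<xi> k)\<^sup>2)" if \<xi>L: "\<xi> \<in> L'" for \<xi>
  proof -
    obtain s where s: "0 < s" "\<xi> \<in> dual.ball s" using \<xi>L dual.space_iff by blast
    show ?thesis
    proof (rule summable_comparison_test)
      show "summable (\<lambda>k. (s / r0)\<^sup>2 * (1/4) ^ k)" by (intro summable_mult summable_geometric) simp
      have "(T \<xi> k)\<^sup>2 \<le> (s / r0)\<^sup>2 * (1/4) ^ k" for k
      proof -
        have "\<bar>T \<xi> k\<bar>\<^sup>2 \<le> (s / r0 * (1/2) ^ k)\<^sup>2" using T_le(1)[OF s] by (intro power_mono) auto
        also have "((1/2::real) ^ k)\<^sup>2 = (1/4) ^ k" by (simp add: power2_eq_square power_mult_distrib[symmetric])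
        then have "(s / r0 * (1/2) ^ k)\<^sup>2 = (s / r0)\<^sup>2 * (1/4) ^ k" by (simp only: power_mult_distrib)
        finally show ?thesis by simp
      qed
      then show "\<exists>N. \<forall>k\<ge>N. norm ((T \<xi> k)\<^sup>2) \<le> (s / r0)\<^sup>2 * (1/4) ^ k" by auto
    qed
  qed
  have "\<exists>y. summable (\<lambda>k. (y k)\<^sup>2) \<and> (\<forall>x\<in>T ` C. 1 \<le> (\<Sum>k. y k * x k))"
  proof (rule l2_separation)
    show "T ` C \<noteq> {}" using ne by simp
    show "summable (\<lambda>k. (x k)\<^sup>2)" if "x \<in> T ` C" for x using that T_sq sub by auto
    show "(\<lambda>k. a * x k + b * y k) \<in> T ` C" if xy: "x \<in> T ` C" "y \<in> T ` C" and ab: "0 \<le> a" "0 \<le> b" "a + b = 1" for x y a b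
    proof -
      obtain u v where uv: "u \<in> C" "x = T u" "v \<in> C" "y = T v" using xy by auto
      have "T (\<lambda>\<omega>. a * u \<omega> + b * v \<omega>) k = a * T u k + b * T v k" for k
      proof -
        have "T (\<lambda>\<omega>. a * u \<omega> + b * v \<omega>) k = (\<integral>\<omega>. a * (g k \<omega> * u \<omega>) + b * (g k \<omega> * v \<omega>) \<partial>M)"
          unfolding T_def by (intro Bochner_Integration.integral_cong) (auto simp: algebra_simps)
        also have "\<dots> = a * T u k + b * T v k" unfolding T_def using gi[OF subsetD[OF sub uv(1)], of k] gi[OF subsetD[OF sub uv(3)], of k] by simp
        finally show ?thesis .
      qed
      then have "(\<lambda>k. a * x k + b * y k) = T (\<lambda>\<omega>. a * u \<omega> + b * v \<omega>)" using uv by auto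
      then show ?thesis using convex[OF uv(1,3) ab] by blast
    qed
    show "1 \<le> (\<Sum>k. (x k)\<^sup>2)" if x: "x \<in> T ` C" for x
    proof -
      obtain \<xi> where \<xi>: "\<xi> \<in> C" "x = T \<xi>" using x by auto
      obtain k where k: "1 < \<bar>x k\<bar>" using escape[OF \<xi>(1)] \<xi>(2) unfolding T_def by auto
      have "1\<^sup>2 \<le> \<bar>x k\<bar>\<^sup>2" using k by (intro power_mono) auto
      also have "\<dots> = (\<Sum>i\<in>{k}. (x i)\<^sup>2)" by simp
      also have "\<dots> \<le> (\<Sum>i. (x i)\<^sup>2)" using T_sq[of \<xi>] \<xi> sub by (intro sum_le_suminf) auto
      finally show ?thesis by simp
    qed
  qed
  then obtain y where ys: "summable (\<lambda>k. (y k)\<^sup>2)" and y: "\<And>\<xi>. \<xi> \<in> C \<Longrightarrow> 1 \<le> (\<Sum>k. y k * T \<xi> k)" by auto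
  \<comment> \<open>A crude bound for all coefficients: as the functionals decay geometrically,
    bounded coefficients already give absolute convergence.\<close>
  define Y where "Y = 1 + (\<Sum>k. (y k)\<^sup>2)"
  have Y1: "1 \<le> Y" unfolding Y_def using suminf_nonneg[OF ys] by simp
  have Y: "\<bar>y k\<bar> \<le> Y" for k
  proof -
    have "\<bar>y k\<bar> \<le> 1 + (y k)\<^sup>2"
    proof (cases "\<bar>y k\<bar> \<le> 1")
      case True
      then show ?thesis using zero_le_power2[of "y k"] by linarith
    next
      case False
      then have "\<bar>y k\<bar> * 1 \<le> \<bar>y k\<bar> * \<bar>y k\<bar>" by (intro mult_left_mono) auto
      then show ?thesis by (simp add: power2_eq_square)
    qed
    also have "(y k)\<^sup>2 = (\<Sum>i\<in>{k}. (y i)\<^sup>2)" by simp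
    also have "\<dots> \<le> (\<Sum>i. (y i)\<^sup>2)" by (rule sum_le_suminf[OF ys]) auto
    finally show ?thesis unfolding Y_def by simp
  qed
  \<comment> \<open>Where the series diverges, the value is unspecified but the function stays
    measurable. Absolute convergence a.e. follows from \<open>series\<close> tested with the
    constant function 1.\<close>
  define \<eta> where "\<eta> \<omega> = (\<Sum>k. y k * g k \<omega>)" for \<omega>
  have \<eta>m [measurable]: "\<eta> \<in> borel_measurable M" unfolding \<eta>_def by measurable
  have series: "(AE \<omega> in M. summable (\<lambda>k. \<bar>y k * g k \<omega> * \<xi> \<omega>\<bar>))
      \<and> summable (\<lambda>k. \<integral>\<omega>. \<bar>y k * g k \<omega> * \<xi> \<omega>\<bar> \<partial>M) \<and> (\<Sum>k. \<integral>\<omega>. \<bar>y k * g k \<omega> * \<xi> \<omega>\<bar> \<partial>M) \<le> 2 * Y * (s / r0)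
      \<and> (\<forall>k. integrable M (\<lambda>\<omega>. y k * g k \<omega> * \<xi> \<omega>))"
    if s: "0 < s" and \<xi>: "\<xi> \<in> dual.ball s" for s \<xi>
  proof -
    have \<xi>L: "\<xi> \<in> L'" using s \<xi> dual.space_iff by blast
    have [measurable]: "\<xi> \<in> borel_measurable M" using \<xi> dual.ball_meas by blast
    have i: "integrable M (\<lambda>\<omega>. y k * g k \<omega> * \<xi> \<omega>)" for k using gi[OF \<xi>L, of k] by (simp add: mult.assoc)
    have le: "(\<integral>\<omega>. \<bar>y k * g k \<omega> * \<xi> \<omega>\<bar> \<partial>M) \<le> Y * (s / r0) * (1/2) ^ k" for k
    proof -
      have "(\<integral>\<omega>. \<bar>y k * g k \<omega> * \<xi> \<omega>\<bar> \<partial>M) = \<bar>y k\<bar> * (\<integral>\<omega>. \<bar>g k \<omega> * \<xi> \<omega>\<bar> \<partial>M)" by (simp add: abs_mult mult.assoc)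
      also have "\<dots> \<le> Y * (s / r0 * (1/2) ^ k)" using T_le(2)[OF s \<xi>] Y Y1 by (intro mult_mono) (auto intro!: integral_nonneg_AE)
      finally show ?thesis by (simp add: mult.assoc)
    qed
    have geo: "summable (\<lambda>k. Y * (s / r0) * (1/2) ^ k)" by (intro summable_mult summable_geometric) simp
    have sm: "summable (\<lambda>k. \<integral>\<omega>. \<bar>y k * g k \<omega> * \<xi> \<omega>\<bar> \<partial>M)"
      by (rule summable_comparison_test[OF _ geo]) (use le in \<open>auto intro!: exI[of _ 0] simp: integral_nonneg_AE\<close>)
    have "(\<Sum>k. \<integral>\<omega>. \<bar>y k * g k \<omega> * \<xi> \<omega>\<bar> \<partial>M) \<le> (\<Sum>k. Y * (s / r0) * (1/2) ^ k)" by (rule suminf_le[OF le sm geo])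
    also have "\<dots> = Y * (s / r0) * (\<Sum>k. (1/2) ^ k)" by (intro suminf_mult summable_geometric) simp
    also have "\<dots> = 2 * Y * (s / r0)" by (subst suminf_geometric) auto
    finally have bd: "(\<Sum>k. \<integral>\<omega>. \<bar>y k * g k \<omega> * \<xi> \<omega>\<bar> \<partial>M) \<le> 2 * Y * (s / r0)" .
    have "AE \<omega> in M. summable (\<lambda>k. \<bar>y k * g k \<omega> * \<xi> \<omega>\<bar>)"
      by (rule AE_summable_of_integrals[OF _ i le geo]) measurable
    then show ?thesis using i sm bd by blast
  qed
  have pairing: "(\<integral>\<omega>. \<eta> \<omega> * \<xi> \<omega> \<partial>M) = (\<Sum>k. y k * T \<xi> k) \<and> integrable M (\<lambda>\<omega>. \<eta> \<omega> * \<xi> \<omega>)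
      \<and> (\<integral>\<omega>. \<bar>\<eta> \<omega> * \<xi> \<omega>\<bar> \<partial>M) \<le> 2 * Y * (s / r0)" if s: "0 < s" and \<xi>: "\<xi> \<in> dual.ball s" for s \<xi>
  proof -
    obtain s1 where s1: "0 < s1" "(\<lambda>_. 1) \<in> dual.ball s1" using dual.const_space dual.space_iff by blast
    have [measurable]: "\<xi> \<in> borel_measurable M" using \<xi> dual.ball_meas by blast
    have se: "AE \<omega> in M. summable (\<lambda>k. \<bar>y k * g k \<omega> * \<xi> \<omega>\<bar>)" "summable (\<lambda>k. \<integral>\<omega>. \<bar>y k * g k \<omega> * \<xi> \<omega>\<bar> \<partial>M)"
      "(\<Sum>k. \<integral>\<omega>. \<bar>y k * g k \<omega> * \<xi> \<omega>\<bar> \<partial>M) \<le> 2 * Y * (s / r0)" "\<And>k. integrable M (\<lambda>\<omega>. y k * g k \<omega> * \<xi> \<omega>)"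
      using series[OF s \<xi>] by auto
    have "AE \<omega> in M. summable (\<lambda>k. \<bar>y k * g k \<omega>\<bar>)" using series[OF s1] by simp
    then have eq: "AE \<omega> in M. \<eta> \<omega> * \<xi> \<omega> = (\<Sum>k. y k * g k \<omega> * \<xi> \<omega>)"
    proof eventually_elim
      case (elim \<omega>)
      then have "summable (\<lambda>k. y k * g k \<omega>)" by (rule summable_rabs_cancel)
      then show ?case unfolding \<eta>_def by (rule suminf_mult2)
    qed
    have i: "integrable M (\<lambda>\<omega>. \<Sum>k. y k * g k \<omega> * \<xi> \<omega>)"
      by (rule integrable_suminf) (use se in auto)
    have "(\<integral>\<omega>. \<eta> \<omega> * \<xi> \<omega> \<partial>M) = (\<integral>\<omega>. (\<Sum>k. y k * g k \<omega> * \<xi> \<omega>) \<partial>M)"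
      by (rule integral_cong_AE) (use eq in auto)
    also have "\<dots> = (\<Sum>k. \<integral>\<omega>. y k * g k \<omega> * \<xi> \<omega> \<partial>M)" by (rule integral_suminf) (use se in auto)
    finally have 1: "(\<integral>\<omega>. \<eta> \<omega> * \<xi> \<omega> \<partial>M) = (\<Sum>k. y k * T \<xi> k)" unfolding T_def by (simp add: mult.assoc)
    have 2: "integrable M (\<lambda>\<omega>. \<eta> \<omega> * \<xi> \<omega>)"
      by (rule integrable_cong_AE_imp[OF i]) (use eq in \<open>auto elim: eventually_mono\<close>)
    have i2: "integrable M (\<lambda>\<omega>. \<Sum>k. \<bar>y k * g k \<omega> * \<xi> \<omega>\<bar>)"
      by (rule integrable_suminf) (use se in auto)
    have "(\<integral>\<omega>. \<bar>\<eta> \<omega> * \<xi> \<omega>\<bar> \<partial>M) \<le> (\<integral>\<omega>. (\<Sum>k. \<bar>y k * g k \<omega> * \<xi> \<omega>\<bar>) \<partial>M)"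
    proof (rule integral_mono_AE[OF _ i2])
      show "AE \<omega> in M. \<bar>\<eta> \<omega> * \<xi> \<omega>\<bar> \<le> (\<Sum>k. \<bar>y k * g k \<omega> * \<xi> \<omega>\<bar>)" using eq se(1)
        by eventually_elim (use summable_rabs in auto)
    qed (use 2 in auto)
    also have "\<dots> = (\<Sum>k. \<integral>\<omega>. \<bar>y k * g k \<omega> * \<xi> \<omega>\<bar> \<partial>M)" by (rule integral_suminf) (use se in auto)
    also have "\<dots> \<le> 2 * Y * (s / r0)" by (rule se(3))
    finally show ?thesis using 1 2 by blast
  qed
  \<comment> \<open>For nonnegative \<open>\<xi>\<close> the integral of
    \<open>\<bar>\<eta>\<bar> * \<xi>\<close> is the absolute integral bounded in
    \<open>pairing\<close>, where \<open>s = 1\<close> gives the constant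
    \<open>2 Y / r0\<close>.\<close>
  have "(\<lambda>\<omega>. \<bar>\<eta> \<omega>\<bar>) \<in> L"
  proof (rule bounded_functional_in_space)
    show "0 < 2 * Y * (1 / r0)" using Y1 r0 by simp
    show "integrable M (\<lambda>\<omega>. \<bar>\<eta> \<omega>\<bar> * \<xi> \<omega>) \<and> (\<integral>\<omega>. \<bar>\<eta> \<omega>\<bar> * \<xi> \<omega> \<partial>M) \<le> 2 * Y * (1 / r0)"
      if \<xi>: "\<xi> \<in> dual.ball 1" "\<And>\<omega>. 0 \<le> \<xi> \<omega>" for \<xi>
    proof -
      have "\<bar>\<eta> \<omega>\<bar> * \<xi> \<omega> = \<bar>\<eta> \<omega> * \<xi> \<omega>\<bar>" for \<omega> using \<xi>(2)[of \<omega>] by (simp add: abs_mult)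
      then show ?thesis using pairing[OF _ \<xi>(1)] by simp
    qed
  qed auto
  then have \<eta>L: "\<eta> \<in> L" by (rule space_dominated) auto
  moreover have "1 \<le> (\<integral>\<omega>. \<eta> \<omega> * \<xi> \<omega> \<partial>M)" if \<xi>: "\<xi> \<in> C" for \<xi>
  proof -
    obtain s where "0 < s" "\<xi> \<in> dual.ball s" using \<xi> sub dual.space_iff by blast
    then show ?thesis using pairing y[OF \<xi>] by simp
  qed
  ultimately show ?thesis by blast
qed

end

section \<open>Weakly compact sets and order bounded sequences\<close>

text \<open>If every point of \<open>K\<close> had a neighbourhood that the sequence eventually
  avoids, finitely many of them would cover \<open>K\<close>. The weak topology need not be
  metrisable, so a cluster point takes the place of a convergent subsequence.\<close>

lemma compactin_cluster_point:
  fixes x :: "nat \<Rightarrow> 'b"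
  assumes K: "compactin X K" and x: "\<And>n. x n \<in> K"
  shows "\<exists>p\<in>K. \<forall>U. openin X U \<and> p \<in> U \<longrightarrow> (\<exists>\<^sub>F n in sequentially. x n \<in> U)"
proof (rule ccontr)
  assume "\<not> ?thesis"
  then have "\<forall>p\<in>K. \<exists>U. openin X U \<and> p \<in> U \<and> (\<forall>\<^sub>F n in sequentially. x n \<notin> U)" by (auto simp: frequently_def)
  then obtain U where U: "\<And>p. p \<in> K \<Longrightarrow> openin X (U p)" "\<And>p. p \<in> K \<Longrightarrow> p \<in> U p"
    "\<And>p. p \<in> K \<Longrightarrow> \<forall>\<^sub>F n in sequentially. x n \<notin> U p" by metis
  have "\<exists>\<F>. finite \<F> \<and> \<F> \<subseteq> U ` K \<and> K \<subseteq> \<Union>\<F>"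
    by (rule compactinD[OF K]) (use U(1,2) in auto)
  then obtain \<F> where F: "finite \<F>" "\<F> \<subseteq> U ` K" "K \<subseteq> \<Union>\<F>" by blast
  have "\<forall>\<^sub>F n in sequentially. \<forall>V\<in>\<F>. x n \<notin> V"
    using F U(3) by (intro eventually_ball_finite) auto
  then obtain n where "\<forall>V\<in>\<F>. x n \<notin> V" using eventually_happens' sequentially_bot by blast
  then show False using F(3) x[of n] by blast
qed

lemma eventually_in_generated:
  assumes gen: "generate_topology_on S U" and x: "p \<in> U"
    and ev: "\<And>B. B \<in> S \<Longrightarrow> p \<in> B \<Longrightarrow> \<forall>\<^sub>F n in F. x n \<in> B"
  shows "\<forall>\<^sub>F n in F. x n \<in> U"
  using gen x
proof induction
  case (Int a b)
  then have "\<forall>\<^sub>F n in F. x n \<in> a" "\<forall>\<^sub>F n in F. x n \<in> b" by auto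
  then show ?case by eventually_elim auto
next
  case (UN K)
  then obtain k where "k \<in> K" "p \<in> k" by auto
  with UN have "\<forall>\<^sub>F n in F. x n \<in> k" by auto
  then show ?case by eventually_elim (use \<open>k \<in> K\<close> in auto)
qed (use ev in auto)

lemma limitin_generated:
  assumes "p \<in> \<Union>S" and "\<And>B. B \<in> S \<Longrightarrow> p \<in> B \<Longrightarrow> \<forall>\<^sub>F n in F. x n \<in> B"
  shows "limitin (topology_generated_by S) x p F"
  unfolding limitin_def using assms eventually_in_generated[where S = S and p = p and F = F and x = x]
  by (auto simp: openin_topology_generated_by_iff)

lemma weak_open:
  assumes "\<eta> \<in> F" "open U"
  shows "openin (weak_topology M E F) {\<xi> \<in> E. pairing M \<eta> \<xi> \<in> U}"
  unfolding weak_topology_def by (rule topology_generated_by_Basis) (use assms in blast)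

lemma weak_neighbourhood:
  assumes "openin (weak_topology M E F) U" and "\<xi>\<^sub>0 \<in> U"
  shows "\<exists>A e. finite A \<and> A \<subseteq> F \<and> 0 < e \<and> {\<xi> \<in> E. \<forall>\<eta>\<in>A. \<bar>pairing M \<eta> \<xi> - pairing M \<eta> \<xi>\<^sub>0\<bar> < e} \<subseteq> U"
  using assms unfolding weak_topology_def openin_topology_generated_by_iff
proof (induction)
  case (Int a b)
  then obtain A e B d where A: "finite A" "A \<subseteq> F" "0 < e" "{\<xi> \<in> E. \<forall>\<eta>\<in>A. \<bar>pairing M \<eta> \<xi> - pairing M \<eta> \<xi>\<^sub>0\<bar> < e} \<subseteq> a"
    and B: "finite B" "B \<subseteq> F" "0 < d" "{\<xi> \<in> E. \<forall>\<eta>\<in>B. \<bar>pairing M \<eta> \<xi> - pairing M \<eta> \<xi>\<^sub>0\<bar> < d} \<subseteq> b" by blast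
  then show ?case by (intro exI[of _ "A \<union> B"] exI[of _ "min e d"]) auto
next
  case (UN K)
  then obtain k where "k \<in> K" "\<xi>\<^sub>0 \<in> k" by auto
  then show ?case using UN(2)[of k] by (meson Union_upper order_trans)
next
  case (Basis s)
  then obtain \<eta> V where *: "\<eta> \<in> F" "open V" "s = {\<xi> \<in> E. pairing M \<eta> \<xi> \<in> V}" by auto
  then have "pairing M \<eta> \<xi>\<^sub>0 \<in> V" using Basis by auto
  then obtain e where e: "0 < e" "\<And>y. dist y (pairing M \<eta> \<xi>\<^sub>0) < e \<Longrightarrow> y \<in> V" using *(2) unfolding open_dist by blast
  then show ?case using * by (intro exI[of _ "{\<eta>}"] exI[of _ e]) (auto simp: dist_real_def)
qed auto

lemma pairing_commute: "pairing M \<eta> \<xi> = pairing M \<xi> \<eta>"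
  unfolding pairing_def by (simp add: mult.commute)

lemma pairing_scale: "pairing M (\<lambda>\<omega>. a * \<eta> \<omega>) \<xi> = a * pairing M \<eta> \<xi>"
  unfolding pairing_def by (simp add: mult.assoc)

section \<open>The pairing, and uniform convergence on weakly compact sets\<close>

context orlicz_dual
begin

lemma pairing_diff:
  "\<eta> \<in> L \<Longrightarrow> \<xi> \<in> L' \<Longrightarrow> \<zeta> \<in> L' \<Longrightarrow> pairing M \<eta> (\<lambda>\<omega>. \<xi> \<omega> - \<zeta> \<omega>) = pairing M \<eta> \<xi> - pairing M \<eta> \<zeta>"
  unfolding pairing_def using integrable_pairing[of \<eta> \<xi>] integrable_pairing[of \<eta> \<zeta>] by (simp add: right_diff_distrib)

lemma pairing_combine:
  "\<eta> \<in> L \<Longrightarrow> \<xi> \<in> L' \<Longrightarrow> \<zeta> \<in> L' \<Longrightarrow> pairing M \<eta> (\<lambda>\<omega>. a * \<xi> \<omega> + b * \<zeta> \<omega>) = a * pairing M \<eta> \<xi> + b * pairing M \<eta> \<zeta>"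
proof -
  assume *: "\<eta> \<in> L" "\<xi> \<in> L'" "\<zeta> \<in> L'"
  have "pairing M \<eta> (\<lambda>\<omega>. a * \<xi> \<omega> + b * \<zeta> \<omega>) = (\<integral>\<omega>. a * (\<eta> \<omega> * \<xi> \<omega>) + b * (\<eta> \<omega> * \<zeta> \<omega>) \<partial>M)"
    unfolding pairing_def by (intro Bochner_Integration.integral_cong) (auto simp: algebra_simps)
  then show ?thesis unfolding pairing_def using integrable_pairing[OF *(1,2)] integrable_pairing[OF *(1,3)] by simp
qed

lemma pairing_combine_left:
  "\<eta> \<in> L \<Longrightarrow> \<theta> \<in> L \<Longrightarrow> \<xi> \<in> L' \<Longrightarrow> pairing M (\<lambda>\<omega>. a * \<eta> \<omega> + b * \<theta> \<omega>) \<xi> = a * pairing M \<eta> \<xi> + b * pairing M \<theta> \<xi>"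
proof -
  assume *: "\<eta> \<in> L" "\<theta> \<in> L" "\<xi> \<in> L'"
  have "pairing M (\<lambda>\<omega>. a * \<eta> \<omega> + b * \<theta> \<omega>) \<xi> = (\<integral>\<omega>. a * (\<eta> \<omega> * \<xi> \<omega>) + b * (\<theta> \<omega> * \<xi> \<omega>) \<partial>M)"
    unfolding pairing_def by (intro Bochner_Integration.integral_cong) (auto simp: algebra_simps)
  then show ?thesis unfolding pairing_def using integrable_pairing[OF *(1,3)] integrable_pairing[OF *(2,3)] by simp
qed

lemma pairing_dominated:
  assumes \<eta>: "\<eta> \<in> L" and h: "h \<in> L'" and [measurable]: "\<And>n. x n \<in> borel_measurable M" "y \<in> borel_measurable M"
    and le: "\<And>n. AE \<omega> in M. \<bar>x n \<omega>\<bar> \<le> h \<omega>" and lim: "AE \<omega> in M. (\<lambda>n. x n \<omega>) \<longlonglongrightarrow> y \<omega>"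
  shows "(\<lambda>n. pairing M \<eta> (x n)) \<longlonglongrightarrow> pairing M \<eta> y"
  unfolding pairing_def
proof (rule integral_dominated_convergence[where w = "\<lambda>\<omega>. \<bar>\<eta> \<omega> * h \<omega>\<bar>"])
  have [measurable]: "\<eta> \<in> borel_measurable M" using \<eta> by (rule space_meas)
  show "(\<lambda>\<omega>. \<eta> \<omega> * y \<omega>) \<in> borel_measurable M" "(\<lambda>\<omega>. \<eta> \<omega> * x n \<omega>) \<in> borel_measurable M" for n by measurable
  show "integrable M (\<lambda>\<omega>. \<bar>\<eta> \<omega> * h \<omega>\<bar>)" using integrable_pairing[OF \<eta> h] by (rule integrable_abs)
  show "AE \<omega> in M. (\<lambda>n. \<eta> \<omega> * x n \<omega>) \<longlonglongrightarrow> \<eta> \<omega> * y \<omega>" using lim by eventually_elim (rule tendsto_mult_left)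
  show "AE \<omega> in M. norm (\<eta> \<omega> * x n \<omega>) \<le> \<bar>\<eta> \<omega> * h \<omega>\<bar>" for n using le[of n]
    by eventually_elim (auto simp: abs_mult intro!: mult_left_mono)
qed

text \<open>Gliding hump. The \<open>n\<close>-th functional of the subsequence sees the \<open>n\<close>-th increment of \<open>G\<close> and, up to
  small errors, neither the past nor the future of \<open>G\<close>; the update of \<open>G\<close> is a pointwise convex
  combination, so \<open>G\<close> stays in the order interval.\<close>

lemma compact_functional_gap:
  assumes K: "compactin (weak_topology M L L') K" and h: "h \<in> L'"
    and zm: "\<And>n::nat. z n \<in> borel_measurable M" and zh: "\<And>n. AE \<omega> in M. \<bar>z n \<omega>\<bar> \<le> h \<omega>"
    and zlim: "AE \<omega> in M. (\<lambda>n. z n \<omega>) \<longlonglongrightarrow> 0" and e: "0 < e" and \<eta>K: "\<And>n. \<eta> n \<in> K"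
  shows "\<exists>n. \<bar>pairing M (\<eta> n) (z n)\<bar> < e"
proof (rule ccontr)
  assume "\<nexists>n. \<bar>pairing M (\<eta> n) (z n)\<bar> < e"
  then have big: "e \<le> \<bar>pairing M (\<eta> n) (z n)\<bar>" for n by (simp add: not_less)
  have KL: "K \<subseteq> L"
    using compactin_subset_topspace[OF K] unfolding weak_topology_def by auto
  then have \<eta>L: "\<eta> n \<in> L" for n using \<eta>K by auto
  have [measurable]: "z n \<in> borel_measurable M" "h \<in> borel_measurable M" for n using zm dual.space_meas[OF h] by auto
  have abs_L: "(\<lambda>\<omega>. \<bar>\<theta> \<omega>\<bar>) \<in> L" if "\<theta> \<in> L" for \<theta> using space_meas[OF that] by (intro space_dominated[OF that]) auto
  have abs_L': "(\<lambda>\<omega>. \<bar>\<theta> \<omega>\<bar>) \<in> L'" if "\<theta> \<in> L'" for \<theta> using dual.space_meas[OF that] by (intro dual.space_dominated[OF that]) auto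
  have dom: "g \<in> L'" if "g \<in> borel_measurable M" "AE \<omega> in M. \<bar>g \<omega>\<bar> \<le> h \<omega>" for g
  proof (rule dual.space_dominated[OF h that(1)])
    show "AE \<omega> in M. \<bar>g \<omega>\<bar> \<le> \<bar>h \<omega>\<bar>" using that(2) by eventually_elim simp
  qed
  have zL: "z n \<in> L'" for n using dom[OF zm zh] .
  obtain p where p: "p \<in> K" "\<And>U. openin (weak_topology M L L') U \<Longrightarrow> p \<in> U \<Longrightarrow> \<exists>\<^sub>F n in sequentially. \<eta> n \<in> U"
  proof -
    from compactin_cluster_point[where x = \<eta>, OF K \<eta>K] show ?thesis using that by (elim bexE) metis
  qed
  have pL: "p \<in> L" using p KL by auto
  \<comment> \<open>Functionals recentred at the cluster point \<open>p\<close>: infinitely many of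
    them are small on any given finite set.\<close>
  define a where "a n g = pairing M (\<eta> n) g - pairing M p g" for n g
  have a_abs: "\<bar>a n g\<bar> \<le> pairing M (\<lambda>\<omega>. \<bar>\<eta> n \<omega>\<bar>) (\<lambda>\<omega>. \<bar>g \<omega>\<bar>) + pairing M (\<lambda>\<omega>. \<bar>p \<omega>\<bar>) (\<lambda>\<omega>. \<bar>g \<omega>\<bar>)" for n g
    unfolding a_def pairing_def abs_mult[symmetric]
    using integral_abs_bound[of M "\<lambda>\<omega>. \<eta> n \<omega> * g \<omega>"] integral_abs_bound[of M "\<lambda>\<omega>. p \<omega> * g \<omega>"] by linarith
  have a_diff: "a n (\<lambda>\<omega>. u \<omega> - v \<omega>) = a n u - a n v" if "u \<in> L'" "v \<in> L'" for n u v
    unfolding a_def using pairing_diff[OF \<eta>L that] pairing_diff[OF pL that] by simp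
  have z0: "(\<lambda>n. pairing M (\<lambda>\<omega>. \<bar>\<theta> \<omega>\<bar>) (\<lambda>\<omega>. \<bar>z n \<omega>\<bar>)) \<longlonglongrightarrow> 0" if "\<theta> \<in> L" for \<theta>
  proof -
    have "(\<lambda>n. pairing M (\<lambda>\<omega>. \<bar>\<theta> \<omega>\<bar>) (\<lambda>\<omega>. \<bar>z n \<omega>\<bar>)) \<longlonglongrightarrow> pairing M (\<lambda>\<omega>. \<bar>\<theta> \<omega>\<bar>) (\<lambda>_. 0)"
    proof (rule pairing_dominated[OF abs_L[OF that] h])
      show "AE \<omega> in M. \<bar>\<bar>z n \<omega>\<bar>\<bar> \<le> h \<omega>" for n using zh[of n] by simp
      show "AE \<omega> in M. (\<lambda>n. \<bar>z n \<omega>\<bar>) \<longlonglongrightarrow> 0" using zlim by eventually_elim (rule tendsto_rabs_zero)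
    qed measurable
    then show ?thesis by (simp add: pairing_def)
  qed
  \<comment> \<open>As \<open>c\<close> halves at each step, errors \<open>4 * c i\<close> from step
    \<open>j + 1\<close> on sum to at most \<open>8 * c (j + 1)\<close>. With \<open>e / 128\<close>
    the total loss \<open>c j + 8 * c (j + 1)\<close> is below \<open>e / 8\<close>, so that of the
    increment \<open>e / 4\<close> at least \<open>e / 8\<close> remains.\<close>
  define c where "c j = e / 128 * (1/2) ^ j" for j :: nat
  have c: "0 < c j" "c j \<le> e / 128" "c (Suc j) = c j / 2" for j
    unfolding c_def using e by (auto simp: power_le_one mult_le_cancel_left1 intro: mult_left_le)
  \<comment> \<open>\<open>S\<close> collects all values of \<open>G\<close> so far: the next
    functional must be small on each of them, which in the end makes two cluster points agree on all
    of them.\<close>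
  define inv where "inv n G S \<longleftrightarrow> finite S \<and> S \<subseteq> L' \<and> G \<in> S \<and> (AE \<omega> in M. \<bar>G \<omega>\<bar> \<le> h \<omega>)"
    for n :: nat and G :: "'a \<Rightarrow> real" and S
  define nxt where "nxt j n G S n' G' S' \<longleftrightarrow> n < n' \<and> S' = insert G' S \<and> (\<forall>g\<in>S. \<bar>a n' g\<bar> \<le> c j)
    \<and> (\<forall>i\<le>n. pairing M (\<lambda>\<omega>. \<bar>\<eta> i \<omega>\<bar>) (\<lambda>\<omega>. \<bar>z n' \<omega>\<bar>) \<le> c j) \<and> pairing M (\<lambda>\<omega>. \<bar>p \<omega>\<bar>) (\<lambda>\<omega>. \<bar>z n' \<omega>\<bar>) \<le> c j
    \<and> pairing M (\<lambda>\<omega>. \<bar>1\<bar>) (\<lambda>\<omega>. \<bar>z n' \<omega>\<bar>) \<le> c j \<and> (AE \<omega> in M. \<bar>G' \<omega> - G \<omega>\<bar> \<le> 2 * \<bar>z n' \<omega>\<bar>)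
    \<and> e / 4 \<le> \<bar>a n' (\<lambda>\<omega>. G' \<omega> - G \<omega>)\<bar>" for j n n' :: nat and G G' :: "'a \<Rightarrow> real" and S S'
  have step: "\<exists>n' G' S'. inv n' G' S' \<and> nxt j n G S n' G' S'" if I: "inv n G S" for j n G S
  proof -
    have S: "finite S" "S \<subseteq> L'" "G \<in> S" and Gh: "AE \<omega> in M. \<bar>G \<omega>\<bar> \<le> h \<omega>" using I unfolding inv_def by auto
    have [measurable]: "G \<in> borel_measurable M" using S dual.space_meas by blast
    have small: "\<forall>\<^sub>F n' in sequentially. pairing M (\<lambda>\<omega>. \<bar>\<theta> \<omega>\<bar>) (\<lambda>\<omega>. \<bar>z n' \<omega>\<bar>) \<le> c j" if "\<theta> \<in> L" for \<theta>
      using order_tendstoD(2)[OF z0[OF that] c(1)[of j]] by eventually_elim simp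
    have ev1: "\<forall>\<^sub>F n' in sequentially. \<forall>i\<in>{..n}. pairing M (\<lambda>\<omega>. \<bar>\<eta> i \<omega>\<bar>) (\<lambda>\<omega>. \<bar>z n' \<omega>\<bar>) \<le> c j"
      using small \<eta>L by (intro eventually_ball_finite) auto
    have ev: "\<forall>\<^sub>F n' in sequentially. n < n' \<and> (\<forall>i\<in>{..n}. pairing M (\<lambda>\<omega>. \<bar>\<eta> i \<omega>\<bar>) (\<lambda>\<omega>. \<bar>z n' \<omega>\<bar>) \<le> c j)
        \<and> pairing M (\<lambda>\<omega>. \<bar>p \<omega>\<bar>) (\<lambda>\<omega>. \<bar>z n' \<omega>\<bar>) \<le> c j \<and> pairing M (\<lambda>\<omega>. \<bar>1\<bar>) (\<lambda>\<omega>. \<bar>z n' \<omega>\<bar>) \<le> c j"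
      by (intro eventually_conj ev1 eventually_gt_at_top small[OF pL] small[OF const_space])
    let ?U = "topspace (weak_topology M L L') \<inter> (\<Inter>g\<in>S. {\<theta> \<in> L. pairing M g \<theta> \<in> {pairing M p g - c j<..<pairing M p g + c j}})"
    have top: "topspace (weak_topology M L L') = L"
      using dual.const_space[of 0] unfolding weak_topology_def by auto
    have "openin (weak_topology M L L') ?U"
      using S by (intro openin_Int openin_topspace openin_INT2 weak_open) (auto simp: top)
    moreover have "p \<in> ?U" using pL c(1)[of j] by (auto simp: top pairing_commute)
    ultimately have fr: "\<exists>\<^sub>F n' in sequentially. \<eta> n' \<in> ?U" by (rule p(2))
    obtain n' where U: "\<eta> n' \<in> ?U" and n': "n < n'" "\<And>i. i \<le> n \<Longrightarrow> pairing M (\<lambda>\<omega>. \<bar>\<eta> i \<omega>\<bar>) (\<lambda>\<omega>. \<bar>z n' \<omega>\<bar>) \<le> c j"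
        "pairing M (\<lambda>\<omega>. \<bar>p \<omega>\<bar>) (\<lambda>\<omega>. \<bar>z n' \<omega>\<bar>) \<le> c j" "pairing M (\<lambda>\<omega>. \<bar>1\<bar>) (\<lambda>\<omega>. \<bar>z n' \<omega>\<bar>) \<le> c j"
    proof -
      from frequently_eventually_ex[OF fr ev] show ?thesis using that by (elim exE conjE) (simp only: Ball_def atMost_iff)
    qed
    have past: "\<bar>a n' g\<bar> \<le> c j" if "g \<in> S" for g
    proof -
      have "pairing M g (\<eta> n') \<in> {pairing M p g - c j<..<pairing M p g + c j}" using U that by auto
      then show ?thesis unfolding a_def pairing_commute[of M "\<eta> n'" g] by (auto simp: abs_le_iff)
    qed
    \<comment> \<open>The weight with \<open>w * h = \<bar>z n'\<bar>\<close>, so that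
      \<open>(1 - w) * G + z n'\<close> is bounded by
      \<open>(1 - w) * h + \<bar>z n'\<bar> = h\<close>. Where \<open>h = 0\<close>, also
      \<open>z n' = 0\<close> a.e., and division by zero yields the value
      \<open>w = 0\<close>.\<close>
    define w where "w \<omega> = min 1 (\<bar>z n' \<omega>\<bar> / h \<omega>)" for \<omega>
    have [measurable]: "w \<in> borel_measurable M" unfolding w_def by measurable
    have w: "AE \<omega> in M. 0 \<le> w \<omega> \<and> w \<omega> \<le> 1 \<and> w \<omega> * h \<omega> = \<bar>z n' \<omega>\<bar>" using zh[of n']
      by eventually_elim (auto simp: w_def min_def divide_le_eq_1)
    \<comment> \<open>Passing from \<open>G\<close> to \<open>G1\<close> adds \<open>z n'\<close>
      but also removes \<open>w * G\<close>, whose effect on the functional is not controlled.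
      \<open>G0\<close> performs the removal alone; as the two differ by \<open>z n'\<close>, one of
      them moves the functional by at least \<open>e / 4\<close>.\<close>
    define G0 where "G0 \<omega> = (1 - w \<omega>) * G \<omega>" for \<omega>
    define G1 where "G1 \<omega> = (1 - w \<omega>) * G \<omega> + z n' \<omega>" for \<omega>
    have [measurable]: "G0 \<in> borel_measurable M" "G1 \<in> borel_measurable M" unfolding G0_def G1_def by measurable
    have bounds: "AE \<omega> in M. \<bar>G0 \<omega>\<bar> \<le> h \<omega> \<and> \<bar>G1 \<omega>\<bar> \<le> h \<omega> \<and> \<bar>G0 \<omega> - G \<omega>\<bar> \<le> 2 * \<bar>z n' \<omega>\<bar> \<and> \<bar>G1 \<omega> - G \<omega>\<bar> \<le> 2 * \<bar>z n' \<omega>\<bar>"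
      using w Gh
    proof eventually_elim
      case (elim \<omega>)
      have 0: "\<bar>(1 - w \<omega>) * G \<omega>\<bar> \<le> (1 - w \<omega>) * h \<omega>" unfolding abs_mult using elim by (intro mult_mono) auto
      have 1: "(1 - w \<omega>) * h \<omega> = h \<omega> - \<bar>z n' \<omega>\<bar>" using elim by (simp add: left_diff_distrib)
      have 2: "\<bar>w \<omega> * G \<omega>\<bar> \<le> \<bar>z n' \<omega>\<bar>" unfolding abs_mult using elim mult_left_mono[of "\<bar>G \<omega>\<bar>" "h \<omega>" "w \<omega>"] by simp
      have "(1 - w \<omega>) * G \<omega> = G \<omega> - w \<omega> * G \<omega>" by (simp add: left_diff_distrib)
      then show ?case using 0 1 2 unfolding G0_def G1_def by linarith
    qed
    have bounds': "AE \<omega> in M. \<bar>G0 \<omega>\<bar> \<le> h \<omega>" "AE \<omega> in M. \<bar>G1 \<omega>\<bar> \<le> h \<omega>"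
      "AE \<omega> in M. \<bar>G0 \<omega> - G \<omega>\<bar> \<le> 2 * \<bar>z n' \<omega>\<bar>" "AE \<omega> in M. \<bar>G1 \<omega> - G \<omega>\<bar> \<le> 2 * \<bar>z n' \<omega>\<bar>"
      using bounds by simp_all
    have L': "G \<in> L'" "G0 \<in> L'" "G1 \<in> L'" using Gh bounds' by (simp_all add: dom)
    have az: "e / 2 \<le> \<bar>a n' (z n')\<bar>"
    proof -
      have "\<bar>pairing M p (z n')\<bar> \<le> pairing M (\<lambda>\<omega>. \<bar>p \<omega>\<bar>) (\<lambda>\<omega>. \<bar>z n' \<omega>\<bar>)"
        unfolding pairing_def abs_mult[symmetric] by (rule integral_abs_bound)
      then show ?thesis using big[of n'] n'(3) c(2)[of j] e unfolding a_def by linarith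
    qed
    have "a n' (\<lambda>\<omega>. G1 \<omega> - G0 \<omega>) = a n' (z n')" unfolding G0_def G1_def by simp
    then have "a n' (z n') = a n' (\<lambda>\<omega>. G1 \<omega> - G \<omega>) - a n' (\<lambda>\<omega>. G0 \<omega> - G \<omega>)" using L' a_diff by simp
    then have "e / 4 \<le> \<bar>a n' (\<lambda>\<omega>. G0 \<omega> - G \<omega>)\<bar> \<or> e / 4 \<le> \<bar>a n' (\<lambda>\<omega>. G1 \<omega> - G \<omega>)\<bar>" using az e by linarith
    then obtain G' where G': "G' = G0 \<or> G' = G1" "e / 4 \<le> \<bar>a n' (\<lambda>\<omega>. G' \<omega> - G \<omega>)\<bar>" by blast
    have bd': "AE \<omega> in M. \<bar>G' \<omega>\<bar> \<le> h \<omega>" "AE \<omega> in M. \<bar>G' \<omega> - G \<omega>\<bar> \<le> 2 * \<bar>z n' \<omega>\<bar>"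
      using bounds' G'(1) by blast+
    have "G' \<in> L'" using L' G'(1) by auto
    then have "inv n' G' (insert G' S)" unfolding inv_def using S bd' by auto
    moreover have "nxt j n G S n' G' (insert G' S)" unfolding nxt_def using n' past bd' G'(2) by auto
    ultimately show ?thesis by blast
  qed
  have "\<exists>s. \<forall>j. inv (fst (s j)) (fst (snd (s j))) (snd (snd (s j))) \<and>
    nxt j (fst (s j)) (fst (snd (s j))) (snd (snd (s j))) (fst (s (Suc j))) (fst (snd (s (Suc j)))) (snd (snd (s (Suc j))))"
  proof (rule dependent_nat_choice)
    have "inv 0 (\<lambda>_. 0) {\<lambda>_. 0}" unfolding inv_def
    proof (intro conjI)
      show "AE \<omega> in M. \<bar>0\<bar> \<le> h \<omega>" using zh[of 0] by eventually_elim simp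
    qed (use dual.const_space[of 0] in auto)
    then show "\<exists>s. inv (fst s) (fst (snd s)) (snd (snd s))" by (metis fst_conv snd_conv)
    fix s and j :: nat assume "inv (fst s) (fst (snd s)) (snd (snd s))"
    from step[OF this, of j] obtain n' G' S' where
      "inv n' G' S'" "nxt j (fst s) (fst (snd s)) (snd (snd s)) n' G' S'" by blast
    then show "\<exists>s'. inv (fst s') (fst (snd s')) (snd (snd s')) \<and>
        nxt j (fst s) (fst (snd s)) (snd (snd s)) (fst s') (fst (snd s')) (snd (snd s'))"
      by (metis fst_conv snd_conv)
  qed
  then obtain s where s: "\<And>j. inv (fst (s j)) (fst (snd (s j))) (snd (snd (s j)))"
    "\<And>j. nxt j (fst (s j)) (fst (snd (s j))) (snd (snd (s j))) (fst (s (Suc j))) (fst (snd (s (Suc j)))) (snd (snd (s (Suc j))))" by blast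
  define N G S where "N j = fst (s j)" and "G j = fst (snd (s j))" and "S j = snd (snd (s j))" for j
  have inv: "inv (N j) (G j) (S j)" and nxt: "nxt j (N j) (G j) (S j) (N (Suc j)) (G (Suc j)) (S (Suc j))" for j
    using s unfolding N_def G_def S_def by auto
  have GL: "G j \<in> L'" and Gh: "AE \<omega> in M. \<bar>G j \<omega>\<bar> \<le> h \<omega>" and GS: "G j \<in> S j" for j using inv[of j] unfolding inv_def by auto
  have [measurable]: "G j \<in> borel_measurable M" for j using GL by (rule dual.space_meas)
  have smN: "strict_mono N" using nxt unfolding nxt_def by (intro strict_monoI_Suc) auto
  have SS: "S i \<subseteq> S j" if "i \<le> j" for i j
    using that by (rule lift_Suc_mono_le[rotated]) (use nxt in \<open>auto simp: nxt_def\<close>)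
  have past: "\<bar>a (N (Suc j)) (G i)\<bar> \<le> c j" if "i \<le> j" for i j
    using nxt[of j] SS[OF that] GS[of i] unfolding nxt_def by blast
  have incr: "AE \<omega> in M. \<bar>G (Suc j) \<omega> - G j \<omega>\<bar> \<le> 2 * \<bar>z (N (Suc j)) \<omega>\<bar>" for j using nxt[of j] unfolding nxt_def by blast
  have pair_incr: "pairing M (\<lambda>\<omega>. \<bar>\<theta> \<omega>\<bar>) (\<lambda>\<omega>. \<bar>G (Suc j) \<omega> - G j \<omega>\<bar>) \<le> 2 * pairing M (\<lambda>\<omega>. \<bar>\<theta> \<omega>\<bar>) (\<lambda>\<omega>. \<bar>z (N (Suc j)) \<omega>\<bar>)" if "\<theta> \<in> L" for \<theta> j
  proof -
    have "pairing M (\<lambda>\<omega>. \<bar>\<theta> \<omega>\<bar>) (\<lambda>\<omega>. \<bar>G (Suc j) \<omega> - G j \<omega>\<bar>) \<le> (\<integral>\<omega>. 2 * (\<bar>\<theta> \<omega>\<bar> * \<bar>z (N (Suc j)) \<omega>\<bar>) \<partial>M)"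
      unfolding pairing_def
    proof (rule integral_mono_AE)
      show "integrable M (\<lambda>\<omega>. \<bar>\<theta> \<omega>\<bar> * \<bar>G (Suc j) \<omega> - G j \<omega>\<bar>)" "integrable M (\<lambda>\<omega>. 2 * (\<bar>\<theta> \<omega>\<bar> * \<bar>z (N (Suc j)) \<omega>\<bar>))"
        using that by (auto intro!: integrable_pairing abs_L abs_L' dual.space_diff GL zL integrable_mult_right)
      show "AE \<omega> in M. \<bar>\<theta> \<omega>\<bar> * \<bar>G (Suc j) \<omega> - G j \<omega>\<bar> \<le> 2 * (\<bar>\<theta> \<omega>\<bar> * \<bar>z (N (Suc j)) \<omega>\<bar>)" using incr[of j]
      proof eventually_elim
        case (elim \<omega>)
        from mult_left_mono[OF elim abs_ge_zero[of "\<theta> \<omega>"]] show ?case by simp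
      qed
    qed
    then show ?thesis unfolding pairing_def by simp
  qed
  have "AE \<omega> in M. summable (\<lambda>j. \<bar>G (Suc j) \<omega> - G j \<omega>\<bar>)"
  proof (rule AE_summable_of_integrals)
    show "integrable M (\<lambda>\<omega>. G (Suc j) \<omega> - G j \<omega>)" for j
      using integrable_pairing[OF const_space[of 1] dual.space_diff[OF GL GL], of "Suc j" j] by simp
    show "(\<integral>\<omega>. \<bar>G (Suc j) \<omega> - G j \<omega>\<bar> \<partial>M) \<le> 2 * c j" for j
      using pair_incr[OF const_space[of 1], of j] nxt[of j] unfolding nxt_def by (simp add: pairing_def)
    show "summable (\<lambda>j. 2 * c j)" unfolding c_def by (intro summable_mult summable_geometric) simp
  qed measurable
  then have "AE \<omega> in M. convergent (\<lambda>j. G j \<omega>)"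
  proof eventually_elim
    case (elim \<omega>)
    then have "summable (\<lambda>j. G (Suc j) \<omega> - G j \<omega>)" by (rule summable_rabs_cancel)
    then have "convergent (\<lambda>n. \<Sum>j<n. G (Suc j) \<omega> - G j \<omega>)" by (simp add: summable_iff_convergent)
    then have "convergent (\<lambda>n. G n \<omega> - G 0 \<omega>)" 
      using sum_lessThan_telescope[of "\<lambda>j. G j \<omega>"] by simp
    then show ?case using convergent_add[OF _ convergent_const[of "G 0 \<omega>"]] by force
  qed
  then have Glim: "AE \<omega> in M. (\<lambda>j. G j \<omega>) \<longlonglongrightarrow> lim (\<lambda>j. G j \<omega>)" by eventually_elim (simp add: convergent_LIMSEQ_iff)
  define H where "H \<omega> = lim (\<lambda>j. G j \<omega>)" for \<omega>
  have Hm [measurable]: "H \<in> borel_measurable M" unfolding H_def by (intro borel_measurable_lim_metric) auto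
  have pl: "(\<lambda>j. pairing M \<theta> (G j)) \<longlonglongrightarrow> pairing M \<theta> H" if "\<theta> \<in> L" for \<theta>
    by (rule pairing_dominated[OF that h _ _ Gh]) (use Glim in \<open>auto simp: H_def\<close>)
  have "AE \<omega> in M. \<forall>j. \<bar>G j \<omega>\<bar> \<le> h \<omega>" using Gh by (simp add: AE_all_countable)
  then have "AE \<omega> in M. \<bar>H \<omega>\<bar> \<le> h \<omega>" using Glim
    by eventually_elim (auto simp: H_def intro: LIMSEQ_le_const2[OF tendsto_rabs])
  then have HL: "H \<in> L'" by (intro dom) auto
  have al: "(\<lambda>j. a n (G j)) \<longlonglongrightarrow> a n H" for n unfolding a_def by (intro tendsto_diff pl \<eta>L pL)
  \<comment> \<open>Each increment counts twice, for \<open>\<eta>\<close> and for \<open>p\<close>,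
    each time with the factor 2 of \<open>pair_incr\<close>; and
    \<open>4 * c i = 8 * c i - 8 * c (Suc i)\<close> telescopes.\<close>
  have future: "\<bar>a (N (Suc j)) (G (Suc j + m)) - a (N (Suc j)) (G (Suc j))\<bar> \<le> 8 * c (Suc j) - 8 * c (Suc j + m)" for j m
  proof (induction m)
    case (Suc m)
    let ?i = "Suc j + m"
    have "\<bar>a (N (Suc j)) (\<lambda>\<omega>. G (Suc ?i) \<omega> - G ?i \<omega>)\<bar> \<le> 4 * c ?i"
    proof -
      have "N (Suc j) \<le> N ?i" using smN by (simp add: strict_mono_less_eq)
      then have "pairing M (\<lambda>\<omega>. \<bar>\<eta> (N (Suc j)) \<omega>\<bar>) (\<lambda>\<omega>. \<bar>z (N (Suc ?i)) \<omega>\<bar>) \<le> c ?i"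
        "pairing M (\<lambda>\<omega>. \<bar>p \<omega>\<bar>) (\<lambda>\<omega>. \<bar>z (N (Suc ?i)) \<omega>\<bar>) \<le> c ?i" using nxt[of ?i] unfolding nxt_def by blast+
      then show ?thesis
        using pair_incr[OF \<eta>L, of "N (Suc j)" ?i] pair_incr[OF pL, of ?i] a_abs[of "N (Suc j)" "\<lambda>\<omega>. G (Suc ?i) \<omega> - G ?i \<omega>"] by linarith
    qed
    then have "\<bar>a (N (Suc j)) (G (Suc ?i)) - a (N (Suc j)) (G ?i)\<bar> \<le> 4 * c ?i" using a_diff[OF GL GL] by simp
    then show ?case using Suc c(3)[of ?i] by simp
  qed simp
  have aH: "e / 8 \<le> \<bar>a (N (Suc j)) H\<bar>" for j
  proof -
    have "\<bar>a (N (Suc j)) H - a (N (Suc j)) (G (Suc j))\<bar> \<le> 8 * c (Suc j)"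
    proof (rule LIMSEQ_le_const2)
      show "(\<lambda>m. \<bar>a (N (Suc j)) (G (m + Suc j)) - a (N (Suc j)) (G (Suc j))\<bar>) \<longlonglongrightarrow> \<bar>a (N (Suc j)) H - a (N (Suc j)) (G (Suc j))\<bar>"
        by (intro tendsto_intros LIMSEQ_ignore_initial_segment al)
      have "\<bar>a (N (Suc j)) (G (m + Suc j)) - a (N (Suc j)) (G (Suc j))\<bar> \<le> 8 * c (Suc j)" for m
        using future[of j m] c(1)[of "Suc j + m"] by (simp add: add.commute)
      then show "\<exists>N'. \<forall>m\<ge>N'. \<bar>a (N (Suc j)) (G (m + Suc j)) - a (N (Suc j)) (G (Suc j))\<bar> \<le> 8 * c (Suc j)" by blast
    qed
    moreover have "e / 4 \<le> \<bar>a (N (Suc j)) (G (Suc j)) - a (N (Suc j)) (G j)\<bar>"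
      using nxt[of j] a_diff[OF GL[of "Suc j"] GL[of j]] unfolding nxt_def by simp
    ultimately show ?thesis using past[of j j] c(2)[of j] c(2)[of "Suc j"] e by linarith
  qed
  \<comment> \<open>A cluster point of the selected functionals agrees with \<open>p\<close> on
    every \<open>G i\<close>, since by \<open>past\<close> the recentred values tend to 0 there, and
    hence on the limit \<open>H\<close> by dominated convergence. Yet the recentred values at
    \<open>H\<close> stay at least \<open>e / 8\<close> in modulus.\<close>
  obtain q where q: "q \<in> K" "\<And>U. openin (weak_topology M L L') U \<Longrightarrow> q \<in> U \<Longrightarrow> \<exists>\<^sub>F j in sequentially. \<eta> (N (Suc j)) \<in> U"
  proof -
    from compactin_cluster_point[where x = "\<lambda>j. \<eta> (N (Suc j))", OF K \<eta>K] show ?thesis using that by (elim bexE) metis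
  qed
  have qL: "q \<in> L" using q KL by auto
  have "pairing M q (G i) = pairing M p (G i)" for i
  proof (rule ccontr)
    assume ne: "pairing M q (G i) \<noteq> pairing M p (G i)"
    define d where "d = \<bar>pairing M q (G i) - pairing M p (G i)\<bar> / 2"
    have d: "0 < d" "d < \<bar>pairing M q (G i) - pairing M p (G i)\<bar>" unfolding d_def using ne by auto
    let ?V = "{x. d < \<bar>x - pairing M p (G i)\<bar>}"
    have "open ?V" by (intro open_Collect_less continuous_intros)
    from q(2)[OF weak_open[OF GL[of i] this]] have fr: "\<exists>\<^sub>F j in sequentially. d < \<bar>a (N (Suc j)) (G i)\<bar>"
      using qL d \<eta>L by (auto simp: pairing_commute[of M "G i"] a_def)
    have "c \<longlonglongrightarrow> e / 128 * 0" unfolding c_def by (intro tendsto_mult_left LIMSEQ_realpow_zero) auto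
    then have "\<forall>\<^sub>F j in sequentially. c j < d" using d(1) by (intro order_tendstoD(2)[of c 0]) auto
    then have "\<forall>\<^sub>F j in sequentially. \<not> d < \<bar>a (N (Suc j)) (G i)\<bar>" using eventually_ge_at_top[of i]
      by eventually_elim (use past in \<open>force simp: not_less\<close>)
    then show False using fr by (simp add: frequently_def)
  qed
  then have "(\<lambda>j. pairing M p (G j)) \<longlonglongrightarrow> pairing M q H" using pl[OF qL] by simp
  then have eq: "pairing M q H = pairing M p H" using pl[OF pL] LIMSEQ_unique by blast
  have "open {x. \<bar>x - pairing M p H\<bar> < e / 8}" by (intro open_Collect_less continuous_intros)
  from q(2)[OF weak_open[OF HL this]] have "\<exists>\<^sub>F j in sequentially. \<bar>a (N (Suc j)) H\<bar> < e / 8"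
    using qL e \<eta>L eq by (auto simp: pairing_commute[of M H] a_def)
  from frequently_ex[OF this] obtain j where "\<bar>a (N (Suc j)) H\<bar> < e / 8" by blast
  then show False using aH[of j] by linarith
qed

text \<open>Failure of uniformity provides infinitely many \<open>n\<close> with an offending
  functional in \<open>K\<close>; an increasing enumeration of these indices contradicts
  \<open>compact_functional_gap\<close>.\<close>

lemma compact_uniform_convergence:
  assumes K: "compactin (weak_topology M L L') K" and h: "h \<in> L'"
    and zm: "\<And>n::nat. z n \<in> borel_measurable M" and zh: "\<And>n. AE \<omega> in M. \<bar>z n \<omega>\<bar> \<le> h \<omega>"
    and zlim: "AE \<omega> in M. (\<lambda>n. z n \<omega>) \<longlonglongrightarrow> 0" and e: "0 < e"
  shows "\<forall>\<^sub>F n in sequentially. \<forall>\<eta>\<in>K. \<bar>pairing M \<eta> (z n)\<bar> < e"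
proof (rule ccontr)
  assume "\<not> ?thesis"
  then have inf: "infinite {n. \<exists>\<eta>\<in>K. e \<le> \<bar>pairing M \<eta> (z n)\<bar>}"
    unfolding INFM_iff_infinite[symmetric] by (auto simp: cofinite_eq_sequentially not_eventually not_less)
  obtain r :: "nat \<Rightarrow> nat" where r: "strict_mono r" "\<And>n. r n \<in> {n. \<exists>\<eta>\<in>K. e \<le> \<bar>pairing M \<eta> (z n)\<bar>}"
    using infinite_enumerate[OF inf] by blast
  then have "\<forall>n. \<exists>\<eta>\<in>K. e \<le> \<bar>pairing M \<eta> (z (r n))\<bar>" by auto
  then obtain \<eta> where \<eta>: "\<And>n. \<eta> n \<in> K" "\<And>n. e \<le> \<bar>pairing M (\<eta> n) (z (r n))\<bar>" by metis
  have "AE \<omega> in M. (\<lambda>n. z (r n) \<omega>) \<longlonglongrightarrow> 0" using zlim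
    by eventually_elim (use LIMSEQ_subseq_LIMSEQ[OF _ r(1)] in \<open>force simp: comp_def\<close>)
  from compact_functional_gap[where z = "\<lambda>n. z (r n)" and \<eta> = \<eta>, OF K h zm zh this e \<eta>(1)] \<eta>(2) show False by (auto simp: not_less[symmetric])
qed

end

section \<open>Comparison of the notions of lower semicontinuity\<close>

lemma le_liminfI:
  fixes X :: "nat \<Rightarrow> ereal"
  assumes "\<And>c::real. ereal c < C \<Longrightarrow> \<forall>\<^sub>F n in sequentially. ereal c < X n"
  shows "C \<le> liminf X"
  unfolding le_Liminf_iff
proof (intro allI impI)
  fix y assume "y < C"
  then obtain c :: real where c: "y < ereal c" "ereal c < C" using ereal_dense2 by blast
  show "\<forall>\<^sub>F n in sequentially. y < X n"
    using assms[OF c(2)] by eventually_elim (use c(1) in \<open>auto intro: less_trans\<close>)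
qed

lemma le_of_le_liminf:
  fixes X :: "nat \<Rightarrow> ereal"
  assumes "C \<le> liminf X" "\<And>n. X n \<le> c"
  shows "C \<le> c"
  using assms(1) Liminf_le[OF sequentially_bot always_eventually, of X c] assms(2) by (meson order_trans)

context orlicz_dual
begin

lemma topspace_weak: "topspace (weak_topology M L' L) = L'"
  using const_space[of 0] unfolding weak_topology_def by auto

lemma topspace_weak': "topspace (weak_topology M L L') = L"
  using dual.const_space[of 0] unfolding weak_topology_def by auto

lemma topspace_mackey: "topspace (mackey_topology M L' L) = L'"
proof -
  \<comment> \<open>The empty compact set imposes no condition, so its basic set is all of
    \<open>L'\<close>.\<close>
  let ?B = "{\<xi> \<in> L'. \<forall>\<eta>\<in>{}. \<bar>pairing M \<eta> (\<lambda>\<omega>. \<xi> \<omega> - 0)\<bar> < 1}"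
  have "openin (mackey_topology M L' L) ?B" unfolding mackey_topology_def
  proof (rule topology_generated_by_Basis, intro CollectI exI conjI)
    show "?B = {\<xi> \<in> L'. \<forall>\<eta>\<in>{}. \<bar>pairing M \<eta> (\<lambda>\<omega>. \<xi> \<omega> - (\<lambda>_. 0) \<omega>)\<bar> < 1}" by simp
  qed (use dual.const_space[of 0] in \<open>auto simp: absolutely_convex_def\<close>)
  then have "L' \<subseteq> topspace (mackey_topology M L' L)" using openin_subset by fastforce
  moreover have "topspace (mackey_topology M L' L) \<subseteq> L'" unfolding mackey_topology_def by auto
  ultimately show ?thesis by (rule antisym[rotated])
qed

lemma topspace_L0: "topspace (L0_topology M) = borel_measurable M"
proof
  show "borel_measurable M \<subseteq> topspace (L0_topology M)"
  proof
    fix \<xi> :: "'a \<Rightarrow> real" assume "\<xi> \<in> borel_measurable M"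
    then show "\<xi> \<in> topspace (L0_topology M)" unfolding L0_topology_def
      by (auto intro!: exI[of _ "{\<zeta> \<in> borel_measurable M. (\<integral>\<omega>. min \<bar>\<zeta> \<omega> - \<xi> \<omega>\<bar> 1 \<partial>M) < 1}"] exI[of _ \<xi>] exI[of _ "1::real"])
  qed
qed (auto simp: L0_topology_def)

text \<open>\<open>order_bounded_in\<close> asks for the exact supremum; it is finite a.e. and
  dominated by \<open>h\<close>, so it belongs to \<open>L'\<close> by solidity.\<close>

lemma order_bounded_inI:
  assumes h: "h \<in> L'" and [measurable]: "\<And>n. x n \<in> borel_measurable M" and le: "\<And>n. AE \<omega> in M. \<bar>x n \<omega>\<bar> \<le> h \<omega>"
  shows "order_bounded_in M L' x"
proof -
  have le': "AE \<omega> in M. \<forall>n. \<bar>x n \<omega>\<bar> \<le> h \<omega>" using le by (simp add: AE_all_countable)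
  define \<zeta> where "\<zeta> \<omega> = real_of_ereal (SUP n. ereal \<bar>x n \<omega>\<bar>)" for \<omega>
  have [measurable]: "\<zeta> \<in> borel_measurable M" unfolding \<zeta>_def by measurable
  have *: "AE \<omega> in M. (SUP n. ereal \<bar>x n \<omega>\<bar>) = ereal (\<zeta> \<omega>) \<and> \<bar>\<zeta> \<omega>\<bar> \<le> \<bar>h \<omega>\<bar>" using le'
  proof eventually_elim
    case (elim \<omega>)
    define s where "s = (SUP n. ereal \<bar>x n \<omega>\<bar>)"
    have "s \<le> ereal (h \<omega>)" unfolding s_def using elim by (intro SUP_least) simp
    moreover have "0 \<le> s" unfolding s_def by (intro SUP_upper2[of 0]) auto
    ultimately have "s = ereal (real_of_ereal s) \<and> \<bar>real_of_ereal s\<bar> \<le> \<bar>h \<omega>\<bar>" by (cases s) auto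
    then show ?case unfolding s_def \<zeta>_def .
  qed
  then have "\<zeta> \<in> L'" by (intro dual.space_dominated[OF h]) auto
  then show ?thesis unfolding order_bounded_in_def using * by auto
qed

lemma order_bounded_inE:
  assumes "order_bounded_in M L' x"
  obtains h where "h \<in> L'" "\<And>n. AE \<omega> in M. \<bar>x n \<omega>\<bar> \<le> h \<omega>"
proof -
  obtain h where h: "h \<in> L'" "AE \<omega> in M. (SUP n. ereal \<bar>x n \<omega>\<bar>) = ereal (h \<omega>)" using assms unfolding order_bounded_in_def by auto
  have "AE \<omega> in M. \<bar>x n \<omega>\<bar> \<le> h \<omega>" for n using h(2)
  proof eventually_elim
    case (elim \<omega>)
    have "ereal \<bar>x n \<omega>\<bar> \<le> (SUP n. ereal \<bar>x n \<omega>\<bar>)" by (rule SUP_upper) simp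
    then show ?case using elim by simp
  qed
  then show ?thesis using that h(1) by blast
qed

text \<open>The segment is a continuous image of the interval from -1 to 1. Such segments make every
  weak seminorm a Mackey seminorm.\<close>

lemma singleton_multiples_compact:
  assumes "\<eta> \<in> L"
  shows "compactin (weak_topology M L L') {\<lambda>\<omega>. a * \<eta> \<omega> | a. \<bar>a\<bar> \<le> 1}"
    and "absolutely_convex {\<lambda>\<omega>. a * \<eta> \<omega> | a. \<bar>a\<bar> \<le> 1}"
proof -
  have "continuous_map euclideanreal (weak_topology M L L') (\<lambda>a \<omega>. a * \<eta> \<omega>)"
    unfolding weak_topology_def continuous_on_generated_topo_iff
  proof (intro conjI allI impI ballI)
    fix V assume "V \<in> {{\<xi> \<in> L. pairing M \<zeta> \<xi> \<in> U} |\<zeta> U. \<zeta> \<in> L' \<and> open U}"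
    then obtain \<zeta> U where V: "V = {\<xi> \<in> L. pairing M \<zeta> \<xi> \<in> U}" "\<zeta> \<in> L'" "open U" by auto
    have "(\<lambda>a \<omega>. a * \<eta> \<omega>) -` V = (\<lambda>a. a * pairing M \<eta> \<zeta>) -` U"
      unfolding V(1) using assms by (auto simp: pairing_commute[of M \<zeta>] pairing_scale space_scale)
    moreover have "open ((\<lambda>a. a * pairing M \<eta> \<zeta>) -` U)" by (intro open_vimage V continuous_intros)
    ultimately show "openin euclideanreal ((\<lambda>a \<omega>. a * \<eta> \<omega>) -` V \<inter> topspace euclideanreal)" by simp
  next
    show "(\<lambda>a \<omega>. a * \<eta> \<omega>) ` topspace euclideanreal \<subseteq> \<Union> {{\<xi> \<in> L. pairing M \<zeta> \<xi> \<in> U} |\<zeta> U. \<zeta> \<in> L' \<and> open U}"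
      using topspace_weak' assms unfolding weak_topology_def by (auto simp: space_scale)
  qed
  from image_compactin[OF _ this, of "{-1..1}"]
  have "compactin (weak_topology M L L') ((\<lambda>a \<omega>. a * \<eta> \<omega>) ` {-1..1})" by simp
  moreover have "(\<lambda>a \<omega>. a * \<eta> \<omega>) ` {-1..1} = {\<lambda>\<omega>. a * \<eta> \<omega> | a. \<bar>a\<bar> \<le> 1}" by (auto simp: image_def abs_le_iff)
  ultimately show "compactin (weak_topology M L L') {\<lambda>\<omega>. a * \<eta> \<omega> | a. \<bar>a\<bar> \<le> 1}" by simp
  show "absolutely_convex {\<lambda>\<omega>. a * \<eta> \<omega> | a. \<bar>a\<bar> \<le> 1}"
    unfolding absolutely_convex_def
  proof (intro ballI allI impI)
    fix \<eta>1 \<eta>2 a b assume *: "\<eta>1 \<in> {\<lambda>\<omega>. a * \<eta> \<omega> | a. \<bar>a\<bar> \<le> 1}" "\<eta>2 \<in> {\<lambda>\<omega>. a * \<eta> \<omega> | a. \<bar>a\<bar> \<le> 1}" "\<bar>a\<bar> + \<bar>b\<bar> \<le> (1::real)"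
    then obtain s t where st: "\<eta>1 = (\<lambda>\<omega>. s * \<eta> \<omega>)" "\<bar>s\<bar> \<le> 1" "\<eta>2 = (\<lambda>\<omega>. t * \<eta> \<omega>)" "\<bar>t\<bar> \<le> 1" by auto
    have "\<bar>a * s + b * t\<bar> \<le> \<bar>a\<bar> * \<bar>s\<bar> + \<bar>b\<bar> * \<bar>t\<bar>" by (metis abs_mult abs_triangle_ineq)
    also have "\<dots> \<le> \<bar>a\<bar> * 1 + \<bar>b\<bar> * 1" using st by (intro add_mono mult_left_mono) auto
    finally have "\<bar>a * s + b * t\<bar> \<le> 1" using *(3) by simp
    moreover have "(\<lambda>\<omega>. a * \<eta>1 \<omega> + b * \<eta>2 \<omega>) = (\<lambda>\<omega>. (a * s + b * t) * \<eta> \<omega>)" unfolding st by (auto simp: algebra_simps)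
    ultimately show "(\<lambda>\<omega>. a * \<eta>1 \<omega> + b * \<eta>2 \<omega>) \<in> {\<lambda>\<omega>. a * \<eta> \<omega> | a. \<bar>a\<bar> \<le> 1}" by blast
  qed
qed

text \<open>A weak neighbourhood involves finitely many functionals, and the Mackey ball of the
  segment through each of them controls it.\<close>

lemma weak_imp_mackey_seq:
  assumes weak: "lower_semicontinuous (weak_topology M L' L) f"
  shows "seq_lower_semicontinuous (mackey_topology M L' L) f"
  unfolding seq_lower_semicontinuous_def
proof (intro allI impI)
  fix x and x' assume "range x \<subseteq> topspace (mackey_topology M L' L) \<and> limitin (mackey_topology M L' L) x x' sequentially"
  then have x: "\<And>n. x n \<in> L'" and lim: "limitin (mackey_topology M L' L) x x' sequentially" unfolding topspace_mackey by auto
  have x': "x' \<in> L'" using limitin_topspace[OF lim] unfolding topspace_mackey .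
  show "f x' \<le> liminf (\<lambda>n. f (x n))"
  proof (rule le_liminfI)
    fix c :: real assume c: "ereal c < f x'"
    have "openin (weak_topology M L' L) {x \<in> L'. ereal c < f x}" using weak unfolding lower_semicontinuous_def topspace_weak by blast
    from weak_neighbourhood[OF this, of x'] obtain A e where A: "finite A" "A \<subseteq> L" "0 < e"
      "{\<xi> \<in> L'. \<forall>\<eta>\<in>A. \<bar>pairing M \<eta> \<xi> - pairing M \<eta> x'\<bar> < e} \<subseteq> {x \<in> L'. ereal c < f x}" using x' c by auto
    have "\<forall>\<^sub>F n in sequentially. \<bar>pairing M \<eta> (x n) - pairing M \<eta> x'\<bar> < e" if \<eta>: "\<eta> \<in> A" for \<eta>
    proof -
      have \<eta>L: "\<eta> \<in> L" using \<eta> A by auto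
      let ?K = "{\<lambda>\<omega>. a * \<eta> \<omega> | a. \<bar>a\<bar> \<le> 1}"
      let ?B = "{\<xi> \<in> L'. \<forall>\<theta>\<in>?K. \<bar>pairing M \<theta> (\<lambda>\<omega>. \<xi> \<omega> - x' \<omega>)\<bar> < e}"
      have "openin (mackey_topology M L' L) ?B" unfolding mackey_topology_def
        by (rule topology_generated_by_Basis) (use singleton_multiples_compact[OF \<eta>L] x' A(3) in blast)
      moreover have "x' \<in> ?B" using x' A(3) by (simp add: pairing_def)
      ultimately have "\<forall>\<^sub>F n in sequentially. x n \<in> ?B" using lim unfolding limitin_def by blast
      then show ?thesis
      proof eventually_elim
        case (elim n)
        have "(\<lambda>\<omega>. 1 * \<eta> \<omega>) \<in> ?K" by (intro CollectI exI[of _ 1]) simp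
        then have "\<bar>pairing M \<eta> (\<lambda>\<omega>. x n \<omega> - x' \<omega>)\<bar> < e" using elim by auto
        then show ?case using pairing_diff[OF \<eta>L x x'] by simp
      qed
    qed
    then have "\<forall>\<^sub>F n in sequentially. \<forall>\<eta>\<in>A. \<bar>pairing M \<eta> (x n) - pairing M \<eta> x'\<bar> < e" using A(1) by (intro eventually_ball_finite) auto
    then show "\<forall>\<^sub>F n in sequentially. ereal c < f (x n)" by eventually_elim (use A(4) x in blast)
  qed
qed

lemma mackey_seq_imp_order:
  assumes mackey: "seq_lower_semicontinuous (mackey_topology M L' L) f"
  shows "order_lower_semicontinuous M L' f"
  unfolding order_lower_semicontinuous_def
proof (intro allI impI)
  fix x :: "nat \<Rightarrow> 'a \<Rightarrow> real" and x'
  assume "range x \<subseteq> L' \<and> x' \<in> L' \<and> order_bounded_in M L' x \<and> (AE \<omega> in M. (\<lambda>n. x n \<omega>) \<longlonglongrightarrow> x' \<omega>)"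
  then have x: "\<And>n. x n \<in> L'" and x': "x' \<in> L'" and ob: "order_bounded_in M L' x" and lim: "AE \<omega> in M. (\<lambda>n. x n \<omega>) \<longlonglongrightarrow> x' \<omega>" by auto
  obtain h where h: "h \<in> L'" "\<And>n. AE \<omega> in M. \<bar>x n \<omega>\<bar> \<le> h \<omega>" using order_bounded_inE[OF ob] by blast
  have [measurable]: "x n \<in> borel_measurable M" "x' \<in> borel_measurable M" for n using dual.space_meas[OF x] dual.space_meas[OF x'] by auto
  define z where "z n \<omega> = x n \<omega> - x' \<omega>" for n \<omega>
  have [measurable]: "z n \<in> borel_measurable M" for n unfolding z_def by measurable
  have h2: "(\<lambda>\<omega>. h \<omega> + \<bar>x' \<omega>\<bar>) \<in> L'" by (intro dual.space_add h dual.space_dominated[OF x']) auto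
  have zh: "AE \<omega> in M. \<bar>z n \<omega>\<bar> \<le> h \<omega> + \<bar>x' \<omega>\<bar>" for n using h(2)[of n] unfolding z_def by eventually_elim linarith
  have zlim: "AE \<omega> in M. (\<lambda>n. z n \<omega>) \<longlonglongrightarrow> 0" using lim unfolding z_def by eventually_elim (rule LIM_zero)
  have "limitin (mackey_topology M L' L) x x' sequentially" unfolding mackey_topology_def
  proof (rule limitin_generated)
    show "x' \<in> \<Union> {{\<xi> \<in> L'. \<forall>\<eta>\<in>K. \<bar>pairing M \<eta> (\<lambda>\<omega>. \<xi> \<omega> - \<xi>\<^sub>0 \<omega>)\<bar> < \<epsilon>} | K \<xi>\<^sub>0 \<epsilon>.
        compactin (weak_topology M L L') K \<and> absolutely_convex K \<and> \<xi>\<^sub>0 \<in> L' \<and> 0 < \<epsilon>}"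
      using topspace_mackey x' unfolding mackey_topology_def by simp
    fix B assume "B \<in> {{\<xi> \<in> L'. \<forall>\<eta>\<in>K. \<bar>pairing M \<eta> (\<lambda>\<omega>. \<xi> \<omega> - \<xi>\<^sub>0 \<omega>)\<bar> < \<epsilon>} | K \<xi>\<^sub>0 \<epsilon>.
        compactin (weak_topology M L L') K \<and> absolutely_convex K \<and> \<xi>\<^sub>0 \<in> L' \<and> 0 < \<epsilon>}" and xB: "x' \<in> B"
    then obtain K \<xi>0 e where B: "B = {\<xi> \<in> L'. \<forall>\<eta>\<in>K. \<bar>pairing M \<eta> (\<lambda>\<omega>. \<xi> \<omega> - \<xi>0 \<omega>)\<bar> < e}"
      and K: "compactin (weak_topology M L L') K" and \<xi>0: "\<xi>0 \<in> L'" and e: "0 < e" by blast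
    have KL: "K \<subseteq> L" using compactin_subset_topspace[OF K] unfolding topspace_weak' .
    let ?d = "\<lambda>\<omega>. x' \<omega> - \<xi>0 \<omega>"
    have dL: "?d \<in> L'" by (rule dual.space_diff[OF x' \<xi>0])
    \<comment> \<open>Basic sets are centred at an arbitrary \<open>\<xi>0\<close>, so room around
      \<open>x'\<close> is needed: by compactness of \<open>K\<close> the strict pointwise
      inequality at \<open>x'\<close> holds with a margin \<open>e - m\<close>, within which
      \<open>z n\<close> has to become uniformly small.\<close>
    have "\<exists>m<e. \<forall>\<eta>\<in>K. \<bar>pairing M \<eta> ?d\<bar> \<le> m"
    proof (cases "K = {}")
      case True
      then show ?thesis using e by (intro exI[of _ 0]) auto
    next
      case False
      have "continuous_map (weak_topology M L L') euclideanreal (pairing M ?d)"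
        unfolding continuous_map_def topspace_weak'
        using weak_open[OF dL, of _ M L] by auto
      from image_compactin[OF K this] have "compact (pairing M ?d ` K)" by simp
      then have "compact (abs ` pairing M ?d ` K)" by (rule compact_continuous_image[rotated]) (intro continuous_intros)
      then obtain y where "y \<in> abs ` pairing M ?d ` K" "\<forall>t\<in>abs ` pairing M ?d ` K. t \<le> y"
        using compact_attains_sup[of "abs ` pairing M ?d ` K"] False by auto
      then obtain \<eta> where \<eta>: "\<eta> \<in> K" "\<forall>\<theta>\<in>K. \<bar>pairing M ?d \<theta>\<bar> \<le> \<bar>pairing M ?d \<eta>\<bar>" by auto
      have "\<bar>pairing M \<eta> ?d\<bar> < e" using xB \<eta>(1) unfolding B by auto
      then show ?thesis using \<eta>(2) by (intro exI[of _ "\<bar>pairing M \<eta> ?d\<bar>"]) (simp add: pairing_commute[of M ?d])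
    qed
    then obtain m where m: "m < e" "\<And>\<eta>. \<eta> \<in> K \<Longrightarrow> \<bar>pairing M \<eta> ?d\<bar> \<le> m" by blast
    have "\<forall>\<^sub>F n in sequentially. \<forall>\<eta>\<in>K. \<bar>pairing M \<eta> (z n)\<bar> < e - m"
      by (rule compact_uniform_convergence[OF K h2 _ zh zlim]) (use m in auto)
    then show "\<forall>\<^sub>F n in sequentially. x n \<in> B"
    proof eventually_elim
      case (elim n)
      have "\<bar>pairing M \<eta> (\<lambda>\<omega>. x n \<omega> - \<xi>0 \<omega>)\<bar> < e" if \<eta>: "\<eta> \<in> K" for \<eta>
      proof -
        have \<eta>L: "\<eta> \<in> L" using \<eta> KL by auto
        have "pairing M \<eta> (\<lambda>\<omega>. x n \<omega> - \<xi>0 \<omega>) = pairing M \<eta> (z n) + pairing M \<eta> ?d"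
          unfolding z_def pairing_diff[OF \<eta>L x x'] pairing_diff[OF \<eta>L x' \<xi>0] pairing_diff[OF \<eta>L x \<xi>0] by simp
        then show ?thesis using m(2)[OF \<eta>] elim \<eta> by force
      qed
      then show ?case unfolding B using x by auto
    qed
  qed
  then show "f x' \<le> liminf (\<lambda>n. f (x n))"
    using mackey x unfolding seq_lower_semicontinuous_def topspace_mackey by auto
qed

lemma order_interval_subset:
  assumes "\<zeta> \<in> L'" shows "order_interval M \<zeta> \<subseteq> L'"
proof
  fix \<xi> assume "\<xi> \<in> order_interval M \<zeta>"
  then have \<xi>: "\<xi> \<in> borel_measurable M" "AE \<omega> in M. - \<zeta> \<omega> \<le> \<xi> \<omega> \<and> \<xi> \<omega> \<le> \<zeta> \<omega>" unfolding order_interval_def by auto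
  show "\<xi> \<in> L'"
  proof (rule dual.space_dominated[OF assms \<xi>(1)])
    show "AE \<omega> in M. \<bar>\<xi> \<omega>\<bar> \<le> \<bar>\<zeta> \<omega>\<bar>" using \<xi>(2) by eventually_elim auto
  qed
qed

lemma topspace_interval: "topspace (subtopology (L0_topology M) (order_interval M \<zeta>)) = order_interval M \<zeta>"
  unfolding topspace_subtopology topspace_L0 by (auto simp: order_interval_def)

lemma limitin_L0:
  assumes [measurable]: "\<And>n::nat. x n \<in> borel_measurable M" "x' \<in> borel_measurable M"
    and lim: "AE \<omega> in M. (\<lambda>n. x n \<omega>) \<longlonglongrightarrow> x' \<omega>"
  shows "limitin (L0_topology M) x x' sequentially"
  unfolding L0_topology_def
proof (rule limitin_generated)
  show "x' \<in> \<Union> {{\<xi> \<in> borel_measurable M. (\<integral>\<omega>. min \<bar>\<xi> \<omega> - \<xi>\<^sub>0 \<omega>\<bar> 1 \<partial>M) < \<epsilon>} | \<xi>\<^sub>0 \<epsilon>. \<xi>\<^sub>0 \<in> borel_measurable M \<and> 0 < \<epsilon>}"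
    using topspace_L0 assms(2) unfolding L0_topology_def by simp
  fix B assume "B \<in> {{\<xi> \<in> borel_measurable M. (\<integral>\<omega>. min \<bar>\<xi> \<omega> - \<xi>\<^sub>0 \<omega>\<bar> 1 \<partial>M) < \<epsilon>} | \<xi>\<^sub>0 \<epsilon>. \<xi>\<^sub>0 \<in> borel_measurable M \<and> 0 < \<epsilon>}"
    and xB: "x' \<in> B"
  then obtain \<xi>0 e where B: "B = {\<xi> \<in> borel_measurable M. (\<integral>\<omega>. min \<bar>\<xi> \<omega> - \<xi>0 \<omega>\<bar> 1 \<partial>M) < e}"
    and [measurable]: "\<xi>0 \<in> borel_measurable M" by blast
  have "(\<lambda>n. \<integral>\<omega>. min \<bar>x n \<omega> - \<xi>0 \<omega>\<bar> 1 \<partial>M) \<longlonglongrightarrow> (\<integral>\<omega>. min \<bar>x' \<omega> - \<xi>0 \<omega>\<bar> 1 \<partial>M)"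
  proof (rule integral_dominated_convergence[where w = "\<lambda>_. 1"])
    show "AE \<omega> in M. (\<lambda>n. min \<bar>x n \<omega> - \<xi>0 \<omega>\<bar> 1) \<longlonglongrightarrow> min \<bar>x' \<omega> - \<xi>0 \<omega>\<bar> 1" using lim
      by eventually_elim (intro tendsto_intros)
  qed auto
  moreover have "(\<integral>\<omega>. min \<bar>x' \<omega> - \<xi>0 \<omega>\<bar> 1 \<partial>M) < e" using xB unfolding B by simp
  ultimately have "\<forall>\<^sub>F n in sequentially. (\<integral>\<omega>. min \<bar>x n \<omega> - \<xi>0 \<omega>\<bar> 1 \<partial>M) < e" by (rule order_tendstoD(2))
  then show "\<forall>\<^sub>F n in sequentially. x n \<in> B" unfolding B by eventually_elim auto
qed

text \<open>The bound of the sequence passes to its limit, so everything takes place in a single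
  order interval, where a.s. convergence implies convergence in probability.\<close>

lemma L0_imp_order:
  assumes L0: "\<And>\<zeta>. \<zeta> \<in> L' \<Longrightarrow> lower_semicontinuous (subtopology (L0_topology M) (order_interval M \<zeta>)) f"
  shows "order_lower_semicontinuous M L' f"
  unfolding order_lower_semicontinuous_def
proof (intro allI impI)
  fix x :: "nat \<Rightarrow> 'a \<Rightarrow> real" and x'
  assume "range x \<subseteq> L' \<and> x' \<in> L' \<and> order_bounded_in M L' x \<and> (AE \<omega> in M. (\<lambda>n. x n \<omega>) \<longlonglongrightarrow> x' \<omega>)"
  then have x: "\<And>n. x n \<in> L'" and x': "x' \<in> L'" and ob: "order_bounded_in M L' x" and lim: "AE \<omega> in M. (\<lambda>n. x n \<omega>) \<longlonglongrightarrow> x' \<omega>" by auto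
  obtain h where h: "h \<in> L'" "\<And>n. AE \<omega> in M. \<bar>x n \<omega>\<bar> \<le> h \<omega>" using order_bounded_inE[OF ob] by blast
  have m: "x n \<in> borel_measurable M" "x' \<in> borel_measurable M" for n using dual.space_meas[OF x] dual.space_meas[OF x'] by auto
  have xI: "x n \<in> order_interval M h" for n
  proof -
    have "AE \<omega> in M. - h \<omega> \<le> x n \<omega> \<and> x n \<omega> \<le> h \<omega>" using h(2)[of n] by eventually_elim auto
    then show ?thesis unfolding order_interval_def using m by blast
  qed
  have "AE \<omega> in M. \<forall>n. \<bar>x n \<omega>\<bar> \<le> h \<omega>" using h(2) by (simp add: AE_all_countable)
  then have "AE \<omega> in M. - h \<omega> \<le> x' \<omega> \<and> x' \<omega> \<le> h \<omega>" using lim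
  proof eventually_elim
    case (elim \<omega>)
    have "\<bar>x' \<omega>\<bar> \<le> h \<omega>" by (rule LIMSEQ_le_const2[OF tendsto_rabs[OF elim(2)]]) (use elim(1) in blast)
    then show ?case by auto
  qed
  then have xI': "x' \<in> order_interval M h" unfolding order_interval_def using m by blast
  show "f x' \<le> liminf (\<lambda>n. f (x n))"
  proof (rule le_liminfI)
    fix c :: real assume c: "ereal c < f x'"
    have "openin (subtopology (L0_topology M) (order_interval M h)) {x \<in> order_interval M h. ereal c < f x}"
      using L0[OF h(1)] unfolding lower_semicontinuous_def topspace_interval by blast
    then obtain T where T: "openin (L0_topology M) T" "{x \<in> order_interval M h. ereal c < f x} = T \<inter> order_interval M h"
      unfolding openin_subtopology by blast
    have "x' \<in> T" using T(2) xI' c by auto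
    then have "\<forall>\<^sub>F n in sequentially. x n \<in> T" using limitin_L0[OF m lim] T(1) unfolding limitin_def by blast
    then show "\<forall>\<^sub>F n in sequentially. ereal c < f (x n)" by eventually_elim (use T(2) xI in blast)
  qed
qed

text \<open>Otherwise points of the interval with \<open>f \<le> c\<close> converge in probability
  to a point with \<open>f > c\<close>. A subsequence converges a.s., and it is order bounded by
  \<open>\<zeta>\<close>.\<close>

lemma order_imp_L0:
  assumes ord: "order_lower_semicontinuous M L' f" and \<zeta>: "\<zeta> \<in> L'"
  shows "lower_semicontinuous (subtopology (L0_topology M) (order_interval M \<zeta>)) f"
  unfolding lower_semicontinuous_def topspace_interval
proof
  fix c :: real
  let ?I = "order_interval M \<zeta>" and ?S = "{x \<in> order_interval M \<zeta>. ereal c < f x}"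
  show "openin (subtopology (L0_topology M) ?I) ?S"
    unfolding openin_subopen[of _ ?S]
  proof
    fix x' assume x': "x' \<in> ?S"
    then have xI: "x' \<in> ?I" and fx: "ereal c < f x'" by auto
    have x'L: "x' \<in> L'" using order_interval_subset[OF \<zeta>] xI by auto
    have [measurable]: "x' \<in> borel_measurable M" using dual.space_meas[OF x'L] .
    define B where "B e = {\<xi> \<in> borel_measurable M. (\<integral>\<omega>. min \<bar>\<xi> \<omega> - x' \<omega>\<bar> 1 \<partial>M) < e}" for e
    have "\<exists>e>0. B e \<inter> ?I \<subseteq> ?S"
    proof (rule ccontr)
      assume no: "\<not> ?thesis"
      have "\<exists>x. x \<in> B (1 / real (Suc n)) \<inter> ?I \<and> x \<notin> ?S" for n
      proof -
        have "0 < 1 / real (Suc n)" by simp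
        then have "\<not> B (1 / real (Suc n)) \<inter> ?I \<subseteq> ?S" using no by blast
        then show ?thesis by blast
      qed
      then obtain x where "\<And>n. x n \<in> B (1 / real (Suc n)) \<inter> ?I \<and> x n \<notin> ?S" by metis
      then have xB: "\<And>n. x n \<in> B (1 / real (Suc n))" and xI: "\<And>n. x n \<in> ?I" and fx: "\<And>n. f (x n) \<le> ereal c" by (auto simp: not_less)
      have [measurable]: "x n \<in> borel_measurable M" for n using xB unfolding B_def by auto
      have lim0: "(\<lambda>n. \<integral>\<omega>. norm (min \<bar>x n \<omega> - x' \<omega>\<bar> 1) \<partial>M) \<longlonglongrightarrow> 0"
      proof (rule tendsto_sandwich[OF _ _ tendsto_const])
        show "(\<lambda>n. 1 / real (Suc n)) \<longlonglongrightarrow> 0" by (rule LIMSEQ_Suc[OF lim_inverse_n', unfolded inverse_eq_divide])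
        have "(\<integral>\<omega>. norm (min \<bar>x n \<omega> - x' \<omega>\<bar> 1) \<partial>M) \<le> 1 / real (Suc n)" for n
          using xB[of n] unfolding B_def by (simp add: less_imp_le abs_of_nonneg)
        then show "\<forall>\<^sub>F n in sequentially. (\<integral>\<omega>. norm (min \<bar>x n \<omega> - x' \<omega>\<bar> 1) \<partial>M) \<le> 1 / real (Suc n)" by simp
      qed auto
      have "integrable M (\<lambda>\<omega>. min \<bar>x n \<omega> - x' \<omega>\<bar> 1)" for n by (intro integrable_const_bound[where B = 1]) auto
      from tendsto_L1_AE_subseq[OF this lim0] obtain r :: "nat \<Rightarrow> nat" where
        r: "AE \<omega> in M. (\<lambda>n. min \<bar>x (r n) \<omega> - x' \<omega>\<bar> 1) \<longlonglongrightarrow> 0" by blast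
      have "AE \<omega> in M. (\<lambda>n. x (r n) \<omega>) \<longlonglongrightarrow> x' \<omega>" using r
      proof eventually_elim
        case (elim \<omega>)
        have "\<forall>\<^sub>F n in sequentially. min \<bar>x (r n) \<omega> - x' \<omega>\<bar> 1 < 1" using elim by (rule order_tendstoD(2)) simp
        then have "\<forall>\<^sub>F n in sequentially. min \<bar>x (r n) \<omega> - x' \<omega>\<bar> 1 = \<bar>x (r n) \<omega> - x' \<omega>\<bar>" by eventually_elim auto
        then have "(\<lambda>n. \<bar>x (r n) \<omega> - x' \<omega>\<bar>) \<longlonglongrightarrow> 0" using elim by (rule Lim_transform_eventually[rotated])
        then show ?case by (rule LIM_zero_cancel[OF tendsto_rabs_zero_cancel])
      qed
      moreover have "order_bounded_in M L' (\<lambda>n. x (r n))"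
      proof (rule order_bounded_inI[OF \<zeta>])
        show "AE \<omega> in M. \<bar>x (r n) \<omega>\<bar> \<le> \<zeta> \<omega>" for n
        proof -
          have "AE \<omega> in M. - \<zeta> \<omega> \<le> x (r n) \<omega> \<and> x (r n) \<omega> \<le> \<zeta> \<omega>" using xI[of "r n"] unfolding order_interval_def by blast
          then show ?thesis by eventually_elim auto
        qed
      qed simp
      moreover have "range (\<lambda>n. x (r n)) \<subseteq> L'" using xI order_interval_subset[OF \<zeta>] by blast
      ultimately have "f x' \<le> liminf (\<lambda>n. f (x (r n)))" using ord x'L unfolding order_lower_semicontinuous_def by blast
      then have "f x' \<le> ereal c" using fx by (rule le_of_le_liminf)
      then show False using \<open>ereal c < f x'\<close> by simp
    qed
    then obtain e where e: "0 < e" "B e \<inter> ?I \<subseteq> ?S" by blast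
    have "openin (L0_topology M) (B e)" unfolding L0_topology_def B_def
    proof (rule topology_generated_by_Basis, intro CollectI exI conjI)
      show "0 < e" by (rule e(1))
    qed (rule refl, measurable)
    then have "openin (subtopology (L0_topology M) ?I) (B e \<inter> ?I)" unfolding openin_subtopology by blast
    moreover have "x' \<in> B e \<inter> ?I" using xI e(1) unfolding B_def by simp
    ultimately show "\<exists>T. openin (subtopology (L0_topology M) ?I) T \<and> x' \<in> T \<and> T \<subseteq> ?S" using e(2) by blast
  qed
qed

end

section \<open>Duality of convex functions\<close>

text \<open>Working with real upper bounds \<open>s\<close>, \<open>t\<close> avoids products with
  infinite values. The endpoints \<open>a = 0\<close> and \<open>b = 0\<close>, which
  \<open>proper_convex_on\<close> leaves out, are trivial.\<close>

lemma proper_convex_le: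
  assumes f: "proper_convex_on E f" and "\<xi> \<in> E" "\<zeta> \<in> E" "f \<xi> \<le> ereal s" "f \<zeta> \<le> ereal t"
    and ab: "0 \<le> a" "0 \<le> b" "a + b = (1::real)"
  shows "f (\<lambda>\<omega>. a * \<xi> \<omega> + b * \<zeta> \<omega>) \<le> ereal (a * s + b * t)"
proof (cases "a = 0 \<or> b = 0")
  case True
  then show ?thesis using assms by auto
next
  case False
  then have a: "0 < a" "a < 1" and b: "b = 1 - a" using ab by auto
  have "f (\<lambda>\<omega>. a * \<xi> \<omega> + b * \<zeta> \<omega>) \<le> ereal a * f \<xi> + ereal b * f \<zeta>"
    using f a assms(2,3) unfolding proper_convex_on_def b by blast
  also have "\<dots> \<le> ereal a * ereal s + ereal b * ereal t"
    using assms(4,5) ab by (intro add_mono ereal_mult_left_mono) auto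
  finally show ?thesis by simp
qed

context orlicz_dual
begin

text \<open>The sublevel set at \<open>c\<close>, translated so that \<open>x0\<close> becomes the
  origin, is convex and order closed and misses 0. The functional from
  \<open>separate_from_zero\<close> is at least 1 on it, so \<open>f > c\<close> on the weakly open
  half-space where this functional exceeds its value at \<open>x0\<close> by less than 1.\<close>

lemma order_imp_weak:
  assumes f: "proper_convex_on L' f" and ord: "order_lower_semicontinuous M L' f"
  shows "lower_semicontinuous (weak_topology M L' L) f"
  unfolding lower_semicontinuous_def topspace_weak
proof
  fix c :: real
  let ?S = "{x \<in> L'. ereal c < f x}"
  show "openin (weak_topology M L' L) ?S"
    unfolding openin_subopen[of _ ?S]
  proof
    fix x0 assume "x0 \<in> ?S"
    then have x0: "x0 \<in> L'" "ereal c < f x0" by auto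
    have [measurable]: "x0 \<in> borel_measurable M" using x0(1) by (rule dual.space_meas)
    define C where "C = {u \<in> L'. f (\<lambda>\<omega>. u \<omega> + x0 \<omega>) \<le> ereal c}"
    have shift: "(\<lambda>\<omega>. u \<omega> + x0 \<omega>) \<in> L'" if "u \<in> L'" for u using that x0(1) by (rule dual.space_add)
    have "\<exists>\<eta>\<in>L. \<forall>u\<in>C. 1 \<le> (\<integral>\<omega>. \<eta> \<omega> * u \<omega> \<partial>M)"
    proof (rule separate_from_zero)
      show "C \<subseteq> L'" unfolding C_def by auto
      show "(\<lambda>_. 0) \<notin> C" using x0(2) unfolding C_def by (simp add: not_le)
      show "(\<lambda>\<omega>. a * u \<omega> + b * v \<omega>) \<in> C" if uv: "u \<in> C" "v \<in> C" and ab: "0 \<le> a" "0 \<le> b" "a + b = 1" for u v a b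
      proof -
        have "f (\<lambda>\<omega>. a * (u \<omega> + x0 \<omega>) + b * (v \<omega> + x0 \<omega>)) \<le> ereal (a * c + b * c)"
          using uv ab unfolding C_def by (intro proper_convex_le[OF f] shift) auto
        moreover have "a * (x + z) + b * (y + z) = (a * x + b * y) + z" for x y z
          using ab(3) by (simp add: distrib_left distrib_right[symmetric] algebra_simps)
        moreover have "a * c + b * c = c" using ab(3) by (simp add: distrib_right[symmetric])
        ultimately show ?thesis using uv unfolding C_def by (auto intro!: dual.space_add dual.space_scale)
      qed
      show "v \<in> C" if u: "\<And>n::nat. u n \<in> C" and v: "v \<in> L'" and h: "h \<in> L'" and le: "\<And>n. AE \<omega> in M. \<bar>u n \<omega>\<bar> \<le> h \<omega>"
        and lim: "AE \<omega> in M. (\<lambda>n. u n \<omega>) \<longlonglongrightarrow> v \<omega>" for u v h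
      proof -
        have uL: "u n \<in> L'" and fu: "f (\<lambda>\<omega>. u n \<omega> + x0 \<omega>) \<le> ereal c" for n using u unfolding C_def by auto
        have [measurable]: "u n \<in> borel_measurable M" for n using uL by (rule dual.space_meas)
        have "order_bounded_in M L' (\<lambda>n \<omega>. u n \<omega> + x0 \<omega>)"
        proof (rule order_bounded_inI)
          show "(\<lambda>\<omega>. h \<omega> + \<bar>x0 \<omega>\<bar>) \<in> L'" by (intro dual.space_add h dual.space_dominated[OF x0(1)]) auto
          show "AE \<omega> in M. \<bar>u n \<omega> + x0 \<omega>\<bar> \<le> h \<omega> + \<bar>x0 \<omega>\<bar>" for n using le[of n] by eventually_elim linarith
        qed measurable
        moreover have "AE \<omega> in M. (\<lambda>n. u n \<omega> + x0 \<omega>) \<longlonglongrightarrow> v \<omega> + x0 \<omega>" using lim by eventually_elim (intro tendsto_intros)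
        ultimately have "f (\<lambda>\<omega>. v \<omega> + x0 \<omega>) \<le> liminf (\<lambda>n. f (\<lambda>\<omega>. u n \<omega> + x0 \<omega>))"
          using ord[unfolded order_lower_semicontinuous_def, rule_format, of "\<lambda>n \<omega>. u n \<omega> + x0 \<omega>" "\<lambda>\<omega>. v \<omega> + x0 \<omega>"]
            shift[OF uL] shift[OF v] by (simp add: image_subset_iff)
        then have "f (\<lambda>\<omega>. v \<omega> + x0 \<omega>) \<le> ereal c" using fu by (rule le_of_le_liminf)
        then show ?thesis unfolding C_def using v by simp
      qed
    qed
    then obtain \<eta> where \<eta>: "\<eta> \<in> L" "\<And>u. u \<in> C \<Longrightarrow> 1 \<le> pairing M \<eta> u" unfolding pairing_def by blast
    let ?T = "{\<xi> \<in> L'. pairing M \<eta> \<xi> \<in> {..<pairing M \<eta> x0 + 1}}"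
    have "openin (weak_topology M L' L) ?T" by (rule weak_open[OF \<eta>(1)]) simp
    moreover have "x0 \<in> ?T" using x0 by simp
    moreover have "?T \<subseteq> ?S"
    proof
      fix \<xi> assume \<xi>: "\<xi> \<in> ?T"
      have "ereal c < f \<xi>"
      proof (rule ccontr)
        assume "\<not> ereal c < f \<xi>"
        then have "(\<lambda>\<omega>. \<xi> \<omega> - x0 \<omega>) \<in> C" unfolding C_def using \<xi> x0(1) by (auto simp: not_less dual.space_diff)
        then have "1 \<le> pairing M \<eta> \<xi> - pairing M \<eta> x0" using \<eta>(2) pairing_diff[OF \<eta>(1) _ x0(1), of \<xi>] \<xi> by force
        then show False using \<xi> by simp
      qed
      then show "\<xi> \<in> ?S" using \<xi> by simp
    qed
    ultimately show "\<exists>T. openin (weak_topology M L' L) T \<and> x0 \<in> T \<and> T \<subseteq> ?S" by blast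
  qed
qed

section \<open>Fenchel-Moreau duality\<close>

lemma conjugate_not_MInf:
  assumes "proper_convex_on L' f"
  shows "convex_conjugate M L' f \<eta> \<noteq> - \<infinity>"
proof -
  obtain \<xi> where \<xi>: "\<xi> \<in> L'" "f \<xi> \<noteq> \<infinity>" "f \<xi> \<noteq> - \<infinity>" using assms unfolding proper_convex_on_def by blast
  then obtain t where "f \<xi> = ereal t" by (cases "f \<xi>") auto
  then have "ereal (pairing M \<eta> \<xi> - t) \<le> convex_conjugate M L' f \<eta>"
    unfolding convex_conjugate_def using \<xi>(1) by (intro SUP_upper2[of \<xi>]) auto
  then show ?thesis by auto
qed

lemma conjugate_le:
  assumes "proper_convex_on L' f" and "\<And>\<xi> s. \<xi> \<in> L' \<Longrightarrow> f \<xi> = ereal s \<Longrightarrow> pairing M \<eta> \<xi> - s \<le> b"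
  shows "convex_conjugate M L' f \<eta> \<le> ereal b"
  unfolding convex_conjugate_def
proof (rule SUP_least)
  fix \<xi> assume \<xi>: "\<xi> \<in> L'"
  then have "f \<xi> \<noteq> - \<infinity>" using assms(1) unfolding proper_convex_on_def by blast
  then show "ereal (pairing M \<eta> \<xi>) - f \<xi> \<le> ereal b" using assms(2)[OF \<xi>] by (cases "f \<xi>") auto
qed

lemma fenchel_inequality:
  assumes "proper_convex_on L' f" and "\<xi> \<in> L'"
  shows "ereal (pairing M \<eta> \<xi>) - convex_conjugate M L' f \<eta> \<le> f \<xi>"
proof -
  have "ereal (pairing M \<eta> \<xi>) - f \<xi> \<le> convex_conjugate M L' f \<eta>"
    unfolding convex_conjugate_def by (rule SUP_upper[OF assms(2)])
  moreover have "f \<xi> \<noteq> - \<infinity>" using assms unfolding proper_convex_on_def by blast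
  ultimately show ?thesis using conjugate_not_MInf[OF assms(1), of \<eta>]
    by (cases "f \<xi>"; cases "convex_conjugate M L' f \<eta>") auto
qed

text \<open>One affine minorant already exceeds \<open>c\<close> at the given point, hence on a weak
  neighbourhood. Its conjugate value is finite: properness excludes minus infinity, and exceeding
  \<open>c\<close> excludes plus infinity.\<close>

lemma dual_rep_imp_weak:
  assumes f: "proper_convex_on L' f"
    and rep: "\<forall>\<xi>\<in>L'. f \<xi> = (SUP \<eta>\<in>L. ereal (pairing M \<eta> \<xi>) - convex_conjugate M L' f \<eta>)"
  shows "lower_semicontinuous (weak_topology M L' L) f"
  unfolding lower_semicontinuous_def topspace_weak
proof
  fix c :: real
  let ?S = "{x \<in> L'. ereal c < f x}"
  show "openin (weak_topology M L' L) ?S"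
    unfolding openin_subopen[of _ ?S]
  proof
    fix x0 assume "x0 \<in> ?S"
    then have x0: "x0 \<in> L'" "ereal c < f x0" by auto
    then have "ereal c < (SUP \<eta>\<in>L. ereal (pairing M \<eta> x0) - convex_conjugate M L' f \<eta>)" using rep by metis
    then obtain \<eta> where \<eta>: "\<eta> \<in> L" "ereal c < ereal (pairing M \<eta> x0) - convex_conjugate M L' f \<eta>" unfolding less_SUP_iff by blast
    then obtain b where b: "convex_conjugate M L' f \<eta> = ereal b"
      using conjugate_not_MInf[OF f, of \<eta>] by (cases "convex_conjugate M L' f \<eta>") auto
    let ?T = "{\<xi> \<in> L'. pairing M \<eta> \<xi> \<in> {c + b<..}}"
    have "openin (weak_topology M L' L) ?T" by (rule weak_open[OF \<eta>(1)]) simp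
    moreover have "x0 \<in> ?T" using x0 \<eta>(2) unfolding b by simp
    moreover have "?T \<subseteq> ?S"
    proof
      fix \<xi> assume \<xi>: "\<xi> \<in> ?T"
      then have "ereal c < ereal (pairing M \<eta> \<xi>) - convex_conjugate M L' f \<eta>" unfolding b by simp
      also have "\<dots> \<le> f \<xi>" using fenchel_inequality[OF f] \<xi> by blast
      finally show "\<xi> \<in> ?S" using \<xi> by simp
    qed
    ultimately show "\<exists>T. openin (weak_topology M L' L) T \<and> x0 \<in> T \<and> T \<subseteq> ?S" by blast
  qed
qed

text \<open>A weak neighbourhood of \<open>\<xi>\<^sub>0\<close> reduces the separation of \<open>(\<xi>\<^sub>0, c)\<close> from the epigraph to finitely
  many coordinates.\<close>

lemma epigraph_separation:
  assumes f: "proper_convex_on L' f" and weak: "lower_semicontinuous (weak_topology M L' L) f"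
    and \<xi>0: "\<xi>\<^sub>0 \<in> L'" and c: "ereal c < f \<xi>\<^sub>0"
  shows "\<exists>\<eta>\<in>L. \<exists>b\<ge>0. \<forall>\<xi>\<in>L'. \<forall>s. f \<xi> \<le> ereal s \<longrightarrow> 1 \<le> pairing M \<eta> \<xi> - pairing M \<eta> \<xi>\<^sub>0 + b * (s - c)"
proof -
  \<comment> \<open>The intermediate level gives the vertical coordinate a positive scale: near
    \<open>\<xi>\<^sub>0\<close> the epigraph lies above \<open>d\<close>, so
    \<open>(s - c) / (d - c) \<ge> 1\<close> there.\<close>
  obtain d :: real where d: "ereal c < ereal d" "ereal d < f \<xi>\<^sub>0" using ereal_dense2[OF c] by blast
  then have cd: "0 < d - c" by simp
  have "openin (weak_topology M L' L) {x \<in> L'. ereal d < f x}" using weak unfolding lower_semicontinuous_def topspace_weak by blast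
  from weak_neighbourhood[OF this, of \<xi>\<^sub>0] obtain A e where A: "finite A" "A \<subseteq> L" "0 < e"
    and nb: "{\<xi> \<in> L'. \<forall>\<eta>\<in>A. \<bar>pairing M \<eta> \<xi> - pairing M \<eta> \<xi>\<^sub>0\<bar> < e} \<subseteq> {x \<in> L'. ereal d < f x}" using \<xi>0 d by auto
  obtain n :: nat and \<theta> where \<theta>: "A = \<theta> ` {i. i < n}" using finite_imp_nat_seg_image_inj_on[OF A(1)] by blast
  have \<theta>L: "\<theta> k \<in> L" if "k < n" for k using A(2) that unfolding \<theta> by auto
  \<comment> \<open>Scaled so that each point of the epigraph has a coordinate of modulus at least
    1: one with index below \<open>n\<close> if \<open>\<xi>\<close> is outside the weak
    neighbourhood, and the vertical one, with index \<open>n\<close>, if it is inside. Padding with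
    zeros makes \<open>l2_separation\<close> applicable.\<close>
  define T where "T \<xi> s k = (if k < n then (pairing M (\<theta> k) \<xi> - pairing M (\<theta> k) \<xi>\<^sub>0) / e
    else if k = n then (s - c) / (d - c) else 0)" for \<xi> s k
  define S where "S = {T \<xi> s | \<xi> s. \<xi> \<in> L' \<and> f \<xi> \<le> ereal s}"
  have T0: "T \<xi> s k = 0" if "k \<notin> {..n}" for \<xi> s k using that unfolding T_def by simp
  have sm: "summable (\<lambda>k. (T \<xi> s k)\<^sup>2)" for \<xi> s by (rule summable_finite[of "{..n}"]) (use T0 in auto)
  have "\<exists>y. summable (\<lambda>k. (y k)\<^sup>2) \<and> (\<forall>x\<in>S. 1 \<le> (\<Sum>k. y k * x k))"
  proof (rule l2_separation)
    obtain \<xi> where \<xi>: "\<xi> \<in> L'" "f \<xi> \<noteq> \<infinity>" "f \<xi> \<noteq> - \<infinity>" using f unfolding proper_convex_on_def by blast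
    then obtain r where "f \<xi> \<le> ereal r" by (cases "f \<xi>") auto
    then have "T \<xi> r \<in> S" unfolding S_def using \<xi>(1) by blast
    then show "S \<noteq> {}" by blast
    show "summable (\<lambda>k. (x k)\<^sup>2)" if "x \<in> S" for x using that sm unfolding S_def by auto
    show "(\<lambda>k. a * x k + b * y k) \<in> S" if xy: "x \<in> S" "y \<in> S" and ab: "0 \<le> a" "0 \<le> b" "a + b = 1" for x y a b
    proof -
      obtain \<xi> s \<zeta> t where *: "x = T \<xi> s" "\<xi> \<in> L'" "f \<xi> \<le> ereal s" "y = T \<zeta> t" "\<zeta> \<in> L'" "f \<zeta> \<le> ereal t"
        using xy unfolding S_def by blast
      have lin: "a * ((p - z) / r) + b * ((q - z) / r) = (a * p + b * q - z) / r" for p q z r :: real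
      proof -
        have "a * (p - z) + b * (q - z) = a * p + b * q - (a + b) * z" by (simp add: algebra_simps)
        then show ?thesis using ab(3) by (simp add: add_divide_distrib[symmetric])
      qed
      have "a * T \<xi> s k + b * T \<zeta> t k = T (\<lambda>\<omega>. a * \<xi> \<omega> + b * \<zeta> \<omega>) (a * s + b * t) k" for k
      proof -
        consider "k < n" | "k = n" | "n < k" by linarith
        then show ?thesis
        proof cases
          case 1
          then show ?thesis unfolding T_def by (simp only: if_True pairing_combine[OF \<theta>L *(2,5)] lin)
        next
          case 2
          then show ?thesis unfolding T_def by (simp only: less_irrefl refl if_False if_True lin simp_thms)
        next
          case 3
          then show ?thesis unfolding T_def by simp
        qed
      qed
      then have "(\<lambda>k. a * x k + b * y k) = T (\<lambda>\<omega>. a * \<xi> \<omega> + b * \<zeta> \<omega>) (a * s + b * t)" unfolding * by (rule ext)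
      moreover have "(\<lambda>\<omega>. a * \<xi> \<omega> + b * \<zeta> \<omega>) \<in> L'" by (rule dual.space_add[OF dual.space_scale[OF *(2)] dual.space_scale[OF *(5)]])
      moreover have "f (\<lambda>\<omega>. a * \<xi> \<omega> + b * \<zeta> \<omega>) \<le> ereal (a * s + b * t)" 
      proof (rule proper_convex_le[where f = f and E = L' and \<xi> = \<xi> and \<zeta> = \<zeta> and s = s and t = t])
      qed (fact f *(2) *(5) *(3) *(6) ab)+
      ultimately show ?thesis unfolding S_def by blast
    qed
    show "1 \<le> (\<Sum>k. (x k)\<^sup>2)" if x: "x \<in> S" for x
    proof -
      obtain \<xi> s where *: "x = T \<xi> s" "\<xi> \<in> L'" "f \<xi> \<le> ereal s" using x unfolding S_def by blast
      have "\<exists>k. 1 \<le> \<bar>T \<xi> s k\<bar>"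
      proof (cases "\<forall>\<eta>\<in>A. \<bar>pairing M \<eta> \<xi> - pairing M \<eta> \<xi>\<^sub>0\<bar> < e")
        case True
        then have "ereal d < f \<xi>" using nb *(2) by blast
        then have "ereal d < ereal s" using *(3) by (rule less_le_trans)
        then have "1 \<le> (s - c) / (d - c)" using cd by (simp add: pos_le_divide_eq)
        also have "\<dots> = T \<xi> s n" unfolding T_def by simp
        finally show ?thesis by (intro exI[of _ n]) linarith
      next
        case False
        then obtain k where "k < n" "e \<le> \<bar>pairing M (\<theta> k) \<xi> - pairing M (\<theta> k) \<xi>\<^sub>0\<bar>" unfolding \<theta> by (auto simp: not_less)
        then show ?thesis unfolding T_def using A(3) by (intro exI[of _ k]) (simp add: abs_divide pos_le_divide_eq)
      qed
      then obtain k where k: "1 \<le> \<bar>T \<xi> s k\<bar>" by blast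
      have "1\<^sup>2 \<le> \<bar>T \<xi> s k\<bar>\<^sup>2" using k by (intro power_mono) auto
      also have "\<dots> = (\<Sum>i\<in>{k}. (T \<xi> s i)\<^sup>2)" by simp
      also have "\<dots> \<le> (\<Sum>i. (T \<xi> s i)\<^sup>2)" by (intro sum_le_suminf sm) auto
      finally show ?thesis unfolding * by simp
    qed
  qed
  then obtain y where y: "\<And>x. x \<in> S \<Longrightarrow> 1 \<le> (\<Sum>k. y k * x k)" by blast
  define \<eta> where "\<eta> \<omega> = (\<Sum>k<n. y k / e * \<theta> k \<omega>)" for \<omega>
  define b where "b = y n / (d - c)"
  have \<eta>_part: "(\<lambda>\<omega>. \<Sum>k<m. y k / e * \<theta> k \<omega>) \<in> L \<and> (\<forall>\<xi>\<in>L'. pairing M (\<lambda>\<omega>. \<Sum>k<m. y k / e * \<theta> k \<omega>) \<xi> = (\<Sum>k<m. y k / e * pairing M (\<theta> k) \<xi>))"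
    if "m \<le> n" for m using that
  proof (induction m)
    case 0
    then show ?case using const_space[of 0] by (simp add: pairing_def)
  next
    case (Suc m)
    let ?g = "\<lambda>\<omega>. \<Sum>k<m. y k / e * \<theta> k \<omega>"
    have g: "?g \<in> L" "\<And>\<xi>. \<xi> \<in> L' \<Longrightarrow> pairing M ?g \<xi> = (\<Sum>k<m. y k / e * pairing M (\<theta> k) \<xi>)" and m: "\<theta> m \<in> L" using Suc \<theta>L by auto
    have "(\<lambda>\<omega>. ?g \<omega> + y m / e * \<theta> m \<omega>) \<in> L" by (intro space_add space_scale g m)
    moreover have "pairing M (\<lambda>\<omega>. ?g \<omega> + y m / e * \<theta> m \<omega>) \<xi> = pairing M ?g \<xi> + y m / e * pairing M (\<theta> m) \<xi>" if "\<xi> \<in> L'" for \<xi>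
      using pairing_combine_left[OF g(1) m that, of 1 "y m / e"] by simp
    ultimately show ?case using g(2) by simp
  qed
  have \<eta>L: "\<eta> \<in> L" and \<eta>p: "\<And>\<xi>. \<xi> \<in> L' \<Longrightarrow> pairing M \<eta> \<xi> = (\<Sum>k<n. y k / e * pairing M (\<theta> k) \<xi>)"
    using \<eta>_part[of n] unfolding \<eta>_def by auto
  have ineq: "1 \<le> pairing M \<eta> \<xi> - pairing M \<eta> \<xi>\<^sub>0 + b * (s - c)" if \<xi>: "\<xi> \<in> L'" and s: "f \<xi> \<le> ereal s" for \<xi> s
  proof -
    have "1 \<le> (\<Sum>k. y k * T \<xi> s k)" using \<xi> s by (intro y) (auto simp: S_def)
    also have "\<dots> = (\<Sum>k\<le>n. y k * T \<xi> s k)" by (rule suminf_finite) (use T0 in auto)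
    also have "\<dots> = (\<Sum>k<n. y k * T \<xi> s k) + y n * T \<xi> s n" by (simp add: lessThan_Suc_atMost[symmetric])
    also have "(\<Sum>k<n. y k * T \<xi> s k) = (\<Sum>k<n. y k / e * pairing M (\<theta> k) \<xi> - y k / e * pairing M (\<theta> k) \<xi>\<^sub>0)"
      by (rule sum.cong) (auto simp: T_def diff_divide_distrib right_diff_distrib)
    also have "\<dots> = pairing M \<eta> \<xi> - pairing M \<eta> \<xi>\<^sub>0" unfolding \<eta>p[OF \<xi>] \<eta>p[OF \<xi>0] by (rule sum_subtractf)
    also have "y n * T \<xi> s n = b * (s - c)" unfolding T_def b_def by simp
    finally show ?thesis .
  qed
  have "0 \<le> b"
  proof (rule ccontr)
    assume nb: "\<not> 0 \<le> b"
    obtain \<xi> where \<xi>: "\<xi> \<in> L'" "f \<xi> \<noteq> \<infinity>" "f \<xi> \<noteq> - \<infinity>" using f unfolding proper_convex_on_def by blast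
    then obtain t where t: "f \<xi> = ereal t" by (cases "f \<xi>") auto
    define P where "P = pairing M \<eta> \<xi> - pairing M \<eta> \<xi>\<^sub>0"
    \<comment> \<open>The epigraph is unbounded upwards: for negative \<open>b\<close> this height
      makes the separated quantity nonpositive, against the lower bound 1.\<close>
    define s where "s = max t (c + P / (- b))"
    have "P / (- b) \<le> s - c" unfolding s_def by simp
    then have "P \<le> (s - c) * (- b)" using nb by (subst (asm) pos_divide_le_eq) auto
    then have "P + b * (s - c) \<le> 0" by (simp add: mult.commute)
    moreover have "1 \<le> P + b * (s - c)" unfolding P_def using \<xi>(1) t by (intro ineq) (auto simp: s_def)
    ultimately show False by simp
  qed
  then show ?thesis using \<eta>L ineq by blast
qed

text \<open>For \<open>b > 0\<close> the hyperplane is not vertical and can be solved for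
  \<open>s\<close>: \<open>- \<eta> / b\<close> is the slope of an affine minorant of
  \<open>f\<close> with value \<open>c\<close> at \<open>\<xi>\<^sub>0\<close>.\<close>

lemma minorant_of_separation:
  assumes f: "proper_convex_on L' f" and \<xi>0: "\<xi>\<^sub>0 \<in> L'" and \<eta>: "\<eta> \<in> L" and b: "0 < b"
    and sep: "\<forall>\<xi>\<in>L'. \<forall>s. f \<xi> \<le> ereal s \<longrightarrow> 1 \<le> pairing M \<eta> \<xi> - pairing M \<eta> \<xi>\<^sub>0 + b * (s - c)"
  shows "\<exists>\<theta>\<in>L. convex_conjugate M L' f \<theta> \<le> ereal (pairing M \<theta> \<xi>\<^sub>0 - c)"
proof (intro bexI conjugate_le[OF f])
  let ?\<theta> = "\<lambda>\<omega>. (- 1 / b) * \<eta> \<omega>"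
  show "?\<theta> \<in> L" by (rule space_scale[OF \<eta>])
  fix \<xi> s assume "\<xi> \<in> L'" "f \<xi> = ereal s"
  then have "1 \<le> pairing M \<eta> \<xi> - pairing M \<eta> \<xi>\<^sub>0 + b * (s - c)" using sep by simp
  then have "0 \<le> (pairing M \<eta> \<xi> - pairing M \<eta> \<xi>\<^sub>0 + b * (s - c)) / b" using b by simp
  also have "\<dots> = pairing M \<eta> \<xi> / b - pairing M \<eta> \<xi>\<^sub>0 / b + (s - c)" using b by (simp add: add_divide_distrib diff_divide_distrib)
  finally show "pairing M ?\<theta> \<xi> - s \<le> pairing M ?\<theta> \<xi>\<^sub>0 - c" unfolding pairing_scale by simp
qed

text \<open>For each real \<open>c\<close> below \<open>f \<xi>\<^sub>0\<close> an affine minorant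
  is needed whose value at \<open>\<xi>\<^sub>0\<close> is at least \<open>c\<close>. Separation
  gives it unless the hyperplane is vertical, as may happen where \<open>f\<close> is infinite; then
  a minorant obtained at a point of finite value is tilted by a multiple of the vertical
  functional.\<close>

lemma weak_imp_dual_rep:
  assumes f: "proper_convex_on L' f" and weak: "lower_semicontinuous (weak_topology M L' L) f" and \<xi>0: "\<xi>\<^sub>0 \<in> L'"
  shows "f \<xi>\<^sub>0 = (SUP \<eta>\<in>L. ereal (pairing M \<eta> \<xi>\<^sub>0) - convex_conjugate M L' f \<eta>)"
proof (rule antisym)
  show "(SUP \<eta>\<in>L. ereal (pairing M \<eta> \<xi>\<^sub>0) - convex_conjugate M L' f \<eta>) \<le> f \<xi>\<^sub>0"
    by (intro SUP_least fenchel_inequality[OF f \<xi>0])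
  have minorant: "\<exists>\<theta>\<in>L. convex_conjugate M L' f \<theta> \<le> ereal (pairing M \<theta> \<xi>\<^sub>0 - c)" if c: "ereal c < f \<xi>\<^sub>0" for c
  proof -
    obtain \<eta> b where \<eta>: "\<eta> \<in> L" "0 \<le> b"
      "\<forall>\<xi>\<in>L'. \<forall>s. f \<xi> \<le> ereal s \<longrightarrow> 1 \<le> pairing M \<eta> \<xi> - pairing M \<eta> \<xi>\<^sub>0 + b * (s - c)"
      using epigraph_separation[OF f weak \<xi>0 c] by blast
    show ?thesis
    proof (cases "b = 0")
      case False
      then show ?thesis using minorant_of_separation[OF f \<xi>0 \<eta>(1) _ \<eta>(3)] \<eta>(2) by simp
    next
      case True
      obtain \<xi>1 t where \<xi>1: "\<xi>1 \<in> L'" "f \<xi>1 = ereal t"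
      proof -
        obtain \<xi> where "\<xi> \<in> L'" "f \<xi> \<noteq> \<infinity>" "f \<xi> \<noteq> - \<infinity>" using f unfolding proper_convex_on_def by blast
        then show ?thesis using that by (cases "f \<xi>") auto
      qed
      \<comment> \<open>Below a finite value the hyperplane cannot be vertical: inserting
        \<open>\<xi> = \<xi>1\<close> and \<open>s = t\<close> leaves
        \<open>1 \<le> b1\<close>.\<close>
      have "ereal (t - 1) < f \<xi>1" using \<xi>1(2) by simp
      from epigraph_separation[OF f weak \<xi>1(1) this] obtain \<eta>1 b1 where \<eta>1: "\<eta>1 \<in> L" "0 \<le> b1"
        "\<forall>\<xi>\<in>L'. \<forall>s. f \<xi> \<le> ereal s \<longrightarrow> 1 \<le> pairing M \<eta>1 \<xi> - pairing M \<eta>1 \<xi>1 + b1 * (s - (t - 1))" by blast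
      have "1 \<le> b1" using \<eta>1(3) \<xi>1 by force
      then obtain \<theta> where \<theta>: "\<theta> \<in> L" "convex_conjugate M L' f \<theta> \<le> ereal (pairing M \<theta> \<xi>1 - (t - 1))"
        using minorant_of_separation[OF f \<xi>1(1) \<eta>1(1) _ \<eta>1(3)] by auto
      define a where "a = pairing M \<theta> \<xi>1 - (t - 1)"
      \<comment> \<open>The minorant with slope \<open>\<theta>\<close> and constant
        \<open>- a\<close> may fall short of \<open>c\<close> at \<open>\<xi>\<^sub>0\<close>, and
        \<open>r\<close> is this shortfall. Where \<open>f\<close> is finite, \<open>\<eta>\<close>
        exceeds its value at \<open>\<xi>\<^sub>0\<close> by at least 1, so subtracting
        \<open>r * \<eta>\<close> makes up for it.\<close>
      define r where "r = max 0 (a - pairing M \<theta> \<xi>\<^sub>0 + c)"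
      let ?\<eta> = "\<lambda>\<omega>. 1 * \<theta> \<omega> + (- r) * \<eta> \<omega>"
      have "convex_conjugate M L' f ?\<eta> \<le> ereal (pairing M ?\<eta> \<xi>\<^sub>0 - c)"
      proof (rule conjugate_le[OF f])
        fix \<xi> s assume \<xi>: "\<xi> \<in> L'" "f \<xi> = ereal s"
        have "ereal (pairing M \<theta> \<xi>) - f \<xi> \<le> convex_conjugate M L' f \<theta>"
          unfolding convex_conjugate_def by (rule SUP_upper[OF \<xi>(1)])
        then have 1: "pairing M \<theta> \<xi> - s \<le> a" using \<theta>(2) \<xi>(2) unfolding a_def by (metis ereal_less_eq(3) ereal_minus(1) order_trans)
        have "1 \<le> pairing M \<eta> \<xi> - pairing M \<eta> \<xi>\<^sub>0" 
          using \<eta>(3)[rule_format, OF \<xi>(1), of s] \<xi>(2) True by simp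
        then have "r * 1 \<le> r * (pairing M \<eta> \<xi> - pairing M \<eta> \<xi>\<^sub>0)" by (intro mult_left_mono) (auto simp: r_def)
        then have 2: "r \<le> r * pairing M \<eta> \<xi> - r * pairing M \<eta> \<xi>\<^sub>0" by (simp add: right_diff_distrib)
        have 3: "a - pairing M \<theta> \<xi>\<^sub>0 + c \<le> r" unfolding r_def by simp
        show "pairing M ?\<eta> \<xi> - s \<le> pairing M ?\<eta> \<xi>\<^sub>0 - c"
          unfolding pairing_combine_left[OF \<theta>(1) \<eta>(1) \<xi>(1)] pairing_combine_left[OF \<theta>(1) \<eta>(1) \<xi>0] using 1 2 3 by simp
      qed
      moreover have "?\<eta> \<in> L" by (intro space_add space_scale \<theta>(1) \<eta>(1))
      ultimately show ?thesis by blast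
    qed
  qed
  show "f \<xi>\<^sub>0 \<le> (SUP \<eta>\<in>L. ereal (pairing M \<eta> \<xi>\<^sub>0) - convex_conjugate M L' f \<eta>)"
  proof (rule dense_le)
    fix z assume "z < f \<xi>\<^sub>0"
    then obtain c :: real where c: "z < ereal c" "ereal c < f \<xi>\<^sub>0" using ereal_dense2 by blast
    obtain \<theta> where \<theta>: "\<theta> \<in> L" "convex_conjugate M L' f \<theta> \<le> ereal (pairing M \<theta> \<xi>\<^sub>0 - c)" using minorant[OF c(2)] by blast
    have "ereal c \<le> ereal (pairing M \<theta> \<xi>\<^sub>0) - convex_conjugate M L' f \<theta>"
      using \<theta>(2) by (cases "convex_conjugate M L' f \<theta>") auto
    also have "\<dots> \<le> (SUP \<eta>\<in>L. ereal (pairing M \<eta> \<xi>\<^sub>0) - convex_conjugate M L' f \<eta>)" by (rule SUP_upper[OF \<theta>(1)])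
    finally show "z \<le> (SUP \<eta>\<in>L. ereal (pairing M \<eta> \<xi>\<^sub>0) - convex_conjugate M L' f \<eta>)" using c(1) by (simp add: less_imp_le order_trans)
  qed
qed

end

theorem theorem4p4:
  fixes M :: "'a measure" and \<Phi> :: "real \<Rightarrow> real" and f :: "('a \<Rightarrow> real) \<Rightarrow> ereal"
  assumes "prob_space M"
    and "young_function \<Phi>"
    and "Delta2 \<Phi>"
    and "ae_invariant_on M (orlicz_space M (young_conjugate \<Phi>)) f"
    and "proper_convex_on (orlicz_space M (young_conjugate \<Phi>)) f"
  defines "L \<equiv> orlicz_space M \<Phi>" and "L' \<equiv> orlicz_space M (young_conjugate \<Phi>)"
  defines "weak_lsc \<equiv> lower_semicontinuous (weak_topology M L' L) f"
    and "dual_rep \<equiv>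
      (\<forall>\<xi>\<in>L'. f \<xi> = (SUP \<eta>\<in>L. ereal (pairing M \<eta> \<xi>) - convex_conjugate M L' f \<eta>))"
    and "mackey_seq_lsc \<equiv> seq_lower_semicontinuous (mackey_topology M L' L) f"
    and "L0_lsc \<equiv>
      (\<forall>\<zeta>\<in>L'. lower_semicontinuous (subtopology (L0_topology M) (order_interval M \<zeta>)) f)"
    and "order_lsc \<equiv> order_lower_semicontinuous M L' f"
  shows "(weak_lsc \<longleftrightarrow> dual_rep) \<and> (L0_lsc \<longleftrightarrow> order_lsc) \<and>
         (weak_lsc \<longleftrightarrow> mackey_seq_lsc) \<and> (mackey_seq_lsc \<longleftrightarrow> L0_lsc)"
proof -
  interpret prob_space M by fact
  interpret orlicz_dual M \<Phi> by unfold_locales fact+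
  note f = assms(5)
  have "weak_lsc \<longleftrightarrow> dual_rep"
    unfolding weak_lsc_def dual_rep_def L_def L'_def using weak_imp_dual_rep[OF f] dual_rep_imp_weak[OF f] by blast
  moreover have "L0_lsc \<longleftrightarrow> order_lsc"
    unfolding L0_lsc_def order_lsc_def L'_def using L0_imp_order order_imp_L0 by blast
  moreover have "weak_lsc \<Longrightarrow> mackey_seq_lsc" "mackey_seq_lsc \<Longrightarrow> order_lsc" "order_lsc \<Longrightarrow> weak_lsc"
    unfolding weak_lsc_def mackey_seq_lsc_def order_lsc_def L_def L'_def
    by (fact weak_imp_mackey_seq mackey_seq_imp_order order_imp_weak[OF f])+
  ultimately show ?thesis by blast
qed

end
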